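(* Let $p\in(1,\infty)$, $s\in(0,1)$, let $\Omega\subset\mathbb{R}^N$ be a smooth bounded domain with $N>sp$, let $\gamma>0$, let $f\in L^1(\Omega)$ be non-negative, and let $u,v$ be weak solutions to $$(-\Delta)_p^s u=\frac{f(x)}{u^\gamma}\ \text{ in }\Omega,\qquad u>0\ \text{ in }\Omega,\qquad u=0\ \text{ in }\mathbb{R}^N\setminus\Omega. \qquad (P)$$ Assume that each of $u$ and $v$ has zero Dirichlet boundary datum in at least one of the following two senses (a function $z$ standing for $u$ or $v$): (a) $z\ge 0$ and $(z-\varepsilon)^+\in W^{s,p}_0(\Omega)$ for every $\varepsilon>0$; (b) $z^{\max\{\frac{\gamma+p-1}{p},1\}}\in W^{s,p}_0(\Omega)$. Then $u\equiv v$ (a.e.).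
   Context: For measurable $u:\mathbb{R}^N\to\mathbb{R}$ let $[u]_{D^{s,p}(\mathbb{R}^N)}:=\left(\int_{\mathbb{R}^{2N}}\frac{|u(x)-u(y)|^p}{|x-y|^{N+sp}}\,dx\,dy\right)^{1/p}$, $W^{s,p}(\mathbb{R}^N):=\{u\in L^p(\mathbb{R}^N):[u]_{D^{s,p}(\mathbb{R}^N)}<\infty\}$, and $W^{s,p}_0(\Omega):=\{u\in W^{s,p}(\mathbb{R}^N): u=0 \text{ in }\mathbb{R}^N\setminus\Omega\}$. $W^{s,p}_{\rm loc}(\Omega)$ is the set of functions $u$ with $u\in L^p(K)$ and $\int_{K\times K}\frac{|u(x)-u(y)|^p}{|x-y|^{N+sp}}\,dx\,dy<\infty$ for all $K\Subset\Omega$. $(-\Delta)^s_p$ denotes the fractional $p$-Laplacian. Weak solution of $(P)$: a function $u\in W^{s,p}_{\rm loc}(\Omega)\cap L^{p-1}(\Omega)$, with $u>0$ in $\Omega$ and $u=0$ in $\mathbb{R}^N\setminus\Omega$, such that $u^{\max\{\frac{\gamma+p-1}{p},1\}}\in W^{s,p}_0(\Omega)$, $\frac{f}{u^\gamma}\in L^1_{\rm loc}(\Omega)$, and $$\int_{\mathbb{R}^{2N}}\frac{|u(x)-u(y)|^{p-2}(u(x)-u(y))(\varphi(x)-\varphi(y))}{|x-y|^{N+sp}}\,dx\,dy=\int_\Omega\frac{f(x)}{u^\gamma}\varphi\,dx\qquad\text{for every }\varphi\in C^\infty_c(\Omega).$$ *)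

theory Defs
  imports "HOL-Analysis.Analysis"
begin

primrec C_k :: "nat \<Rightarrow> (real ^ 'n \<Rightarrow> real) \<Rightarrow> bool" where
  "C_k 0 g \<longleftrightarrow> continuous_on UNIV g"
| "C_k (Suc k) g \<longleftrightarrow>
     (\<forall>x. g differentiable at x) \<and> (\<forall>v. C_k k (\<lambda>x. frechet_derivative g (at x) v))"

definition C_infinity :: "(real ^ 'n \<Rightarrow> real) \<Rightarrow> bool" where
  "C_infinity g \<longleftrightarrow> (\<forall>k. C_k k g)"

definition test_function :: "(real ^ 'n) set \<Rightarrow> (real ^ 'n \<Rightarrow> real) \<Rightarrow> bool" where
  "test_function \<Omega> \<phi> \<longleftrightarrow>
     C_infinity \<phi> \<and> compact (closure {x. \<phi> x \<noteq> 0}) \<and> closure {x. \<phi> x \<noteq> 0} \<subseteq> \<Omega>"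

text \<open>
  Smoothness of the boundary: near each of its points the set is, after a rotation taking the
  last coordinate axis to the unit vector \<open>e\<close>, the part of the space lying strictly above the graph
  of a smooth function of the remaining coordinates. The point \<open>x - (x \<bullet> e) *\<^sub>R e\<close> is
  the orthogonal projection of \<open>x\<close> to the hyperplane normal to \<open>e\<close>; only the values of \<open>g\<close>
  on that hyperplane matter.
\<close>
definition smooth_boundary :: "(real ^ 'n) set \<Rightarrow> bool" where
  "smooth_boundary \<Omega> \<longleftrightarrow>
     (\<forall>x0 \<in> frontier \<Omega>. \<exists>r > 0. \<exists>e g. norm e = 1 \<and> C_infinity g \<and>
        \<Omega> \<inter> ball x0 r = {x \<in> ball x0 r. g (x - (x \<bullet> e) *\<^sub>R e) < x \<bullet> e})"

definition smooth_bounded_domain :: "(real ^ 'n) set \<Rightarrow> bool" where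
  "smooth_bounded_domain \<Omega> \<longleftrightarrow>
     open \<Omega> \<and> connected \<Omega> \<and> \<Omega> \<noteq> {} \<and> bounded \<Omega> \<and> smooth_boundary \<Omega>"

definition compactly_contained :: "(real ^ 'n) set \<Rightarrow> (real ^ 'n) set \<Rightarrow> bool" where
  "compactly_contained K \<Omega> \<longleftrightarrow>
     K \<in> sets lebesgue \<and> compact (closure K) \<and> closure K \<subseteq> \<Omega>"

text \<open>
  Functions are representatives of their almost-everywhere classes. The exponent \<open>q\<close> is meant to
  be positive.
\<close>
definition in_Lp :: "real \<Rightarrow> (real ^ 'n) set \<Rightarrow> (real ^ 'n \<Rightarrow> real) \<Rightarrow> bool" where
  "in_Lp q A u \<longleftrightarrow>
     set_borel_measurable lebesgue A u \<and> set_integrable lebesgue A (\<lambda>x. \<bar>u x\<bar> powr q)"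

text \<open>
  The \<open>p\<close>-th power of the Gagliardo seminorm over \<open>A \<times> A\<close>, as an extended nonnegative
  number; the seminorm itself is finite iff this is. On the diagonal, a null set, the kernel takes
  the value \<open>0\<close>.
\<close>
definition gagliardo_energy ::
    "real \<Rightarrow> real \<Rightarrow> (real ^ 'n) set \<Rightarrow> (real ^ 'n \<Rightarrow> real) \<Rightarrow> ennreal" where
  "gagliardo_energy s p A u =
     (\<integral>\<^sup>+ (x, y) \<in> A \<times> A.
        ennreal (\<bar>u x - u y\<bar> powr p / norm (x - y) powr (real CARD('n) + s * p))
      \<partial>(lebesgue \<Otimes>\<^sub>M lebesgue))"

definition in_W :: "real \<Rightarrow> real \<Rightarrow> (real ^ 'n \<Rightarrow> real) \<Rightarrow> bool" where
  "in_W s p u \<longleftrightarrow> in_Lp p UNIV u \<and> gagliardo_energy s p UNIV u < \<infinity>"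

definition in_W0 :: "real \<Rightarrow> real \<Rightarrow> (real ^ 'n) set \<Rightarrow> (real ^ 'n \<Rightarrow> real) \<Rightarrow> bool" where
  "in_W0 s p \<Omega> u \<longleftrightarrow> in_W s p u \<and> (AE x in lebesgue. x \<notin> \<Omega> \<longrightarrow> u x = 0)"

definition in_W_loc :: "real \<Rightarrow> real \<Rightarrow> (real ^ 'n) set \<Rightarrow> (real ^ 'n \<Rightarrow> real) \<Rightarrow> bool" where
  "in_W_loc s p \<Omega> u \<longleftrightarrow>
     (\<forall>K. compactly_contained K \<Omega> \<longrightarrow> in_Lp p K u \<and> gagliardo_energy s p K u < \<infinity>)"

definition in_L1_loc :: "(real ^ 'n) set \<Rightarrow> (real ^ 'n \<Rightarrow> real) \<Rightarrow> bool" where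
  "in_L1_loc \<Omega> h \<longleftrightarrow> (\<forall>K. compactly_contained K \<Omega> \<longrightarrow> set_integrable lebesgue K h)"

text \<open>
  The weak form of the fractional \<open>p\<close>-Laplacian. For a test function \<open>\<phi>\<close> on a bounded open set
  \<open>\<Omega>\<close>, and \<open>u\<close> in \<open>W\<^sup>s\<^sup>,\<^sup>p\<close> locally and in \<open>L\<^sup>p\<^sup>-\<^sup>1\<close> on \<open>\<Omega>\<close>
  and vanishing outside it, the integral converges absolutely, so that the value \<open>0\<close> of a divergent
  Bochner integral does not occur in \<open>weak_solution\<close> below.
\<close>
definition frac_p_Laplacian_form ::
    "real \<Rightarrow> real \<Rightarrow> (real ^ 'n \<Rightarrow> real) \<Rightarrow> (real ^ 'n \<Rightarrow> real) \<Rightarrow> real" where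
  "frac_p_Laplacian_form s p u \<phi> =
     (\<integral> (x, y). \<bar>u x - u y\<bar> powr (p - 2) * (u x - u y) * (\<phi> x - \<phi> y)
                 / norm (x - y) powr (real CARD('n) + s * p)
      \<partial>(lebesgue \<Otimes>\<^sub>M lebesgue))"

definition power_in_W0 ::
    "real \<Rightarrow> real \<Rightarrow> real \<Rightarrow> (real ^ 'n) set \<Rightarrow> (real ^ 'n \<Rightarrow> real) \<Rightarrow> bool" where
  "power_in_W0 s p \<gamma> \<Omega> z \<longleftrightarrow>
     in_W0 s p \<Omega> (\<lambda>x. z x powr max ((\<gamma> + p - 1) / p) 1)"

definition truncations_in_W0 ::
    "real \<Rightarrow> real \<Rightarrow> (real ^ 'n) set \<Rightarrow> (real ^ 'n \<Rightarrow> real) \<Rightarrow> bool" where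
  "truncations_in_W0 s p \<Omega> z \<longleftrightarrow>
     (AE x in lebesgue. 0 \<le> z x) \<and> (\<forall>\<epsilon> > 0. in_W0 s p \<Omega> (\<lambda>x. max (z x - \<epsilon>) 0))"

definition weak_solution ::
    "real \<Rightarrow> real \<Rightarrow> real \<Rightarrow> (real ^ 'n) set \<Rightarrow> (real ^ 'n \<Rightarrow> real) \<Rightarrow> (real ^ 'n \<Rightarrow> real) \<Rightarrow> bool"
where
  "weak_solution s p \<gamma> \<Omega> f u \<longleftrightarrow>
     in_W_loc s p \<Omega> u \<and> in_Lp (p - 1) \<Omega> u \<and>
     (AE x in lebesgue. x \<in> \<Omega> \<longrightarrow> 0 < u x) \<and>
     (AE x in lebesgue. x \<notin> \<Omega> \<longrightarrow> u x = 0) \<and>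
     power_in_W0 s p \<gamma> \<Omega> u \<and>
     in_L1_loc \<Omega> (\<lambda>x. f x / u x powr \<gamma>) \<and>
     (\<forall>\<phi>. test_function \<Omega> \<phi> \<longrightarrow>
        frac_p_Laplacian_form s p u \<phi> = (LINT x:\<Omega>|lebesgue. f x / u x powr \<gamma> * \<phi> x))"

end

theory Submission
  imports Defs
begin

text \<open>
  Since \<open>t \<mapsto> (t - \<epsilon>)\<^sup>+\<close> is Lipschitz as a function of \<open>t\<^sup>\<alpha>\<close> for \<open>\<alpha> \<ge> 1\<close>, the condition on
  the power of \<open>u\<close> puts \<open>z = (u - \<epsilon>)\<^sup>+\<close> in \<open>W\<^sup>s\<^sup>,\<^sup>p\<close>. The smooth boundary makes \<open>z\<close> a limit of bounded
  functions of finite energy with compact support in \<open>\<Omega>\<close>; let \<open>z\<^sub>n\<close> be their truncations between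
  \<open>0\<close> and \<open>z\<close>. Both equations may be tested with \<open>w\<^sub>n = (z\<^sub>n - v)\<^sup>+\<close>, and as \<open>u \<ge> v\<close> where
  \<open>w\<^sub>n > 0\<close>, the difference of the two right-hand sides is \<open>\<le> 0\<close>. With \<open>J t = \<bar>t\<bar>\<^sup>p\<^sup>-\<^sup>2 t\<close> and \<open>\<delta>\<close> for
  increments, monotonicity of \<open>J\<close> gives the pointwise bound
  \<open>(J \<delta>u - J \<delta>v) \<delta>w\<^sub>n \<ge> - (J \<delta>z - J \<delta>z\<^sub>n) (\<delta>z - \<delta>z\<^sub>n)\<close>, whose right-hand side tends to \<open>0\<close> in
  \<open>L\<^sup>1\<close> and does not involve the uncontrolled increments of \<open>v\<close>. Fatou's lemma on
  \<open>\<Omega> \<times> (\<real>\<^sup>N - \<Omega>)\<close> then yields \<open>u - \<epsilon> \<le> v\<close>, and the roles of \<open>u\<close> and \<open>v\<close> may be exchanged.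
\<close>

section \<open>Smooth bump functions and convolution\<close>

text \<open>A solution has finite energy only locally in \<Omega>; globally just a power of it is
  controlled. Hence (z - v)^+ cannot be tested directly, since its increments involve those of v up
  to the boundary. For each n the compact support of w_n makes the local energy of v suffice, and
  the pointwise bound keeps the passage to the limit free of v. Mollification occurs twice: centred
  and smooth, to pass from test functions to bounded compactly supported functions of finite energy;
  off centre, to push supports into \<Omega> along inner cones. By Jensen it never increases the
  energy, so a.e. convergence upgrades to convergence in energy. The a.e. convergence comes from
  mollifiers bounded by B_k |h|^(-q) with summable B_k and q = N + s p: the energy then bounds the
  L^p errors. The kernel enters through q > N (tails) and q < N + p (Lipschitz cutoffs). The final
  set \<Omega> x (R^N - \<Omega>) is chosen because u and v vanish at the second point: increments
  become values, strict monotonicity of J gives a sign, and the complement of a bounded set has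
  positive measure.\<close>

lemma frechet_derivative_eqI:
  "(f has_derivative f') (at x) \<Longrightarrow> frechet_derivative f (at x) = f'"
  by (metis frechet_derivative_at)

lemma C_k_SucI:
  assumes "\<And>x. (f has_derivative D x) (at x)" "\<And>v. C_k k (\<lambda>x. D x v)"
  shows "C_k (Suc k) f"
  using assms frechet_derivative_eqI[OF assms(1)] by (auto simp: differentiable_def)

lemma C_k_SucD:
  assumes "C_k (Suc k) f"
  shows "(f has_derivative frechet_derivative f (at x)) (at x)"
    and "C_k k (\<lambda>x. frechet_derivative f (at x) v)"
  using assms by (auto simp: frechet_derivative_works)

lemma C_k_Suc_imp: "C_k (Suc k) f \<Longrightarrow> C_k k f"
proof (induction k arbitrary: f)
  case 0
  then show ?case
    by (auto intro!: differentiable_imp_continuous_on simp: differentiable_on_def)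
next
  case (Suc k)
  then show ?case by (metis C_k.simps(2))
qed

lemma C_k_const: "C_k k (\<lambda>x. c)"
proof (induction k arbitrary: c)
  case (Suc k)
  show ?case by (rule C_k_SucI[where D = "\<lambda>_ _. 0"]) (use Suc in auto)
qed simp

lemma C_k_add: "C_k k f \<Longrightarrow> C_k k g \<Longrightarrow> C_k k (\<lambda>x. f x + g x)"
proof (induction k arbitrary: f g)
  case (Suc k)
  note D = C_k_SucD[OF Suc.prems(1)] C_k_SucD[OF Suc.prems(2)]
  show ?case
    by (rule C_k_SucI[where D = "\<lambda>x v. frechet_derivative f (at x) v + frechet_derivative g (at x) v"])
      (use D Suc.IH in \<open>auto intro!: has_derivative_add\<close>)
qed (auto intro: continuous_intros)

lemma C_k_mult: "C_k k f \<Longrightarrow> C_k k g \<Longrightarrow> C_k k (\<lambda>x. f x * g x)"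
proof (induction k arbitrary: f g)
  case (Suc k)
  note D = C_k_SucD[OF Suc.prems(1)] C_k_SucD[OF Suc.prems(2)]
  show ?case
    by (rule C_k_SucI[where D = "\<lambda>x v. f x * frechet_derivative g (at x) v + frechet_derivative f (at x) v * g x"])
      (intro has_derivative_mult C_k_add Suc.IH D Suc.prems[THEN C_k_Suc_imp])+
qed (auto intro: continuous_intros)

lemma C_k_linear:
  assumes "bounded_linear f" shows "C_k k f"
proof (cases k)
  case (Suc n)
  show ?thesis unfolding Suc
    by (rule C_k_SucI[where D = "\<lambda>_. f"])
      (use assms in \<open>auto intro!: bounded_linear_imp_has_derivative C_k_const\<close>)
qed (use assms in \<open>auto intro: linear_continuous_on\<close>)

text \<open>For m = 0 this is the classical flat function exp(-1/t). The factor t^(-m) makes the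
  family closed under differentiation up to linear combinations, so smoothness can be proved for all
  m at once.\<close>

definition flat :: "nat \<Rightarrow> real \<Rightarrow> real" where
  "flat m t = (if t > 0 then exp (- inverse t) * inverse t ^ m else 0)"

lemma power_le_fact_exp: "0 \<le> (s::real) \<Longrightarrow> s ^ n \<le> fact n * exp s"
proof -
  assume s: "0 \<le> s"
  have "(\<Sum>k\<in>{n}. s ^ k /\<^sub>R fact k) \<le> exp s"
    unfolding exp_def by (rule sum_le_suminf) (use s summable_exp_generic[of s] in auto)
  then show ?thesis by (simp add: field_simps)
qed

text \<open>With s = 1/t, a single term of the exponential series gives s^(m+2) \<le> (m+2)! e^s.
  Two powers more than m are spent so that \<open>flat m t / t\<close> tends to 0, which is
  differentiability at the origin.\<close>

lemma flat_le: "\<bar>flat m t\<bar> \<le> fact (m + 2) * t\<^sup>2"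
proof (cases "t > 0")
  case True
  define s where "s = inverse t"
  have s: "s > 0" "t = inverse s" using True by (auto simp: s_def)
  have "exp (-s) * s ^ (m + 2) \<le> exp (-s) * (fact (m+2) * exp s)"
    using power_le_fact_exp[of s "m+2"] s by (intro mult_left_mono) auto
  also have "\<dots> = fact (m+2)" by (simp add: exp_minus)
  finally have "exp (-s) * s ^ m * s\<^sup>2 \<le> fact (m+2)" by (simp only: power_add mult.assoc)
  then have "exp (-s) * s ^ m \<le> fact (m+2) / s\<^sup>2" using s by (simp only: pos_le_divide_eq zero_less_power)
  moreover have "fact (m+2) / s\<^sup>2 = fact (m+2) * t\<^sup>2" using s by (simp add: power_inverse divide_inverse)
  ultimately show ?thesis using True by (simp add: flat_def s_def)
qed (simp add: flat_def)

lemma flat_deriv: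
  "(flat m has_real_derivative (flat (m + 2) t - m * flat (m + 1) t)) (at t)"
proof -
  consider "t > 0" | "t < 0" | "t = 0" by linarith
  then show ?thesis
  proof cases
    case 1
    have "((\<lambda>t. exp (- inverse t) * inverse t ^ m) has_real_derivative
        (flat (m + 2) t - m * flat (m + 1) t)) (at t)"
      using 1 by (auto intro!: derivative_eq_intros simp: flat_def power2_eq_square)
        (cases m; simp add: field_simps)
    then show ?thesis
      by (rule has_field_derivative_transform_within_open[where S = "{0<..}"])
        (use 1 in \<open>auto simp: flat_def\<close>)
  next
    case 2
    have "((\<lambda>t. 0) has_real_derivative (flat (m + 2) t - m * flat (m + 1) t)) (at t)"
      using 2 by (auto simp: flat_def)
    then show ?thesis
      by (rule has_field_derivative_transform_within_open[where S = "{..<0}"])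
        (use 2 in \<open>auto simp: flat_def\<close>)
  next
    case 3
    have "((\<lambda>t. flat m t / t) \<longlongrightarrow> 0) (at 0)"
    proof (rule Lim_null_comparison)
      show "\<forall>\<^sub>F t in at 0. norm (flat m t / t) \<le> fact (m + 2) * \<bar>t\<bar>"
      proof (rule eventuallyI)
        fix t :: real
        show "norm (flat m t / t) \<le> fact (m + 2) * \<bar>t\<bar>"
        proof (cases "t = 0")
          case False
          then show ?thesis using flat_le[of m t]
            by (simp add: abs_divide pos_divide_le_eq power2_eq_square abs_mult_self_eq mult.assoc)
        qed simp
      qed
    qed (auto intro!: tendsto_eq_intros)
    then show ?thesis using 3 by (simp add: has_field_derivative_iff flat_def)
  qed
qed

definition bump :: "nat \<Rightarrow> real \<Rightarrow> real ^ 'n \<Rightarrow> real" where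
  "bump m c x = flat m (1 - c * (x \<bullet> x))"

lemma bump_deriv:
  "(bump m c has_derivative (\<lambda>v. (bump (m + 2) c x + (- real m) * bump (m + 1) c x) * ((- 2 * c) * (x \<bullet> v)))) (at x)"
proof -
  have 1: "((\<lambda>x. 1 - c * (x \<bullet> x)) has_derivative (\<lambda>v. (- 2 * c) * (x \<bullet> v))) (at x)"
    by (auto intro!: derivative_eq_intros simp: inner_commute algebra_simps)
  have 2: "(flat m has_derivative (*) (bump (m + 2) c x + (- real m) * bump (m + 1) c x)) (at (1 - c * (x \<bullet> x)))"
    using flat_deriv[of m "1 - c * (x \<bullet> x)"] by (simp add: bump_def has_field_derivative_def)
  have 3: "(\<lambda>x. flat m (1 - c * (x \<bullet> x))) = bump m c" by (auto simp: bump_def)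
  show ?thesis using diff_chain_at[OF 1 2] unfolding o_def 3 .
qed

text \<open>The induction keeps m arbitrary: a directional derivative of a bump is a combination of
  bumps of index m + 1 and m + 2, times a linear function.\<close>

lemma C_k_bump: "C_k k (bump m c)"
proof (induction k arbitrary: m)
  case 0
  have "bump m c differentiable at x" for x :: "real ^ 'n" using bump_deriv by (auto simp: differentiable_def)
  then show ?case by (auto intro!: differentiable_imp_continuous_on simp: differentiable_on_def)
next
  case (Suc k)
  have "C_k k (\<lambda>x. x \<bullet> v)" for v :: "real ^ 'n"
    by (rule C_k_linear) (rule bounded_linear_inner_left)
  then show ?case using Suc
    by (intro C_k_SucI[OF bump_deriv] C_k_mult C_k_add C_k_const) auto
qed

lemma bump_eq_0: "c * (x \<bullet> x) \<ge> 1 \<Longrightarrow> bump m c x = 0"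
  by (simp add: bump_def flat_def)

lemma bump_nonneg: "bump m c x \<ge> 0"
  by (simp add: bump_def flat_def)

section \<open>Differentiation under the convolution integral\<close>

lemma uniform_continuity_compact_support:
  fixes G :: "'a::euclidean_space \<Rightarrow> real"
  assumes G: "continuous_on UNIV G" and supp: "\<And>x. norm x > R \<Longrightarrow> G x = 0" and e: "e > 0"
  shows "\<exists>d>0. \<forall>x y. dist x y < d \<longrightarrow> \<bar>G x - G y\<bar> < e"
proof -
  have "uniformly_continuous_on (cball 0 (R+1)) G"
    by (rule compact_uniformly_continuous) (use G continuous_on_subset in auto)
  then obtain d where d: "d > 0"
    "\<And>x y. x \<in> cball 0 (R+1) \<Longrightarrow> y \<in> cball 0 (R+1) \<Longrightarrow> dist y x < d \<Longrightarrow> dist (G y) (G x) < e"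
    using e unfolding uniformly_continuous_on_def by metis
  show ?thesis
  proof (intro exI[of _ "min d 1"] conjI allI impI)
    fix x y :: 'a assume xy: "dist x y < min d 1"
    show "\<bar>G x - G y\<bar> < e"
    proof (cases "norm x \<le> R \<or> norm y \<le> R")
      case True
      have "norm x \<le> norm y + dist x y" "norm y \<le> norm x + dist x y"
        by (metis add.commute dist_norm norm_triangle_sub dist_commute)+
      with True xy have "norm x \<le> R + 1" "norm y \<le> R + 1" by auto
      then show ?thesis using d(2)[of y x] xy by (auto simp: dist_real_def dist_commute)
    next
      case False
      then show ?thesis using supp[of x] supp[of y] e by simp
    qed
  qed (use d in auto)
qed

lemma compact_support_bounded:
  fixes G :: "'a::euclidean_space \<Rightarrow> real"
  assumes G: "continuous_on UNIV G" and supp: "\<And>x. norm x > R \<Longrightarrow> G x = 0"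
  obtains M where "M \<ge> 0" "\<And>x. \<bar>G x\<bar> \<le> M"
proof -
  have "compact (G ` cball 0 R)"
    by (rule compact_continuous_image) (use G continuous_on_subset in auto)
  then obtain M where M: "\<And>x. x \<in> cball 0 R \<Longrightarrow> \<bar>G x\<bar> \<le> M"
    by (metis bounded_iff compact_imp_bounded imageI real_norm_def)
  have "\<bar>G x\<bar> \<le> max M 0" for x
    using M[of x] supp[of x] by (cases "norm x \<le> R") auto
  then show ?thesis using that[of "max M 0"] by auto
qed

lemma integrable_conv:
  fixes w \<rho> :: "'a::euclidean_space \<Rightarrow> real"
  assumes "integrable lborel w" "\<rho> \<in> borel_measurable borel" "\<And>x. \<bar>\<rho> x\<bar> \<le> M"
  shows "integrable lborel (\<lambda>y. w y * \<rho> (x - y))"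
proof (rule Bochner_Integration.integrable_bound)
  show "integrable lborel (\<lambda>y. M * w y)" using assms by auto
  show "(\<lambda>y. w y * \<rho> (x - y)) \<in> borel_measurable lborel" using assms by measurable
  have "\<bar>w y\<bar> * \<bar>\<rho> (x - y)\<bar> \<le> M * \<bar>w y\<bar>" for y
    using mult_left_mono[OF assms(3)[of "x - y"], of "\<bar>w y\<bar>"] by (simp add: mult.commute)
  then show "AE y in lborel. norm (w y * \<rho> (x - y)) \<le> norm (M * w y)"
    using assms(3)[of 0] by (auto simp: abs_mult intro!: AE_I2 order.trans[OF _ mult_right_mono[OF abs_ge_self]])
qed

lemma C_infinity_frechet_derivative:
  "C_infinity \<rho> \<Longrightarrow> C_infinity (\<lambda>x. frechet_derivative \<rho> (at x) v)"
  unfolding C_infinity_def by (metis C_k.simps(2))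

lemma C_infinity_continuous: "C_infinity \<rho> \<Longrightarrow> continuous_on UNIV \<rho>"
  unfolding C_infinity_def by (metis C_k.simps(1))

lemma C_infinity_has_derivative:
  "C_infinity \<rho> \<Longrightarrow> (\<rho> has_derivative frechet_derivative \<rho> (at x)) (at x)"
  unfolding C_infinity_def by (metis C_k_SucD(1))

lemma frechet_derivative_support:
  assumes "\<And>x. norm x > R \<Longrightarrow> \<rho> x = 0" and "norm x > R"
  shows "frechet_derivative \<rho> (at x) v = 0"
proof -
  have "(\<rho> has_derivative (\<lambda>_. 0)) (at x)"
    by (rule has_derivative_transform_within_open[where s = "- cball 0 R" and f = "\<lambda>_. 0"])
      (use assms in auto)
  then show ?thesis by (simp add: frechet_derivative_eqI)
qed

lemma abs_linear_functional_le:
  fixes l :: "'a::euclidean_space \<Rightarrow> real"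
  assumes l: "linear l" and M: "\<And>i. i \<in> Basis \<Longrightarrow> \<bar>l i\<bar> \<le> M i"
  shows "\<bar>l h\<bar> \<le> (\<Sum>i\<in>Basis. M i) * norm h"
proof -
  have "l h = l (\<Sum>i\<in>Basis. (h \<bullet> i) *\<^sub>R i)" by (simp add: euclidean_representation)
  also have "\<dots> = (\<Sum>i\<in>Basis. (h \<bullet> i) * l i)" by (simp add: linear_sum[OF l] linear_cmul[OF l])
  also have "\<bar>\<dots>\<bar> \<le> (\<Sum>i\<in>Basis. norm h * M i)"
    by (intro order.trans[OF sum_abs] sum_mono) (auto simp: abs_mult intro!: mult_mono Basis_le_norm M)
  also have "\<dots> = (\<Sum>i\<in>Basis. M i) * norm h" by (subst sum_distrib_left[symmetric]) (rule mult.commute)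
  finally show ?thesis .
qed

text \<open>Compact support makes the directional derivatives uniformly continuous; the mean value
  theorem on the segment from a to a + h then bounds the remainder with d independent of a. This
  uniformity lets the remainder be integrated in \<open>conv_has_derivative\<close>.\<close>

lemma uniformly_differentiable:
  fixes \<rho> :: "real ^ 'n \<Rightarrow> real"
  assumes \<rho>: "C_infinity \<rho>" and supp: "\<And>x. norm x > R \<Longrightarrow> \<rho> x = 0" and e: "e > 0"
  shows "\<exists>d>0. \<forall>a h. norm h < d \<longrightarrow> \<bar>\<rho> (a + h) - \<rho> a - frechet_derivative \<rho> (at a) h\<bar> \<le> e * norm h"
proof -
  define D where "D = (\<lambda>a. frechet_derivative \<rho> (at a))"
  have D: "(\<rho> has_derivative D a) (at a)" for a
    using C_infinity_has_derivative[OF \<rho>] by (simp add: D_def)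
  have lin: "linear (D a)" for a using D has_derivative_linear by blast
  \<comment> \<open>The functional D (a + t h) - D a is estimated on each basis vector separately,
    and the estimates are added up.\<close>
  define e' where "e' = e / DIM(real^'n)"
  have e': "e' > 0" using e by (simp add: e'_def)
  have "\<exists>d>0. \<forall>x y. dist x y < d \<longrightarrow> \<bar>D x i - D y i\<bar> < e'" for i
  proof (rule uniform_continuity_compact_support[OF _ _ e'])
    show "continuous_on UNIV (\<lambda>x. D x i)"
      unfolding D_def by (rule C_infinity_continuous[OF C_infinity_frechet_derivative[OF \<rho>]])
    show "D x i = 0" if "norm x > R" for x
      unfolding D_def by (rule frechet_derivative_support[OF supp that])
  qed
  then obtain d where d: "\<And>i. d i > (0::real)"
    "\<And>i x y. dist x y < d i \<Longrightarrow> \<bar>D x i - D y i\<bar> < e'"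
    by metis
  define d0 where "d0 = Min (d ` Basis)"
  show ?thesis
  proof (intro exI[of _ d0] conjI allI impI)
    show "d0 > 0" using d(1) by (simp add: d0_def)
    fix a h :: "real ^ 'n" assume h: "norm h < d0"
    have "\<exists>t\<in>{0<..<1}. \<rho> (a + 1 *\<^sub>R h) - \<rho> (a + 0 *\<^sub>R h) = (\<lambda>s. D (a + t *\<^sub>R h) (s *\<^sub>R h)) (1 - 0)"
    proof (rule mvt_simple)
      fix t :: real
      have *: "((\<lambda>t. a + t *\<^sub>R h) has_derivative (\<lambda>s. s *\<^sub>R h)) (at t within {0..1})"
        by (auto intro!: derivative_eq_intros)
      show "((\<lambda>t. \<rho> (a + t *\<^sub>R h)) has_derivative (\<lambda>s. D (a + t *\<^sub>R h) (s *\<^sub>R h))) (at t within {0..1})"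
        using has_derivative_compose[OF * D] by simp
    qed simp
    then obtain t where t: "0 < t" "t < 1" "\<rho> (a + h) - \<rho> a = D (a + t *\<^sub>R h) h" by auto
    have dist: "dist (a + t *\<^sub>R h) a < d i" if "i \<in> Basis" for i
    proof -
      have "dist (a + t *\<^sub>R h) a = t * norm h" using t by (simp add: dist_norm)
      also have "\<dots> \<le> norm h" using t by (simp add: mult_left_le_one_le)
      also have "\<dots> < d i" using h that by (auto simp: d0_def)
      finally show ?thesis .
    qed
    have "\<bar>D (a + t *\<^sub>R h) h - D a h\<bar> \<le> (\<Sum>i\<in>(Basis :: (real ^ 'n) set). e') * norm h"
      using less_imp_le[OF d(2)[OF dist]] by (intro abs_linear_functional_le linear_compose_sub lin)
    then have "\<bar>\<rho> (a + h) - \<rho> a - D a h\<bar> \<le> e * norm h" by (simp add: t(3) e'_def)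
    then show "\<bar>\<rho> (a + h) - \<rho> a - frechet_derivative \<rho> (at a) h\<bar> \<le> e * norm h"
      by (simp add: D_def)
  qed
qed

lemma conv_has_derivative:
  fixes \<rho> w :: "real ^ 'n \<Rightarrow> real"
  assumes w: "integrable lborel w" and \<rho>: "C_infinity \<rho>" and supp: "\<And>x. norm x > R \<Longrightarrow> \<rho> x = 0"
  shows "((\<lambda>x. \<integral>y. w y * \<rho> (x - y) \<partial>lborel) has_derivative
      (\<lambda>v. \<integral>y. w y * frechet_derivative \<rho> (at (x - y)) v \<partial>lborel)) (at x)"
proof -
  define D where "D = (\<lambda>a. frechet_derivative \<rho> (at a))"
  have D: "(\<rho> has_derivative D a) (at a)" for a
    using C_infinity_has_derivative[OF \<rho>] by (simp add: D_def)
  have lin: "linear (D a)" for a using D has_derivative_linear by blast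
  have cD: "continuous_on UNIV (\<lambda>a. D a v)" for v
    unfolding D_def using C_infinity_continuous[OF C_infinity_frechet_derivative[OF \<rho>]] .
  have int: "integrable lborel (\<lambda>y. w y * \<rho> (x - y))" for x
  proof -
    obtain M where "\<And>x. \<bar>\<rho> x\<bar> \<le> M"
      using compact_support_bounded[OF C_infinity_continuous[OF \<rho>] supp] by metis
    then show ?thesis
      using w C_infinity_continuous[OF \<rho>] by (intro integrable_conv) (auto intro: borel_measurable_continuous_onI)
  qed
  have intD: "integrable lborel (\<lambda>y. w y * D (x - y) v)" for x v
  proof -
    have "D x v = 0" if "norm x > R" for x
      unfolding D_def by (rule frechet_derivative_support[OF supp that])
    from compact_support_bounded[OF cD this] obtain M where "\<And>x. \<bar>D x v\<bar> \<le> M" by metis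
    then show ?thesis
      using w integrable_conv[of w "\<lambda>a. D a v" M] cD by (auto intro: borel_measurable_continuous_onI)
  qed
  define L where "L = (\<lambda>v. \<integral>y. w y * D (x - y) v \<partial>lborel)"
  have linL: "linear L"
    by (rule linearI) (simp_all add: L_def linear_add[OF lin] linear_cmul[OF lin] distrib_left intD
        mult.left_commute[of _ _ "D _ _"] flip: Bochner_Integration.integral_add)
  let ?F = "\<lambda>x. \<integral>y. w y * \<rho> (x - y) \<partial>lborel"
  have "(?F has_derivative L) (at x)"
    unfolding has_derivative_at_alt
  proof (intro conjI allI impI)
    show "bounded_linear L" using linL by (simp add: linear_conv_bounded_linear)
    fix e :: real assume e: "e > 0"
    \<comment> \<open>W is the L^1 norm of w; dividing by W + 1 covers the case w = 0.\<close>
    define W where "W = (\<integral>y. \<bar>w y\<bar> \<partial>lborel)"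
    have W: "W \<ge> 0" by (simp add: W_def)
    have "e / (W + 1) > 0" using e W by simp
    then obtain d where d: "d > 0" "\<And>a h. norm h < d \<Longrightarrow> \<bar>\<rho> (a + h) - \<rho> a - D a h\<bar> \<le> e / (W + 1) * norm h"
      using uniformly_differentiable[OF \<rho> supp] unfolding D_def by blast
    show "\<exists>d>0. \<forall>y. norm (y - x) < d \<longrightarrow>
        norm (?F y - ?F x - L (y - x)) \<le> e * norm (y - x)"
    proof (intro exI[of _ d] conjI allI impI)
      fix y assume y: "norm (y - x) < d"
      define q where "q = (\<lambda>z. \<rho> (y - z) - \<rho> (x - z) - D (x - z) (y - x))"
      have q: "\<bar>q z\<bar> \<le> e / (W + 1) * norm (y - x)" for z
        using d(2)[OF y, of "x - z"] by (simp add: q_def)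
      have iq: "integrable lborel (\<lambda>z. w z * q z)"
        using int intD by (simp add: q_def right_diff_distrib)
      have "?F y - ?F x - L (y - x) = (\<integral>z. w z * q z \<partial>lborel)"
        using int intD by (simp add: q_def L_def right_diff_distrib)
      also have "norm \<dots> \<le> (\<integral>z. \<bar>w z\<bar> * (e / (W + 1) * norm (y - x)) \<partial>lborel)"
      proof (rule order.trans[OF integral_norm_bound integral_mono])
        show "integrable lborel (\<lambda>z. norm (w z * q z))" using iq by (rule integrable_norm)
        show "integrable lborel (\<lambda>z. \<bar>w z\<bar> * (e / (W + 1) * norm (y - x)))" using w by auto
        show "norm (w z * q z) \<le> \<bar>w z\<bar> * (e / (W + 1) * norm (y - x))" for z
          using mult_left_mono[OF q abs_ge_zero, of "w z" z] by (simp only: real_norm_def abs_mult)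
      qed
      also have "\<dots> = W * (e / (W + 1) * norm (y - x))" by (simp add: W_def)
      also have "\<dots> = (W / (W + 1)) * (e * norm (y - x))" by simp
      also have "\<dots> \<le> 1 * (e * norm (y - x))"
        using W e by (intro mult_right_mono) auto
      finally show "norm (?F y - ?F x - L (y - x)) \<le> e * norm (y - x)"
        by simp
    qed (use d in auto)
  qed
  then show ?thesis by (simp add: L_def D_def)
qed

text \<open>A derivative of the convolution is the convolution with a derivative of \<rho>, again
  smooth and supported in the same ball; hence an induction over k for all \<rho>, while w stays
  merely integrable.\<close>

lemma C_infinity_conv:
  fixes \<rho> w :: "real ^ 'n \<Rightarrow> real"
  assumes w: "integrable lborel w" and \<rho>: "C_infinity \<rho>" and supp: "\<And>x. norm x > R \<Longrightarrow> \<rho> x = 0"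
  shows "C_infinity (\<lambda>x. \<integral>y. w y * \<rho> (x - y) \<partial>lborel)"
proof -
  have "C_k k (\<lambda>x. \<integral>y. w y * \<rho> (x - y) \<partial>lborel)" for k
    using \<rho> supp
  proof (induction k arbitrary: \<rho>)
    case 0
    have "(\<lambda>x. \<integral>y. w y * \<rho> (x - y) \<partial>lborel) differentiable at x" for x
      using conv_has_derivative[OF w 0] by (auto simp: differentiable_def)
    then show ?case by (auto intro!: differentiable_imp_continuous_on simp: differentiable_on_def)
  next
    case (Suc k)
    show ?case
      by (rule C_k_SucI[OF conv_has_derivative[OF w Suc.prems]])
        (use Suc C_infinity_frechet_derivative frechet_derivative_support in blast)+
  qed
  then show ?thesis by (simp add: C_infinity_def)
qed

section \<open>The kernel measure\<close>

abbreviation kern :: "real \<Rightarrow> 'a::real_normed_vector \<Rightarrow> 'a \<Rightarrow> real" where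
  "kern q x y \<equiv> 1 / norm (x - y) powr q"

text \<open>Absorbing the singular kernel into the measure turns the Gagliardo seminorm into the L^p
  norm of the increments, so that general convergence theorems apply. The exponent q stands for N +
  s p. On the diagonal the density is 1 / 0 = 0.\<close>

definition kernel_measure :: "real \<Rightarrow> ('a::euclidean_space \<times> 'a) measure" where
  "kernel_measure q = density lborel (\<lambda>z. ennreal (kern q (fst z) (snd z)))"

lemma measurable_fst_borel [measurable]:
  "fst \<in> borel_measurable (borel :: ('a::euclidean_space \<times> 'b::euclidean_space) measure)"
  unfolding borel_prod[symmetric] by measurable

lemma measurable_snd_borel [measurable]:
  "snd \<in> borel_measurable (borel :: ('a::euclidean_space \<times> 'b::euclidean_space) measure)"
  unfolding borel_prod[symmetric] by measurable

lemma measurable_Pair_borel [measurable (raw)]: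
  fixes f :: "'c \<Rightarrow> 'a::euclidean_space" and g :: "'c \<Rightarrow> 'b::euclidean_space"
  assumes [measurable]: "f \<in> borel_measurable M" "g \<in> borel_measurable M"
  shows "(\<lambda>x. (f x, g x)) \<in> borel_measurable M"
  unfolding borel_prod[symmetric] by measurable

lemma sets_kernel_measure [simp, measurable_cong]: "sets (kernel_measure q) = sets borel"
  by (simp add: kernel_measure_def)

lemma space_kernel_measure [simp]: "space (kernel_measure q) = UNIV"
  by (simp add: kernel_measure_def)

lemma measurable_kernel_measure [simp]: "measurable (kernel_measure q) N = measurable borel N"
  by (rule measurable_cong_sets) auto

lemma nn_integral_kernel_measure:
  fixes F :: "'a::euclidean_space \<times> 'a \<Rightarrow> ennreal"
  assumes F [measurable]: "F \<in> borel_measurable borel"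
  shows "(\<integral>\<^sup>+ z. F z \<partial>kernel_measure q) =
    (\<integral>\<^sup>+ x. \<integral>\<^sup>+ y. ennreal (kern q x y) * F (x, y) \<partial>lborel \<partial>lborel)"
proof -
  define H where "H = (\<lambda>z. ennreal (kern q (fst z) (snd z)) * F z)"
  have H [measurable]: "H \<in> borel_measurable borel"
    unfolding H_def by measurable
  have "(\<integral>\<^sup>+ z. F z \<partial>kernel_measure q) = (\<integral>\<^sup>+ z. H z \<partial>lborel)"
    unfolding kernel_measure_def by (subst nn_integral_density) (auto simp: H_def)
  also have "\<dots> = (\<integral>\<^sup>+ x. \<integral>\<^sup>+ y. H (x, y) \<partial>lborel \<partial>lborel)"
    unfolding lborel_prod[symmetric]
    by (subst lborel.nn_integral_fst[symmetric]) (use H in \<open>auto simp: lborel_prod\<close>)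
  finally show ?thesis by (simp add: H_def)
qed

lemma nn_integral_lborel_shift:
  fixes g :: "'a::euclidean_space \<Rightarrow> ennreal"
  assumes [measurable]: "g \<in> borel_measurable borel"
  shows "(\<integral>\<^sup>+ x. g (x + c) \<partial>lborel) = (\<integral>\<^sup>+ x. g x \<partial>lborel)"
proof -
  have "(\<integral>\<^sup>+ x. g x \<partial>lborel) = (\<integral>\<^sup>+ x. g x \<partial>distr lborel borel ((+) c))"
    by (simp only: lborel_distr_plus)
  also have "\<dots> = (\<integral>\<^sup>+ x. g (x + c) \<partial>lborel)"
    by (subst nn_integral_distr) (auto simp: add.commute)
  finally show ?thesis ..
qed

lemma distr_lborel_reflect: "distr lborel borel (\<lambda>x. c - x) = (lborel :: 'a::euclidean_space measure)"
  using lborel_affine[of "-1" c] by (simp add: density_1)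

lemma nn_integral_lborel_reflect:
  fixes g :: "'a::euclidean_space \<Rightarrow> ennreal"
  assumes [measurable]: "g \<in> borel_measurable borel"
  shows "(\<integral>\<^sup>+ x. g (c - x) \<partial>lborel) = (\<integral>\<^sup>+ x. g x \<partial>lborel)"
  by (subst (2) distr_lborel_reflect[of c, symmetric], subst nn_integral_distr) auto

lemma integral_lborel_reflect:
  fixes g :: "'a::euclidean_space \<Rightarrow> real"
  assumes [measurable]: "g \<in> borel_measurable borel"
  shows "(\<integral>x. g (c - x) \<partial>lborel) = (\<integral>x. g x \<partial>lborel)"
  by (subst (2) distr_lborel_reflect[of c, symmetric], subst integral_distr) auto

lemma nn_integral_kernel_measure_swap:
  fixes F :: "'a::euclidean_space \<times> 'a \<Rightarrow> ennreal"
  assumes F [measurable]: "F \<in> borel_measurable borel"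
  shows "(\<integral>\<^sup>+ z. F (snd z, fst z) \<partial>kernel_measure q) = (\<integral>\<^sup>+ z. F z \<partial>kernel_measure q)"
proof -
  define H where "H = (\<lambda>z. ennreal (kern q (fst z) (snd z)) * F z)"
  have "H \<in> borel_measurable borel"
    unfolding H_def by measurable
  then have H [measurable]: "H \<in> borel_measurable (lborel \<Otimes>\<^sub>M lborel)"
    unfolding lborel_prod by simp
  have F': "(\<lambda>z. F (snd z, fst z)) \<in> borel_measurable borel"
    by measurable
  have "(\<integral>\<^sup>+ z. F (snd z, fst z) \<partial>kernel_measure q) = (\<integral>\<^sup>+ x. \<integral>\<^sup>+ y. H (y, x) \<partial>lborel \<partial>lborel)"
    by (subst nn_integral_kernel_measure[OF F']) (simp add: H_def norm_minus_commute)
  also have "\<dots> = (\<integral>\<^sup>+ x. \<integral>\<^sup>+ y. H (x, y) \<partial>lborel \<partial>lborel)"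
    by (rule lborel_pair.Fubini'[OF _]) (use H in \<open>simp\<close>)
  also have "\<dots> = (\<integral>\<^sup>+ z. F z \<partial>kernel_measure q)"
    by (simp add: nn_integral_kernel_measure H_def)
  finally show ?thesis .
qed

lemma nn_integral_kernel_measure_shift:
  fixes F :: "'a::euclidean_space \<times> 'a \<Rightarrow> ennreal"
  assumes F [measurable]: "F \<in> borel_measurable borel"
  shows "(\<integral>\<^sup>+ z. F (fst z - h, snd z - h) \<partial>kernel_measure q) = (\<integral>\<^sup>+ z. F z \<partial>kernel_measure q)"
proof -
  define H where "H = (\<lambda>z. ennreal (kern q (fst z) (snd z)) * F z)"
  have H [measurable]: "H \<in> borel_measurable borel"
    unfolding H_def by measurable
  have F': "(\<lambda>z. F (fst z - h, snd z - h)) \<in> borel_measurable borel"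
    by measurable
  have "(\<integral>\<^sup>+ z. F (fst z - h, snd z - h) \<partial>kernel_measure q) = (\<integral>\<^sup>+ z. H (z + (-h, -h)) \<partial>lborel)"
    unfolding kernel_measure_def
    by (subst nn_integral_density) (auto simp: H_def plus_prod_def)
  also have "\<dots> = (\<integral>\<^sup>+ z. H z \<partial>lborel)"
    by (rule nn_integral_lborel_shift) measurable
  also have "\<dots> = (\<integral>\<^sup>+ z. F z \<partial>kernel_measure q)"
    unfolding kernel_measure_def
    by (subst nn_integral_density) (auto simp: H_def)
  finally show ?thesis .
qed

lemma AE_lborel_pair:
  fixes P :: "'a::euclidean_space \<Rightarrow> bool"
  assumes "AE x in lborel. P x"
  shows "AE z in lborel. P (fst z) \<and> P (snd (z :: 'a \<times> 'a))"
proof -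
  obtain N where N: "N \<in> null_sets lborel" "{x. \<not> P x} \<subseteq> N"
    using assms by (auto elim!: AE_E simp: null_sets_def)
  have "N \<times> UNIV \<in> null_sets (lborel \<Otimes>\<^sub>M (lborel :: 'a measure))"
    using N by (auto simp: null_sets_def lborel.emeasure_pair_measure_Times)
  moreover have "UNIV \<times> N \<in> null_sets ((lborel :: 'a measure) \<Otimes>\<^sub>M lborel)"
    using N by (auto simp: null_sets_def lborel.emeasure_pair_measure_Times)
  ultimately have "N \<times> UNIV \<union> UNIV \<times> N \<in> null_sets (lborel :: ('a \<times> 'a) measure)"
    unfolding lborel_prod by (rule null_sets.Un)
  then show ?thesis
    by (rule AE_I') (use N in auto)
qed

lemma AE_kernel_measureI:
  "AE z in lborel. P z \<Longrightarrow> AE z in kernel_measure q. P z"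
  unfolding kernel_measure_def by (auto simp: AE_density)

lemma AE_kernel_measure_pair:
  "AE x in lborel. P x \<Longrightarrow> AE z in kernel_measure q. P (fst z) \<and> P (snd z)"
  by (intro AE_kernel_measureI AE_lborel_pair)

abbreviation incr :: "('a \<Rightarrow> real) \<Rightarrow> 'a \<times> 'a \<Rightarrow> real" where
  "incr u z \<equiv> u (fst z) - u (snd z)"

abbreviation local_energy :: "real \<Rightarrow> real \<Rightarrow> 'a::euclidean_space set \<Rightarrow> ('a \<Rightarrow> real) \<Rightarrow> ennreal" where
  "local_energy q p K u \<equiv>
     \<integral>\<^sup>+ z. indicator (K \<times> K) z * ennreal (\<bar>incr u z\<bar> powr p) \<partial>kernel_measure q"

definition energy :: "real \<Rightarrow> real \<Rightarrow> ('a::euclidean_space \<Rightarrow> real) \<Rightarrow> ennreal" where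
  "energy q p u = (\<integral>\<^sup>+ z. ennreal (\<bar>incr u z\<bar> powr p) \<partial>kernel_measure q)"

section \<open>Integrability of the kernel at infinity and near the diagonal\<close>

lemma dyadic_scale:
  assumes "(x::real) \<ge> 1"
  obtains k where "2 ^ k \<le> x" "x < 2 ^ Suc k"
proof -
  have ex: "\<exists>n. x < 2 ^ n" using real_arch_pow[of 2 x] by auto
  define n where "n = (LEAST n. x < 2 ^ n)"
  have n: "x < 2 ^ n" unfolding n_def using ex by (rule LeastI_ex)
  then have "n \<noteq> 0" using assms by (auto intro: ccontr)
  then obtain k where k: "n = Suc k" by (cases n) auto
  have "\<not> x < 2 ^ k" using k not_less_Least[of k "\<lambda>n. x < 2 ^ n"] by (simp add: n_def)
  then show ?thesis using that[of k] n k by simp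
qed

text \<open>At each point g is at most one term of the series of c_k times the indicator of the ball
  of radius r_k. The integral of that term is c_k times the volume of the ball, so the hypothesis
  makes the integrated series geometric.\<close>

lemma nn_integral_le_shells:
  fixes g :: "'a::euclidean_space \<Rightarrow> ennreal" and b r c C :: "nat \<Rightarrow> real"
  assumes "\<And>h. g h \<noteq> 0 \<Longrightarrow> \<exists>k. norm h \<le> r k \<and> g h \<le> ennreal (c k)"
    and r: "\<And>k. r k \<ge> 0" and c: "\<And>k. c k \<ge> 0"
    and eq: "\<And>k. c k * r k ^ DIM('a) \<le> K * \<theta> ^ k" and K: "0 \<le> K" "0 \<le> \<theta>" "\<theta> < 1"
  shows "(\<integral>\<^sup>+ h. g h \<partial>lborel) \<le> ennreal (K * unit_ball_vol DIM('a) / (1 - \<theta>))"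
proof -
  have *: "g h \<le> (\<Sum>k. ennreal (c k) * indicator (cball 0 (r k)) h)" for h
  proof (cases "g h = 0")
    case False
    then obtain k where k: "norm h \<le> r k" "g h \<le> ennreal (c k)" using assms(1) by blast
    then have "g h \<le> (\<Sum>k\<in>{k}. ennreal (c k) * indicator (cball 0 (r k)) h)" by simp
    also have "\<dots> \<le> (\<Sum>k. ennreal (c k) * indicator (cball 0 (r k)) h)"
      by (rule sum_le_suminf) auto
    finally show ?thesis .
  qed simp
  have "(\<integral>\<^sup>+ h. g h \<partial>lborel) \<le> (\<integral>\<^sup>+ h. (\<Sum>k. ennreal (c k) * indicator (cball 0 (r k)) (h::'a)) \<partial>lborel)"
    by (intro nn_integral_mono *)
  also have "\<dots> = (\<Sum>k. ennreal (c k) * emeasure lborel (cball (0::'a) (r k)))"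
  proof (subst nn_integral_suminf)
    have "(\<integral>\<^sup>+ h. ennreal (c i) * indicator (cball (0::'a) (r i)) h \<partial>lborel) = ennreal (c i) * emeasure lborel (cball (0::'a) (r i))" for i
      by (rule nn_integral_cmult_indicator) simp
    then show "(\<Sum>i. \<integral>\<^sup>+ h. ennreal (c i) * indicator (cball (0::'a) (r i)) h \<partial>lborel) = (\<Sum>k. ennreal (c k) * emeasure lborel (cball (0::'a) (r k)))"
      by (rule arg_cong[where f = suminf, OF ext])
    have "cball (0::'a) (r i) \<in> sets borel" for i by simp
    then show "(\<lambda>h. ennreal (c i) * indicator (cball (0::'a) (r i)) h) \<in> borel_measurable lborel" for i
      by measurable
  qed
  also have "\<dots> \<le> (\<Sum>k. ennreal (K * unit_ball_vol DIM('a) * \<theta> ^ k))"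
  proof (intro suminf_le summableI)
    fix k
    have "ennreal (c k) * emeasure lborel (cball (0::'a) (r k)) = ennreal (unit_ball_vol DIM('a) * (c k * r k ^ DIM('a)))"
      using r c by (simp add: emeasure_cball ennreal_mult[symmetric] mult_ac)
    also have "\<dots> \<le> ennreal (unit_ball_vol DIM('a) * (K * \<theta> ^ k))"
      by (intro ennreal_leI mult_left_mono eq) auto
    finally show "ennreal (c k) * emeasure lborel (cball (0::'a) (r k)) \<le> ennreal (K * unit_ball_vol DIM('a) * \<theta> ^ k)"
      by (simp add: mult_ac)
  qed
  also have "\<dots> = ennreal (\<Sum>k. K * unit_ball_vol DIM('a) * \<theta> ^ k)"
    using K by (intro suminf_ennreal2) (auto intro!: summable_mult summable_geometric)
  also have "(\<Sum>k. K * unit_ball_vol DIM('a) * \<theta> ^ k) = K * unit_ball_vol DIM('a) / (1 - \<theta>)"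
    using K by (simp add: suminf_mult suminf_geometric summable_geometric)
  finally show ?thesis .
qed

lemma powr_of_power2: "((2::real) ^ k) powr a = (2 powr a) ^ k"
  by (simp add: powr_power powr_realpow[symmetric] powr_powr mult.commute)

text \<open>On the shell d 2^k \<le> |h| < d 2^(k+1) the kernel is at most (d 2^k)^(-q) and the
  volume of order (d 2^k)^N; the ratio 2^(N - q) is below 1 because q > N.\<close>

lemma kernel_tail_0:
  assumes q: "q > real DIM('a::euclidean_space)" and d: "d > 0"
  shows "\<exists>C\<ge>0. (\<integral>\<^sup>+ h. indicator {h. d \<le> norm h} h * ennreal (1 / norm (h::'a) powr q) \<partial>lborel) \<le> ennreal C"
proof -
  define N where "N = DIM('a)"
  define K where "K = (1 / d powr q) * (2 * d) ^ N"
  have "(\<integral>\<^sup>+ h. indicator {h. d \<le> norm h} h * ennreal (1 / norm (h::'a) powr q) \<partial>lborel)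
    \<le> ennreal (K * unit_ball_vol DIM('a) / (1 - 2 powr (real N - q)))"
  proof (rule nn_integral_le_shells[where r = "\<lambda>k. d * 2 ^ Suc k" and c = "\<lambda>k. 1 / (d * 2 ^ k) powr q"])
    fix h :: 'a assume "indicator {h. d \<le> norm h} h * ennreal (1 / norm h powr q) \<noteq> 0"
    then have h: "d \<le> norm h" by (auto simp: indicator_def split: if_splits)
    with d obtain k where k: "2 ^ k \<le> norm h / d" "norm h / d < 2 ^ Suc k"
      using dyadic_scale[of "norm h / d"] by (auto simp: field_simps)
    have "d * 2 ^ k \<le> norm h" "norm h \<le> d * 2 ^ Suc k" using k d by (auto simp: field_simps)
    moreover have "0 < d * 2 ^ k" using d by simp
    moreover from calculation have "1 / norm h powr q \<le> 1 / (d * 2 ^ k) powr q"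
      using q by (intro divide_left_mono powr_mono2 mult_pos_pos[OF powr_gt_zero[THEN iffD2] powr_gt_zero[THEN iffD2]])
        linarith+
    ultimately show "\<exists>k. norm h \<le> d * 2 ^ Suc k \<and> indicator {h. d \<le> norm h} h * ennreal (1 / norm h powr q) \<le> ennreal (1 / (d * 2 ^ k) powr q)"
      by (intro exI[of _ k]) (auto simp: indicator_def intro: ennreal_leI)
  next
    fix k
    have "1 / (d * 2 ^ k) powr q * (d * 2 ^ Suc k) ^ N = K * ((2 ^ k) ^ N / (2 ^ k) powr q)"
      using d by (simp add: K_def powr_mult power_mult_distrib)
    also have "(2 ^ k) ^ N / (2 ^ k) powr q = (2 powr (real N - q)) ^ k"
      by (simp add: powr_of_power2 powr_diff power_divide powr_realpow flip: power_mult)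
    finally show "1 / (d * 2 ^ k) powr q * (d * 2 ^ Suc k) ^ DIM('a) \<le> K * (2 powr (real N - q)) ^ k"
      by (simp add: N_def)
  qed (use d q in \<open>auto simp: K_def N_def powr_less_one\<close>)
  moreover have "0 \<le> K * unit_ball_vol DIM('a) / (1 - 2 powr (real N - q))"
    using d q powr_less_one[of 2 "real N - q"] by (auto simp: K_def N_def)
  ultimately show ?thesis by blast
qed

text \<open>The shells are now 2^(-k-1) < |h| \<le> 2^(-k), and the geometric ratio is 2^(q - p -
  N). For q = N + s p the condition q < p + N is s < 1.\<close>

lemma kernel_near_0:
  assumes q: "q < p + real DIM('a::euclidean_space)" "0 < q" and p: "0 < p"
  shows "\<exists>C\<ge>0. (\<integral>\<^sup>+ h. indicator {h. norm h \<le> 1} h * ennreal (norm h powr p / norm (h::'a) powr q) \<partial>lborel) \<le> ennreal C"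
proof -
  define N where "N = DIM('a)"
  define \<theta> where "\<theta> = (2::real) powr (q - p - real N)"
  have "(\<integral>\<^sup>+ h. indicator {h. norm h \<le> 1} h * ennreal (norm h powr p / norm (h::'a) powr q) \<partial>lborel)
    \<le> ennreal (2 powr q * unit_ball_vol DIM('a) / (1 - \<theta>))"
  proof (rule nn_integral_le_shells[where r = "\<lambda>k. 1 / 2 ^ k" and c = "\<lambda>k. (1 / 2 ^ k) powr p * (2 ^ Suc k) powr q"])
    fix h :: 'a assume "indicator {h. norm h \<le> 1} h * ennreal (norm h powr p / norm h powr q) \<noteq> 0"
    then have h: "norm h \<le> 1" "norm h > 0" by (auto simp: indicator_def split: if_splits)
    then obtain k where k: "2 ^ k \<le> 1 / norm h" "1 / norm h < 2 ^ Suc k"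
      using dyadic_scale[of "1 / norm h"] by (auto simp: field_simps)
    have 1: "norm h \<le> 1 / 2 ^ k" using k h by (auto simp: field_simps)
    have "norm h powr p / norm h powr q = norm h powr p * (1 / norm h) powr q"
      using h by (simp add: powr_divide)
    also have "\<dots> \<le> (1 / 2 ^ k) powr p * (2 ^ Suc k) powr q"
      using k h p q 1 by (intro mult_mono powr_mono2) auto
    finally have "norm h powr p / norm h powr q \<le> (1 / 2 ^ k) powr p * (2 ^ Suc k) powr q" .
    with 1 show "\<exists>k. norm h \<le> 1 / 2 ^ k \<and> indicator {h. norm h \<le> 1} h * ennreal (norm h powr p / norm h powr q) \<le> ennreal ((1 / 2 ^ k) powr p * (2 ^ Suc k) powr q)"
      by (intro exI[of _ k]) (auto simp: indicator_def intro: ennreal_leI)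
  next
    fix k
    have "(1 / 2 ^ k) powr p * (2 ^ Suc k) powr q * (1 / 2 ^ k) ^ N = 2 powr q * ((2 ^ k) powr q / ((2 ^ k) powr p * (2 ^ k) ^ N))"
      by (simp add: powr_divide powr_mult power_divide)
    also have "(2 ^ k) powr q / ((2 ^ k) powr p * (2 ^ k) ^ N) = \<theta> ^ k"
      by (simp add: powr_of_power2 powr_diff power_divide powr_realpow \<theta>_def flip: power_mult)
        (simp add: mult.commute power_mult power_mult_distrib)
    finally show "(1 / 2 ^ k) powr p * (2 ^ Suc k) powr q * (1 / 2 ^ k) ^ DIM('a) \<le> 2 powr q * \<theta> ^ k"
      by (simp add: N_def)
  qed (use p q in \<open>auto simp: \<theta>_def N_def powr_less_one\<close>)
  moreover have "0 \<le> 2 powr q * unit_ball_vol DIM('a) / (1 - \<theta>)"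
    using p q powr_less_one[of 2 "q - p - real N"] by (auto simp: \<theta>_def N_def)
  ultimately show ?thesis by blast
qed

lemma kernel_tail:
  assumes q: "q > real DIM('a::euclidean_space)" and d: "d > 0"
  obtains C where "C \<ge> 0" "\<And>x::'a. (\<integral>\<^sup>+ y. indicator {y. d \<le> norm (x - y)} y * ennreal (kern q x y) \<partial>lborel) \<le> ennreal C"
proof -
  obtain C where C: "C \<ge> 0" "(\<integral>\<^sup>+ h. indicator {h. d \<le> norm h} h * ennreal (1 / norm (h::'a) powr q) \<partial>lborel) \<le> ennreal C"
    using kernel_tail_0[OF q d] by blast
  have "(\<integral>\<^sup>+ y. indicator {y. d \<le> norm (x - y)} y * ennreal (kern q x y) \<partial>lborel) \<le> ennreal C" for x :: 'a
    using C(2) nn_integral_lborel_reflect[of "\<lambda>h. indicator {h. d \<le> norm h} h * ennreal (1 / norm (h::'a) powr q)" x]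
    by (simp add: indicator_def)
  then show ?thesis using C(1) that by blast
qed

text \<open>The factor min 1 |x - y| is the size of an increment of a bounded Lipschitz cutoff, up
  to a constant; this is the integral over y that appears when a function is multiplied by a
  cutoff.\<close>

lemma kernel_near:
  assumes q: "q < p + real DIM('a::euclidean_space)" "real DIM('a) < q"
  obtains C where "C \<ge> 0" "\<And>x::'a. (\<integral>\<^sup>+ y. ennreal (kern q x y) * ennreal (min 1 (norm (x - y)) powr p) \<partial>lborel) \<le> ennreal C"
proof -
  have p: "0 < p" "0 < q" using q by auto
  obtain C1 where C1: "C1 \<ge> 0" "(\<integral>\<^sup>+ h. indicator {h. 1 \<le> norm h} h * ennreal (1 / norm (h::'a) powr q) \<partial>lborel) \<le> ennreal C1"
    using kernel_tail_0[OF q(2), of 1] by auto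
  obtain C2 where C2: "C2 \<ge> 0" "(\<integral>\<^sup>+ h. indicator {h. norm h \<le> 1} h * ennreal (norm h powr p / norm (h::'a) powr q) \<partial>lborel) \<le> ennreal C2"
    using kernel_near_0[OF q(1) p(2,1)] by blast
  have "(\<integral>\<^sup>+ h. ennreal (1 / norm h powr q) * ennreal (min 1 (norm (h::'a)) powr p) \<partial>lborel) \<le>
    (\<integral>\<^sup>+ h. indicator {h. 1 \<le> norm h} h * ennreal (1 / norm (h::'a) powr q) +
       indicator {h. norm h \<le> 1} h * ennreal (norm h powr p / norm (h::'a) powr q) \<partial>lborel)"
    by (intro nn_integral_mono) (auto simp: indicator_def min_def ennreal_mult[symmetric])
  also have "\<dots> \<le> ennreal C1 + ennreal C2"
    by (subst nn_integral_add) (use C1 C2 in \<open>auto intro: add_mono\<close>)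
  finally have *: "(\<integral>\<^sup>+ h. ennreal (1 / norm h powr q) * ennreal (min 1 (norm (h::'a)) powr p) \<partial>lborel) \<le> ennreal (C1 + C2)"
    using C1 C2 by simp
  show ?thesis
  proof (rule that[of "C1 + C2"])
    show "(\<integral>\<^sup>+ y. ennreal (kern q x y) * ennreal (min 1 (norm (x - y)) powr p) \<partial>lborel) \<le> ennreal (C1 + C2)" for x :: 'a
      using * nn_integral_lborel_reflect[of "\<lambda>h. ennreal (1 / norm h powr q) * ennreal (min 1 (norm (h::'a)) powr p)" x] by simp
  qed (use C1 C2 in auto)
qed

section \<open>Varying domination, Jensen's inequality and mollification\<close>

definition signed_power :: "real \<Rightarrow> real \<Rightarrow> real" where
  "signed_power p t = \<bar>t\<bar> powr (p - 2) * t"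

text \<open>Splitting into positive and negative parts removes the factor |t|^(p-2), which is
  singular at 0 for p < 2; monotonicity and continuity are then those of powers with the positive
  exponent p - 1.\<close>

lemma signed_power_eq: "signed_power p t = max t 0 powr (p - 1) - max (- t) 0 powr (p - 1)"
proof (cases "t = 0")
  case False
  have "\<bar>t\<bar> powr (p - 1) = \<bar>t\<bar> powr (p - 2) * \<bar>t\<bar>"
    using False powr_add[of "\<bar>t\<bar>" "p - 2" 1] by simp
  then show ?thesis using False by (auto simp: signed_power_def max_def abs_if)
qed (simp add: signed_power_def)

lemma abs_signed_power: "\<bar>signed_power p t\<bar> = \<bar>t\<bar> powr (p - 1)"
  by (auto simp: signed_power_eq max_def)

lemma signed_power_mono:
  assumes "1 < p" "a \<le> b" shows "signed_power p a \<le> signed_power p b"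
  unfolding signed_power_eq using assms by (intro diff_mono powr_mono2) auto

lemma signed_power_strict_mono:
  assumes "1 < p" "a < b" shows "signed_power p a < signed_power p b"
proof (cases "b > 0")
  case True
  then have "max a 0 powr (p - 1) < max b 0 powr (p - 1)" using assms by (intro powr_less_mono2) auto
  moreover have "max (- b) 0 powr (p - 1) \<le> max (- a) 0 powr (p - 1)" using assms by (intro powr_mono2) auto
  ultimately show ?thesis unfolding signed_power_eq by linarith
next
  case False
  then have "(- b) powr (p - 1) < (- a) powr (p - 1)" using assms by (intro powr_less_mono2) auto
  then show ?thesis using False assms by (simp add: signed_power_eq max_def)
qed

lemma signed_power_measurable [measurable]: "signed_power p \<in> borel_measurable borel"
  unfolding signed_power_def[abs_def] by measurable

lemma tendsto_signed_power:
  assumes "1 < p" "(f \<longlongrightarrow> l) F" shows "((\<lambda>x. signed_power p (f x)) \<longlongrightarrow> signed_power p l) F"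
  unfolding signed_power_eq using assms
  by (intro tendsto_intros tendsto_powr2 always_eventually) auto

text \<open>A form of Young's inequality without sharp constants: the product is at most the p-th
  power of the larger of the two numbers.\<close>

lemma powr_mult_le_sum:
  fixes a b :: real
  assumes "0 \<le> a" "0 \<le> b" "1 < p"
  shows "a powr (p - 1) * b \<le> a powr p + b powr p"
proof -
  have eq: "c powr (p - 1) * c = c powr p" if "0 \<le> c" for c :: real
    using that assms powr_add[of c "p - 1" 1] by (cases "c = 0") auto
  show ?thesis
  proof (cases "a \<le> b")
    case True
    then have "a powr (p - 1) * b \<le> b powr (p - 1) * b"
      using assms by (intro mult_right_mono powr_mono2) auto
    then show ?thesis using assms eq[of b] by (simp add: add_increasing)
  next
    case False
    then have "a powr (p - 1) * b \<le> a powr (p - 1) * a"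
      by (intro mult_left_mono) auto
    then show ?thesis using assms eq[of a] by (simp add: add_increasing2)
  qed
qed

lemma add_powr_le:
  fixes a b :: real
  assumes "0 \<le> a" "0 \<le> b" "0 \<le> r"
  shows "(a + b) powr r \<le> 2 powr r * (a powr r + b powr r)"
proof -
  have "(a + b) powr r \<le> (2 * max a b) powr r" using assms by (intro powr_mono2) auto
  also have "\<dots> = 2 powr r * max a b powr r" using assms by (simp add: powr_mult)
  also have "\<dots> \<le> 2 powr r * (a powr r + b powr r)" by (intro mult_left_mono) (auto simp: max_def)
  finally show ?thesis .
qed

lemma abs_diff_powr_le:
  fixes a b :: real
  assumes "0 \<le> r"
  shows "\<bar>a - b\<bar> powr r \<le> 2 powr r * (\<bar>a\<bar> powr r + \<bar>b\<bar> powr r)"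
  using assms by (intro order.trans[OF powr_mono2 add_powr_le]) auto

lemma abs_add_powr_le:
  fixes a b :: real
  assumes "0 \<le> r"
  shows "\<bar>a + b\<bar> powr r \<le> 2 powr r * (\<bar>a\<bar> powr r + \<bar>b\<bar> powr r)"
  using abs_diff_powr_le[OF assms, of a "- b"] by simp

text \<open>Pratt's lemma: the dominating functions may vary, provided that their integrals converge.\<close>
lemma dominated_convergence_varying:
  fixes f g :: "nat \<Rightarrow> 'a \<Rightarrow> real"
  assumes [measurable]: "\<And>n. f n \<in> borel_measurable M" "f' \<in> borel_measurable M"
    and g: "\<And>n. integrable M (g n)" "integrable M g'"
    and f_lim: "AE x in M. (\<lambda>n. f n x) \<longlonglongrightarrow> f' x"
    and g_lim: "AE x in M. (\<lambda>n. g n x) \<longlonglongrightarrow> g' x"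
    and le: "\<And>n. AE x in M. \<bar>f n x\<bar> \<le> g n x"
    and int_lim: "(\<lambda>n. \<integral>x. g n x \<partial>M) \<longlonglongrightarrow> (\<integral>x. g' x \<partial>M)"
  shows "integrable M f'" and "\<And>n. integrable M (f n)"
    and "(\<lambda>n. \<integral>x. f n x \<partial>M) \<longlonglongrightarrow> (\<integral>x. f' x \<partial>M)"
proof -
  have [measurable]: "\<And>n. g n \<in> borel_measurable M" "g' \<in> borel_measurable M" using g by auto
  have all_le: "AE x in M. \<forall>n. \<bar>f n x\<bar> \<le> g n x" using le by (simp add: AE_all_countable)
  have le': "AE x in M. \<bar>f' x\<bar> \<le> g' x"
    using all_le f_lim g_lim
  proof eventually_elim
    case (elim x)
    then show ?case
      by (intro LIMSEQ_le[OF tendsto_rabs[OF elim(2)] elim(3)]) auto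
  qed
  show f'_int: "integrable M f'"
    by (rule Bochner_Integration.integrable_bound[OF g(2)]) (use le' in \<open>auto intro: order.trans\<close>)
  show f_int: "integrable M (f n)" for n
    by (rule Bochner_Integration.integrable_bound[OF g(1)[of n]]) (use le[of n] in \<open>auto intro: order.trans\<close>)
  have g_nonneg: "AE x in M. 0 \<le> g n x" for n using le[of n] by eventually_elim auto
  have g'_nonneg: "AE x in M. 0 \<le> g' x" using le' by eventually_elim auto
  have nn: "(\<integral>\<^sup>+x. ennreal (norm (k x)) \<partial>M) = ennreal (\<integral>x. k x \<partial>M)"
    if "integrable M k" "AE x in M. 0 \<le> k x" for k :: "'a \<Rightarrow> real"
    using nn_integral_eq_integral[OF that] that(2) by (subst nn_integral_cong_AE[of _ "\<lambda>x. ennreal (k x)"]) auto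
  have "(\<lambda>n. \<integral>\<^sup>+x. ennreal (norm (g n x - g' x)) \<partial>M) \<longlonglongrightarrow> 0"
  proof (rule Scheffe_lemma1[OF g g_lim])
    have "limsup (\<lambda>n. ennreal (\<integral>x. g n x \<partial>M)) = ennreal (\<integral>x. g' x \<partial>M)"
      using int_lim by (intro lim_imp_Limsup tendsto_ennrealI) auto
    then show "limsup (\<lambda>n. \<integral>\<^sup>+x. ennreal (norm (g n x)) \<partial>M) \<le> (\<integral>\<^sup>+x. ennreal (norm (g' x)) \<partial>M)"
      by (simp only: nn[OF g(1) g_nonneg] nn[OF g(2) g'_nonneg])
  qed
  then have "(\<lambda>n. ennreal (\<integral>x. \<bar>g n x - g' x\<bar> \<partial>M)) \<longlonglongrightarrow> ennreal 0"
    using g by (subst (asm) nn_integral_eq_integral) auto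
  then have 1: "(\<lambda>n. \<integral>x. \<bar>g n x - g' x\<bar> \<partial>M) \<longlonglongrightarrow> 0"
    by (subst (asm) tendsto_ennreal_iff) auto
  \<comment> \<open>Since |f_n - f'| \<le> g_n + g' \<le> 2 g' + |g_n - g'|, capping at 2 g' loses
    at most |g_n - g'|. Ordinary dominated convergence handles the capped part, and the loss tends
    to 0 in L^1 by Scheffe's lemma.\<close>
  define m where "m = (\<lambda>n x. min \<bar>f n x - f' x\<bar> (2 * g' x))"
  have 2: "(\<lambda>n. \<integral>x. m n x \<partial>M) \<longlonglongrightarrow> (\<integral>x. 0 \<partial>M)"
  proof (rule integral_dominated_convergence[where w = "\<lambda>x. 2 * g' x"])
    show "AE x in M. (\<lambda>n. m n x) \<longlonglongrightarrow> 0"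
      using f_lim g'_nonneg
    proof eventually_elim
      case (elim x)
      have "(\<lambda>n. m n x) \<longlonglongrightarrow> min \<bar>f' x - f' x\<bar> (2 * g' x)"
        unfolding m_def by (intro tendsto_intros tendsto_min elim)
      then show ?case using elim by simp
    qed
    show "AE x in M. norm (m n x) \<le> 2 * g' x" for n
      using g'_nonneg by eventually_elim (auto simp: m_def)
  qed (use g in \<open>auto simp: m_def\<close>)
  have m_int: "integrable M (m n)" for n
    unfolding m_def using f_int f'_int g by auto
  have "(\<lambda>n. (\<integral>x. f n x \<partial>M) - (\<integral>x. f' x \<partial>M)) \<longlonglongrightarrow> 0"
  proof (rule Lim_null_comparison[OF always_eventually])
    show "(\<lambda>n. (\<integral>x. m n x \<partial>M) + (\<integral>x. \<bar>g n x - g' x\<bar> \<partial>M)) \<longlonglongrightarrow> 0"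
      using tendsto_add[OF 2 1] by simp
    show "\<forall>n. norm ((\<integral>x. f n x \<partial>M) - (\<integral>x. f' x \<partial>M)) \<le> (\<integral>x. m n x \<partial>M) + (\<integral>x. \<bar>g n x - g' x\<bar> \<partial>M)"
    proof
      fix n
      have "norm ((\<integral>x. f n x \<partial>M) - (\<integral>x. f' x \<partial>M)) \<le> (\<integral>x. \<bar>f n x - f' x\<bar> \<partial>M)"
        using integral_norm_bound[of M "\<lambda>x. f n x - f' x"] f_int f'_int by simp
      also have "\<dots> \<le> (\<integral>x. m n x + \<bar>g n x - g' x\<bar> \<partial>M)"
      proof (rule integral_mono_AE)
        show "AE x in M. \<bar>f n x - f' x\<bar> \<le> m n x + \<bar>g n x - g' x\<bar>"
          using le[of n] le' by eventually_elim (auto simp: m_def min_def)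
      qed (use f_int f'_int g m_int in auto)
      also have "\<dots> = (\<integral>x. m n x \<partial>M) + (\<integral>x. \<bar>g n x - g' x\<bar> \<partial>M)"
        using m_int g by simp
      finally show "norm ((\<integral>x. f n x \<partial>M) - (\<integral>x. f' x \<partial>M)) \<le> (\<integral>x. m n x \<partial>M) + (\<integral>x. \<bar>g n x - g' x\<bar> \<partial>M)" .
    qed
  qed
  then show "(\<lambda>n. \<integral>x. f n x \<partial>M) \<longlonglongrightarrow> (\<integral>x. f' x \<partial>M)" by (simp add: LIM_zero_iff)
qed

lemma powr_above_tangent:
  fixes m t :: real
  assumes "1 \<le> p" "0 < m" "0 \<le> t"
  shows "m powr p + p * m powr (p - 1) * (t - m) \<le> t powr p"
proof (cases "t = 0")
  case False
  have "t powr p - m powr p \<ge> (p * m powr (p - 1)) * (t - m)"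
    by (rule convex_on_imp_above_tangent[OF powr_convex[OF assms(1)]])
      (use assms False in \<open>auto intro!: derivative_eq_intros simp: interior_open\<close>)
  then show ?thesis by simp
next
  \<comment> \<open>The tangent argument was applied for t > 0; at t = 0 the claim reads (1 - p) m^p
    \<le> 0.\<close>
  case True
  have "m powr (p - 1) * m = m powr p" using assms powr_add[of m "p - 1" 1] by simp
  then have "p * m powr (p - 1) * (t - m) = - (p * m powr p)"
    using True by (simp only: diff_0 mult_minus_right mult.assoc)
  moreover have "m powr p \<le> p * m powr p" using assms by (simp add: mult_le_cancel_right1)
  moreover have "t powr p = 0" using True by simp
  ultimately show ?thesis by linarith
qed

text \<open>The tangent line of t^p at m = |\<integral> g \<rho>| is integrated against the
  probability density \<rho>. Its linear part contributes a nonnegative amount, because m is at most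
  the mean of |g|.\<close>

lemma jensen_powr:
  fixes \<rho> g :: "'a \<Rightarrow> real"
  assumes [measurable]: "g \<in> borel_measurable M" "\<rho> \<in> borel_measurable M"
    and \<rho>: "\<And>x. 0 \<le> \<rho> x" "(\<integral>\<^sup>+x. ennreal (\<rho> x) \<partial>M) = 1" and p: "1 \<le> p"
  shows "ennreal (\<bar>\<integral>x. g x * \<rho> x \<partial>M\<bar> powr p) \<le> (\<integral>\<^sup>+x. ennreal (\<rho> x) * ennreal (\<bar>g x\<bar> powr p) \<partial>M)"
proof -
  define m where "m = \<bar>\<integral>x. g x * \<rho> x \<partial>M\<bar>"
  define S where "S = (\<integral>\<^sup>+x. ennreal (\<rho> x) * ennreal (\<bar>g x\<bar> powr p) \<partial>M)"
  \<comment> \<open>The other cases are trivial. In particular, when g \<rho> is not integrable the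
    Bochner integral is 0 by convention, so m > 0 already yields integrability.\<close>
  have "ennreal (m powr p) \<le> S" if "m > 0" "S < \<infinity>"
  proof -
    have int: "integrable M (\<lambda>x. g x * \<rho> x)"
      using that(1) not_integrable_integral_eq by (fastforce simp: m_def)
    have intp: "integrable M (\<lambda>x. \<rho> x * \<bar>g x\<bar> powr p)"
      by (rule integrableI_nonneg) (use that(2) \<rho> in \<open>auto simp: S_def ennreal_mult\<close>)
    have S: "S = ennreal (\<integral>x. \<rho> x * \<bar>g x\<bar> powr p \<partial>M)"
      unfolding S_def by (subst nn_integral_eq_integral[OF intp, symmetric]) (use \<rho> in \<open>auto simp: ennreal_mult\<close>)
    have int\<rho>: "integrable M \<rho>" by (rule integrableI_nonneg) (use \<rho> in auto)
    have int1: "(\<integral>x. \<rho> x \<partial>M) = 1"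
      using nn_integral_eq_integral[OF int\<rho>] \<rho> by (simp add: integral_nonneg)
    have inta: "integrable M (\<lambda>x. \<bar>g x\<bar> * \<rho> x)"
      using integrable_abs[OF int] \<rho> by (simp add: abs_mult)
    have m_le: "m \<le> (\<integral>x. \<bar>g x\<bar> * \<rho> x \<partial>M)"
      using integral_abs_bound[of M "\<lambda>x. g x * \<rho> x"] \<rho> by (simp add: abs_mult m_def)
    define c where "c = p * m powr (p - 1)"
    have c: "0 \<le> c" using p by (simp add: c_def)
    have "m powr p \<le> m powr p + c * ((\<integral>x. \<bar>g x\<bar> * \<rho> x \<partial>M) - m)"
      using m_le c by simp
    also have "\<dots> = (\<integral>x. (m powr p - c * m) * \<rho> x + c * (\<bar>g x\<bar> * \<rho> x) \<partial>M)"
      using inta int\<rho> int1 by (simp add: algebra_simps)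
    also have "\<dots> \<le> (\<integral>x. \<rho> x * \<bar>g x\<bar> powr p \<partial>M)"
    proof (rule integral_mono)
      fix x
      have "\<rho> x * (m powr p + c * (\<bar>g x\<bar> - m)) \<le> \<rho> x * \<bar>g x\<bar> powr p"
        using powr_above_tangent[OF p that(1), of "\<bar>g x\<bar>"] \<rho> by (intro mult_left_mono) (auto simp: c_def)
      then show "(m powr p - c * m) * \<rho> x + c * (\<bar>g x\<bar> * \<rho> x) \<le> \<rho> x * \<bar>g x\<bar> powr p"
        by (simp add: algebra_simps)
    qed (use inta int\<rho> intp in auto)
    finally show ?thesis by (simp add: S ennreal_leI)
  qed
  moreover have "m \<ge> 0" by (simp add: m_def)
  ultimately show ?thesis unfolding m_def[symmetric] S_def[symmetric]
    by (cases "m = 0"; cases "S = \<infinity>") (auto simp: top.not_eq_extremum)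
qed

section \<open>Convolution with bounded probability densities\<close>

definition conv :: "('a::euclidean_space \<Rightarrow> real) \<Rightarrow> ('a \<Rightarrow> real) \<Rightarrow> 'a \<Rightarrow> real" where
  "conv w \<rho> x = (\<integral>y. w y * \<rho> (x - y) \<partial>lborel)"

text \<open>The density may be centred anywhere: the same estimates serve the smooth centred
  mollifiers that produce test functions and the off-centre ones that translate supports into the
  domain.\<close>

locale mollifier =
  fixes \<rho> :: "'a::euclidean_space \<Rightarrow> real" and M :: real
  assumes measurable_mollifier [measurable]: "\<rho> \<in> borel_measurable borel"
    and nonneg: "\<And>x. 0 \<le> \<rho> x" and le: "\<And>x. \<rho> x \<le> M"
    and nn_integral_1: "(\<integral>\<^sup>+x. ennreal (\<rho> x) \<partial>lborel) = 1"
begin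

lemma integrable_mollifier: "integrable lborel \<rho>"
  by (rule integrableI_nonneg) (auto simp: nonneg nn_integral_1)

lemma integral_1: "(\<integral>x. \<rho> x \<partial>lborel) = 1"
  using nn_integral_eq_integral[OF integrable_mollifier] nonneg nn_integral_1 by (simp add: integral_nonneg)

lemma abs_le: "\<bar>\<rho> x\<bar> \<le> M"
  using nonneg[of x] le[of x] by simp

lemma conv_measurable [measurable]:
  assumes [measurable]: "w \<in> borel_measurable borel"
  shows "conv w \<rho> \<in> borel_measurable borel"
  unfolding conv_def[abs_def] by measurable

lemma conv_eq:
  assumes [measurable]: "w \<in> borel_measurable borel"
  shows "conv w \<rho> x = (\<integral>h. w (x - h) * \<rho> h \<partial>lborel)"
  unfolding conv_def using integral_lborel_reflect[of "\<lambda>y. w y * \<rho> (x - y)" x] by simp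

lemma conv_integrable:
  assumes "integrable lborel w"
  shows "integrable lborel (\<lambda>h. w (x - h) * \<rho> h)"
proof -
  have [measurable]: "w \<in> borel_measurable borel" using assms by auto
  have "(\<integral>\<^sup>+h. ennreal (norm (w (x - h))) \<partial>lborel) = (\<integral>\<^sup>+h. ennreal (norm (w h)) \<partial>lborel)"
    by (rule nn_integral_lborel_reflect[of "\<lambda>h. ennreal (norm (w h))"]) measurable
  then have "integrable lborel (\<lambda>h. w (x - h))"
    using assms by (simp add: integrable_iff_bounded)
  then have "integrable lborel (\<lambda>h. M * w (x - h))" by auto
  then show ?thesis
  proof (rule Bochner_Integration.integrable_bound)
    have "\<bar>w (x - h)\<bar> * \<bar>\<rho> h\<bar> \<le> \<bar>w (x - h)\<bar> * \<bar>M\<bar>" for h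
      using abs_le[of h] by (intro mult_left_mono) auto
    then show "AE h in lborel. norm (w (x - h) * \<rho> h) \<le> norm (M * w (x - h))"
      by (simp add: abs_mult mult.commute)
  qed measurable
qed

lemma conv_bound:
  assumes "integrable lborel w"
  shows "\<bar>conv w \<rho> x\<bar> \<le> M * (\<integral>y. \<bar>w y\<bar> \<partial>lborel)"
proof -
  have "\<bar>conv w \<rho> x\<bar> \<le> (\<integral>y. \<bar>w y * \<rho> (x - y)\<bar> \<partial>lborel)"
    unfolding conv_def by (rule integral_abs_bound)
  also have "\<dots> \<le> (\<integral>y. M * \<bar>w y\<bar> \<partial>lborel)"
  proof (rule integral_mono)
    show "integrable lborel (\<lambda>y. \<bar>w y * \<rho> (x - y)\<bar>)"
      by (rule integrable_abs[OF integrable_conv[OF assms measurable_mollifier abs_le]])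
    show "\<bar>w y * \<rho> (x - y)\<bar> \<le> M * \<bar>w y\<bar>" for y
      using mult_left_mono[OF abs_le abs_ge_zero, of "w y" "x - y"] by (simp add: abs_mult mult.commute)
  qed (use assms in auto)
  finally show ?thesis by simp
qed

lemma conv_bound_sup:
  assumes "integrable lborel w" "\<And>x. \<bar>w x\<bar> \<le> B"
  shows "\<bar>conv w \<rho> x\<bar> \<le> B"
proof -
  have [measurable]: "w \<in> borel_measurable borel" using assms by auto
  have "\<bar>conv w \<rho> x\<bar> \<le> (\<integral>h. \<bar>w (x - h) * \<rho> h\<bar> \<partial>lborel)"
    unfolding conv_eq[OF \<open>w \<in> borel_measurable borel\<close>] by (rule integral_abs_bound)
  also have "\<dots> \<le> (\<integral>h. B * \<rho> h \<partial>lborel)"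
  proof (rule integral_mono)
    show "integrable lborel (\<lambda>h. \<bar>w (x - h) * \<rho> h\<bar>)"
      by (rule integrable_abs[OF conv_integrable[OF assms(1)]])
    show "\<bar>w (x - h) * \<rho> h\<bar> \<le> B * \<rho> h" for h
      using mult_right_mono[OF assms(2) nonneg] nonneg[of h] by (simp add: abs_mult)
  qed (use integrable_mollifier in auto)
  finally show ?thesis by (simp add: integral_1)
qed

lemma conv_diff_powr_le:
  assumes w: "integrable lborel w" and p: "1 \<le> p"
  shows "ennreal (\<bar>conv w \<rho> x - conv w \<rho> y\<bar> powr p)
    \<le> (\<integral>\<^sup>+h. ennreal (\<rho> h) * ennreal (\<bar>w (x - h) - w (y - h)\<bar> powr p) \<partial>lborel)"
proof -
  have [measurable]: "w \<in> borel_measurable borel" using w by auto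
  have "conv w \<rho> x - conv w \<rho> y = (\<integral>h. (w (x - h) - w (y - h)) * \<rho> h \<partial>lborel)"
    by (simp add: conv_eq left_diff_distrib conv_integrable[OF w])
  then show ?thesis using jensen_powr[OF _ _ nonneg nn_integral_1 p, of "\<lambda>h. w (x - h) - w (y - h)"]
    by simp
qed

lemma conv_minus_self_powr_le:
  assumes w: "integrable lborel w" and p: "1 \<le> p"
  shows "ennreal (\<bar>conv w \<rho> x - w x\<bar> powr p)
    \<le> (\<integral>\<^sup>+y. ennreal (\<rho> (x - y)) * ennreal (\<bar>w y - w x\<bar> powr p) \<partial>lborel)"
proof -
  have [measurable]: "w \<in> borel_measurable borel" using w by auto
  have "conv w \<rho> x - w x = (\<integral>h. (w (x - h) - w x) * \<rho> h \<partial>lborel)"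
    by (simp add: conv_eq left_diff_distrib conv_integrable[OF w] integrable_mollifier integral_1)
  then have "ennreal (\<bar>conv w \<rho> x - w x\<bar> powr p)
      \<le> (\<integral>\<^sup>+h. ennreal (\<rho> h) * ennreal (\<bar>w (x - h) - w x\<bar> powr p) \<partial>lborel)"
    using jensen_powr[OF _ _ nonneg nn_integral_1 p, of "\<lambda>h. w (x - h) - w x"] by simp
  also have "\<dots> = (\<integral>\<^sup>+y. ennreal (\<rho> (x - y)) * ennreal (\<bar>w y - w x\<bar> powr p) \<partial>lborel)"
    using nn_integral_lborel_reflect[of "\<lambda>y. ennreal (\<rho> (x - y)) * ennreal (\<bar>w y - w x\<bar> powr p)" x] by simp
  finally show ?thesis .
qed

text \<open>A convolution is an average of translates. Jensen's inequality bounds the p-th power of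
  its increments by the average, Tonelli exchanges the integrals, and the kernel is translation
  invariant.\<close>

lemma energy_conv_le:
  assumes w: "integrable lborel w" and p: "1 \<le> p"
  shows "energy q p (conv w \<rho>) \<le> energy q p w"
proof -
  have [measurable]: "w \<in> borel_measurable borel" using w by auto
  let ?e = "\<lambda>h z. ennreal (\<bar>w (fst z - h) - w (snd z - h)\<bar> powr p)"
  let ?k = "\<lambda>z. ennreal (kern q (fst z) (snd z))"
  have "energy q p (conv w \<rho>) \<le> (\<integral>\<^sup>+z. (\<integral>\<^sup>+h. ennreal (\<rho> h) * ?e h z \<partial>lborel) \<partial>kernel_measure q)"
    unfolding energy_def by (intro nn_integral_mono conv_diff_powr_le w p)
  also have "\<dots> = (\<integral>\<^sup>+z. (\<integral>\<^sup>+h. ?k z * (ennreal (\<rho> h) * ?e h z) \<partial>lborel) \<partial>lborel)"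
    unfolding kernel_measure_def
    by (subst nn_integral_density) (auto simp: nn_integral_cmult)
  also have "\<dots> = (\<integral>\<^sup>+h. (\<integral>\<^sup>+z. ?k z * (ennreal (\<rho> h) * ?e h z) \<partial>lborel) \<partial>lborel)"
    by (rule lborel_pair.Fubini'[symmetric]) measurable
  also have "\<dots> = (\<integral>\<^sup>+h. ennreal (\<rho> h) * energy q p w \<partial>lborel)"
  proof (intro nn_integral_cong)
    fix h
    have "(\<integral>\<^sup>+z. ?k z * (ennreal (\<rho> h) * ?e h z) \<partial>lborel) = ennreal (\<rho> h) * (\<integral>\<^sup>+z. ?e h z \<partial>kernel_measure q)"
      unfolding kernel_measure_def
      by (subst nn_integral_density) (auto simp: nn_integral_cmult[symmetric] mult_ac)
    also have "(\<integral>\<^sup>+z. ?e h z \<partial>kernel_measure q) = energy q p w"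
      unfolding energy_def
      using nn_integral_kernel_measure_shift[of "\<lambda>z. ennreal (\<bar>incr w z\<bar> powr p)"] by simp
    finally show "(\<integral>\<^sup>+z. ?k z * (ennreal (\<rho> h) * ?e h z) \<partial>lborel) = ennreal (\<rho> h) * energy q p w" .
  qed
  also have "\<dots> = energy q p w"
    by (simp add: nn_integral_multc nn_integral_1)
  finally show ?thesis .
qed

text \<open>Jensen's inequality gives a double integral of |w y - w x|^p against \<rho> (x - y).
  Dominating \<rho> by a multiple of the singular kernel turns it into the energy, so the L^p error
  is quantified by the energy itself.\<close>

lemma nn_integral_conv_minus_self_le:
  assumes w: "integrable lborel w" and p: "1 \<le> p"
    and B: "0 \<le> B" "\<And>h. h \<noteq> 0 \<Longrightarrow> \<rho> h \<le> B / norm h powr q"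
  shows "(\<integral>\<^sup>+x. ennreal (\<bar>conv w \<rho> x - w x\<bar> powr p) \<partial>lborel) \<le> ennreal B * energy q p w"
proof -
  have [measurable]: "w \<in> borel_measurable borel" using w by auto
  have "(\<integral>\<^sup>+x. ennreal (\<bar>conv w \<rho> x - w x\<bar> powr p) \<partial>lborel)
      \<le> (\<integral>\<^sup>+x. \<integral>\<^sup>+y. ennreal (\<rho> (x - y)) * ennreal (\<bar>w y - w x\<bar> powr p) \<partial>lborel \<partial>lborel)"
    by (intro nn_integral_mono conv_minus_self_powr_le w p)
  also have "\<dots> \<le> (\<integral>\<^sup>+x. \<integral>\<^sup>+y. ennreal B * (ennreal (kern q x y) * ennreal (\<bar>w x - w y\<bar> powr p)) \<partial>lborel \<partial>lborel)"
  proof (intro nn_integral_mono)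
    fix x y :: 'a
    show "ennreal (\<rho> (x - y)) * ennreal (\<bar>w y - w x\<bar> powr p)
      \<le> ennreal B * (ennreal (kern q x y) * ennreal (\<bar>w x - w y\<bar> powr p))"
    proof (cases "x = y")
      case False
      then have "ennreal (\<rho> (x - y)) * ennreal (\<bar>w y - w x\<bar> powr p)
          \<le> ennreal (B / norm (x - y) powr q) * ennreal (\<bar>w y - w x\<bar> powr p)"
        using B(2)[of "x - y"] by (intro mult_right_mono ennreal_leI) auto
      also have "\<dots> = ennreal B * (ennreal (kern q x y) * ennreal (\<bar>w x - w y\<bar> powr p))"
        using B(1) by (simp add: ennreal_mult[symmetric] abs_minus_commute)
      finally show ?thesis .
    qed simp
  qed
  also have "\<dots> = ennreal B * energy q p w"
    unfolding energy_def
    by (subst nn_integral_kernel_measure) (auto simp: nn_integral_cmult)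
  finally show ?thesis .
qed

end

text \<open>The p-th powers of the L^p errors are summable, so the sum of |conv w (\<rho> k) x - w
  x|^p over k is finite for almost every x and its terms tend to 0. The whole sequence converges,
  with no passage to a subsequence.\<close>

lemma conv_AE_tendsto:
  fixes w :: "'a::euclidean_space \<Rightarrow> real"
  assumes \<rho>: "\<And>k. mollifier (\<rho> k) (M k)"
    and w: "integrable lborel w" and p: "1 \<le> p" and en: "energy q p w < \<infinity>"
    and B: "\<And>k. 0 \<le> B k" "\<And>k h. h \<noteq> 0 \<Longrightarrow> \<rho> k h \<le> B k / norm h powr q" "summable B"
  shows "AE x in lborel. (\<lambda>k. conv w (\<rho> k) x) \<longlonglongrightarrow> w x"
proof -
  have [measurable]: "w \<in> borel_measurable borel" using w by auto
  have [measurable]: "conv w (\<rho> k) \<in> borel_measurable borel" for k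
    using mollifier.conv_measurable[OF \<rho>] by simp
  define d where "d = (\<lambda>k x. \<bar>conv w (\<rho> k) x - w x\<bar> powr p)"
  have [measurable]: "d k \<in> borel_measurable borel" for k unfolding d_def by measurable
  have "(\<integral>\<^sup>+x. (\<Sum>k. ennreal (d k x)) \<partial>lborel) = (\<Sum>k. \<integral>\<^sup>+x. ennreal (d k x) \<partial>lborel)"
    by (rule nn_integral_suminf) measurable
  also have "\<dots> \<le> (\<Sum>k. ennreal (B k) * energy q p w)"
    unfolding d_def
    by (intro suminf_le summableI mollifier.nn_integral_conv_minus_self_le[OF \<rho>] w p B)
  also have "\<dots> = ennreal (\<Sum>k. B k) * energy q p w"
    using B by (simp add: ennreal_suminf_multc suminf_ennreal2)
  also have "\<dots> < \<infinity>" using en by (simp add: ennreal_mult_less_top)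
  finally have "AE x in lborel. (\<Sum>k. ennreal (d k x)) \<noteq> \<infinity>"
    by (intro nn_integral_noteq_infinite) auto
  then show ?thesis
  proof eventually_elim
    case (elim x)
    have "summable (\<lambda>k. d k x)"
      by (rule summable_suminf_not_top) (use elim in \<open>auto simp: d_def\<close>)
    then have "(\<lambda>k. d k x) \<longlonglongrightarrow> 0" by (rule summable_LIMSEQ_zero)
    then have "(\<lambda>k. d k x powr (1 / p)) \<longlonglongrightarrow> 0 powr (1 / p)"
      using p by (intro tendsto_powr2 tendsto_intros) (auto simp: d_def)
    moreover have "d k x powr (1 / p) = \<bar>conv w (\<rho> k) x - w x\<bar>" for k
      using p by (simp add: d_def powr_powr)
    ultimately have "(\<lambda>k. \<bar>conv w (\<rho> k) x - w x\<bar>) \<longlonglongrightarrow> 0" by simp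
    then show ?case by (simp add: tendsto_rabs_zero_iff LIM_zero_iff)
  qed
qed

section \<open>Mollifier sequences dominated by the kernel\<close>

lemma nn_integral_lborel_scale:
  fixes g :: "'a::euclidean_space \<Rightarrow> ennreal"
  assumes [measurable]: "g \<in> borel_measurable borel" and t: "0 < t"
  shows "(\<integral>\<^sup>+ x. g (x /\<^sub>R t) \<partial>lborel) = ennreal (t ^ DIM('a)) * (\<integral>\<^sup>+ x. g x \<partial>lborel)"
proof -
  have "(\<integral>\<^sup>+ x. g (x /\<^sub>R t) \<partial>lborel) =
      (\<integral>\<^sup>+ x. g (x /\<^sub>R t) \<partial>density (distr lborel borel (\<lambda>x. 0 + t *\<^sub>R x)) (\<lambda>_. ennreal (\<bar>t\<bar> ^ DIM('a))))"
    using t by (subst lborel_affine[of t "0 :: 'a"]) auto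
  also have "\<dots> = (\<integral>\<^sup>+ x. ennreal (t ^ DIM('a)) * g x \<partial>lborel)"
    using t by (simp add: nn_integral_density nn_integral_distr)
  finally show ?thesis by (simp add: nn_integral_cmult)
qed

lemma bump_le_1: "bump 0 c x \<le> 1"
  by (simp add: bump_def flat_def)

lemma bump_measurable [measurable]: "bump m c \<in> borel_measurable borel"
  using C_k_bump[of 0 m c] by (auto intro: borel_measurable_continuous_onI)

lemma nn_integral_bump:
  obtains z where "z > 0" "(\<integral>\<^sup>+ x. ennreal (bump 0 1 (x :: real ^ 'n)) \<partial>lborel) = ennreal z"
proof -
  let ?I = "\<integral>\<^sup>+ x. ennreal (bump 0 1 (x :: real ^ 'n)) \<partial>lborel"
  have "?I \<le> (\<integral>\<^sup>+ x. indicator (cball (0 :: real ^ 'n) 1) x \<partial>lborel)"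
  proof (rule nn_integral_mono)
    fix x :: "real ^ 'n"
    show "ennreal (bump 0 1 x) \<le> indicator (cball 0 1) x"
    proof (cases "x \<in> cball 0 1")
      case True
      then show ?thesis using bump_le_1[of 1 x] by (simp add: ennreal_le_1)
    next
      case False
      then have "1 \<le> x \<bullet> x" by (simp add: dot_square_norm)
      then show ?thesis by (simp add: bump_eq_0)
    qed
  qed
  also have "\<dots> = emeasure lborel (cball (0 :: real ^ 'n) 1)" by simp
  also have "\<dots> < \<infinity>" by (rule emeasure_lborel_cball_finite)
  finally have fin: "?I < \<infinity>" .
  have "?I \<noteq> 0"
  proof
    assume "?I = 0"
    then have "AE x in lborel. bump 0 1 (x :: real ^ 'n) = 0"
      by (subst (asm) nn_integral_0_iff_AE) (auto simp: bump_nonneg intro: antisym elim!: eventually_mono)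
    moreover have "bump 0 1 (x :: real ^ 'n) \<noteq> 0" if "x \<in> ball 0 1" for x
    proof -
      have "x \<bullet> x < 1" using that by (simp add: dot_square_norm power_less_one_iff)
      then show ?thesis by (simp add: bump_def flat_def)
    qed
    ultimately have "AE x in lborel. (x :: real ^ 'n) \<notin> ball 0 1" by (auto elim!: eventually_mono)
    then have "emeasure lborel (ball (0 :: real ^ 'n) 1) = 0"
      by (subst (asm) AE_iff_measurable[OF _ refl]) (auto simp: ball_def)
    then show False using unit_ball_vol_pos[of "real CARD('n)"] by (simp add: emeasure_ball)
  qed
  then show ?thesis using fin that[of "enn2real ?I"]
    by (auto simp: enn2real_positive_iff top.not_eq_extremum zero_less_iff_neq_zero)
qed

text \<open>A bump is scaled to radius t_k = \<tau> / 2^k and centred at t_k b, so that displacement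
  and radius shrink at the same rate. With b = 0 the densities are smooth multiples of
  \<open>bump\<close>; a nonzero b moves supports along the axis of a cone.\<close>

lemma mollifier_sequence:
  fixes b :: "real ^ 'n" and \<tau> q :: real
  assumes \<tau>: "\<tau> > 0" and q: "q > real CARD('n)"
  obtains \<rho> M B where "\<And>k. mollifier (\<rho> k) (M k)"
    "\<And>k h. \<rho> k h \<noteq> 0 \<Longrightarrow> norm (h - (\<tau> / 2 ^ k) *\<^sub>R b) \<le> \<tau> / 2 ^ k"
    "\<And>k. 0 \<le> B k" "\<And>k h. h \<noteq> 0 \<Longrightarrow> \<rho> k h \<le> B k / norm h powr q" "summable B"
    "b = 0 \<Longrightarrow> \<forall>k. C_infinity (\<rho> k)"
proof -
  obtain z where z: "z > 0" "(\<integral>\<^sup>+ x. ennreal (bump 0 1 (x :: real ^ 'n)) \<partial>lborel) = ennreal z"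
    by (rule nn_integral_bump)
  define N where "N = CARD('n)"
  define t where "t = (\<lambda>k::nat. \<tau> / 2 ^ k)"
  have t: "t k > 0" for k using \<tau> by (simp add: t_def)
  define R where "R = 1 + norm b"
  have R: "R > 0" by (simp add: R_def add_pos_nonneg)
  define \<rho> where "\<rho> = (\<lambda>k (h :: real ^ 'n). bump 0 1 (h /\<^sub>R t k - b) / (z * t k ^ N))"
  define M where "M = (\<lambda>k. 1 / (z * t k ^ N))"
  \<comment> \<open>On the support of \<rho>_k one has |h| \<le> R t_k, hence \<rho>_k \<le> 1 / (z
    t_k^N) \<le> (R t_k)^q / (z t_k^N |h|^q). The coefficient of |h|^(-q) is B_k, geometric with
    ratio 2^(N - q).\<close>
  define B where "B = (\<lambda>k. R powr q / z * t k powr (q - N))"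
  have 1: "mollifier (\<rho> k) (M k)" for k
  proof
    show "\<rho> k \<in> borel_measurable borel" unfolding \<rho>_def by measurable
    show "0 \<le> \<rho> k x" for x using z t[of k] by (simp add: \<rho>_def bump_nonneg)
    show "\<rho> k x \<le> M k" for x
      using z t[of k] unfolding \<rho>_def M_def by (intro divide_right_mono bump_le_1) auto
    have "(\<integral>\<^sup>+x. ennreal (\<rho> k x) \<partial>lborel) = (\<integral>\<^sup>+x. ennreal (bump 0 1 (x /\<^sub>R t k + - b)) * ennreal (1 / (z * t k ^ N)) \<partial>lborel)"
      using z t[of k] by (simp add: \<rho>_def ennreal_mult[symmetric] bump_nonneg)
    also have "\<dots> = (\<integral>\<^sup>+x. ennreal (bump 0 1 (x /\<^sub>R t k + - b)) \<partial>lborel) * ennreal (1 / (z * t k ^ N))"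
      by (rule nn_integral_multc) measurable
    also have "(\<integral>\<^sup>+x. ennreal (bump 0 1 (x /\<^sub>R t k + - b)) \<partial>lborel) = ennreal (t k ^ N) * (\<integral>\<^sup>+x. ennreal (bump 0 1 (x + - b)) \<partial>lborel)"
      using nn_integral_lborel_scale[OF _ t[of k], of "\<lambda>x. ennreal (bump 0 1 (x + - b))"] by (simp add: N_def)
    also have "(\<integral>\<^sup>+x. ennreal (bump 0 1 (x + - b)) \<partial>lborel) = ennreal z"
      using nn_integral_lborel_shift[of "\<lambda>x. ennreal (bump 0 1 x)" "- b"] z by simp
    also have "ennreal (t k ^ N) * ennreal z * ennreal (1 / (z * t k ^ N)) = 1"
      using z t[of k] by (simp add: ennreal_mult[symmetric])
    finally show "(\<integral>\<^sup>+x. ennreal (\<rho> k x) \<partial>lborel) = 1" .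
  qed
  have near: "norm (h /\<^sub>R t k - b) < 1" if "\<rho> k h \<noteq> 0" for k h
  proof (rule ccontr)
    assume "\<not> norm (h /\<^sub>R t k - b) < 1"
    then have "1 \<le> (h /\<^sub>R t k - b) \<bullet> (h /\<^sub>R t k - b)" by (simp add: dot_square_norm)
    then show False using that by (simp add: \<rho>_def bump_eq_0)
  qed
  have 2: "norm (h - t k *\<^sub>R b) \<le> t k" if "\<rho> k h \<noteq> 0" for k h
  proof -
    have "h - t k *\<^sub>R b = t k *\<^sub>R (h /\<^sub>R t k - b)" using t[of k] by (simp add: scaleR_diff_right)
    then have "norm (h - t k *\<^sub>R b) = t k * norm (h /\<^sub>R t k - b)" using t[of k] by (metis abs_of_pos norm_scaleR)
    also have "\<dots> \<le> t k * 1" using near[OF that] t[of k] by (intro mult_left_mono) auto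
    finally show ?thesis by simp
  qed
  have 3: "0 \<le> B k" for k using z by (simp add: B_def)
  have 4: "\<rho> k h \<le> B k / norm h powr q" if "h \<noteq> 0" for k h
  proof (cases "\<rho> k h = 0")
    case False
    have "norm h \<le> norm (h - t k *\<^sub>R b) + norm (t k *\<^sub>R b)" using norm_triangle_ineq[of "h - t k *\<^sub>R b" "t k *\<^sub>R b"] by simp
    also have "\<dots> \<le> t k * R" using 2[OF False] t[of k] by (simp add: R_def algebra_simps)
    finally have "norm h powr q \<le> (t k * R) powr q" using q by (intro powr_mono2) auto
    also have "\<dots> = B k * z * t k ^ N"
      using t[of k] R z by (simp add: B_def powr_mult powr_diff powr_realpow)
    finally have "norm h powr q \<le> B k * (z * t k ^ N)" by (simp add: mult_ac)
    then have "M k * norm h powr q \<le> B k" using z t[of k] by (simp add: M_def field_simps)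
    then have "M k \<le> B k / norm h powr q" using that by (simp add: field_simps)
    then show ?thesis using mollifier.le[OF 1, of k h] by linarith
  qed (use 3 in simp)
  have 5: "summable B"
  proof -
    have "B k = R powr q / z * \<tau> powr (q - N) * (2 powr (N - q)) ^ k" for k
      using \<tau> by (simp add: B_def t_def powr_divide powr_of_power2 powr_diff power_divide mult_ac)
    moreover have "summable (\<lambda>k. R powr q / z * \<tau> powr (q - N) * (2 powr (N - q)) ^ k)"
      using q by (intro summable_mult summable_geometric) (simp add: N_def powr_less_one)
    ultimately show ?thesis by presburger
  qed
  have 6: "\<forall>k. C_infinity (\<rho> k)" if "b = 0"
  proof
    fix k
    have "\<rho> k = (\<lambda>h. bump 0 (1 / (t k)\<^sup>2) h * (1 / (z * t k ^ N)))"
      using that t[of k] by (auto simp: \<rho>_def bump_def power2_eq_square field_simps)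
    then show "C_infinity (\<rho> k)"
      by (simp only: C_infinity_def) (intro allI C_k_mult C_k_bump C_k_const)
  qed
  show ?thesis by (rule that[OF 1 2[unfolded t_def] 3 4 5 6])
qed

section \<open>Energy of sums, contractions and products with cutoffs\<close>

lemma local_energy_le_add:
  assumes [measurable]: "f \<in> borel_measurable borel" "g \<in> borel_measurable borel" "K \<in> sets borel" and p: "0 \<le> p"
    and le: "\<And>x y. \<bar>w x - w y\<bar> \<le> \<bar>f x - f y\<bar> + \<bar>g x - g y\<bar>"
  shows "local_energy q p K w \<le> ennreal (2 powr p) * (local_energy q p K f + local_energy q p K g)"
proof -
  have [measurable]: "K \<times> K \<in> sets borel" by (intro borel_Times) auto
  let ?e = "\<lambda>u z. indicator (K \<times> K) z * ennreal (\<bar>incr u z\<bar> powr p)"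
  have "local_energy q p K w \<le> (\<integral>\<^sup>+ z. ennreal (2 powr p) * (?e f z + ?e g z) \<partial>kernel_measure q)"
  proof (rule nn_integral_mono)
    fix z :: "'a \<times> 'a"
    have "\<bar>incr w z\<bar> powr p \<le> 2 powr p * (\<bar>incr f z\<bar> powr p + \<bar>incr g z\<bar> powr p)"
      using p by (intro order.trans[OF powr_mono2[OF _ _ le] add_powr_le]) auto
    then have "ennreal (\<bar>incr w z\<bar> powr p) \<le> ennreal (2 powr p) * (ennreal (\<bar>incr f z\<bar> powr p) + ennreal (\<bar>incr g z\<bar> powr p))"
      by (simp add: ennreal_plus[symmetric] ennreal_mult[symmetric] ennreal_leI del: ennreal_plus)
    then show "?e w z \<le> ennreal (2 powr p) * (?e f z + ?e g z)" by (auto simp: indicator_def)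
  qed
  also have "\<dots> = ennreal (2 powr p) * (local_energy q p K f + local_energy q p K g)"
    by (simp add: nn_integral_cmult nn_integral_add)
  finally show ?thesis .
qed

lemma energy_eq_local_energy: "energy q p u = local_energy q p UNIV u"
  by (simp add: energy_def)

lemma local_energy_le_energy: "local_energy q p K u \<le> energy q p u"
  unfolding energy_def by (intro nn_integral_mono) (auto simp: indicator_def)

lemma energy_add_le:
  assumes "u \<in> borel_measurable borel" "v \<in> borel_measurable borel" "0 \<le> p"
  shows "energy q p (\<lambda>x. u x + v x) \<le> ennreal (2 powr p) * (energy q p u + energy q p v)"
  unfolding energy_eq_local_energy using assms by (intro local_energy_le_add) auto

lemma energy_le:
  assumes "\<And>x y. \<bar>u x - u y\<bar> \<le> C * \<bar>v x - v y\<bar>" and [measurable]: "v \<in> borel_measurable borel" and "0 \<le> p" "0 \<le> C"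
  shows "energy q p u \<le> ennreal (C powr p) * energy q p v"
proof -
  have "energy q p u \<le> (\<integral>\<^sup>+ z. ennreal (C powr p) * ennreal (\<bar>incr v z\<bar> powr p) \<partial>kernel_measure q)"
    unfolding energy_def using assms
    by (intro nn_integral_mono)
      (auto simp: ennreal_mult[symmetric] powr_mult[symmetric] intro!: ennreal_leI powr_mono2)
  then show ?thesis unfolding energy_def by (simp add: nn_integral_cmult)
qed

text \<open>The increment of the product splits as \<psi> y (z x - z y) + z x (\<psi> x - \<psi> y).
  The first part is bounded by the increment of z; the second is at most |z x| (L + 2) min 1 |x -
  y|, and \<open>kernel_near\<close> integrates out y, leaving the L^p norm of z.\<close>

lemma energy_mult_finite:
  fixes z \<psi> :: "'a::euclidean_space \<Rightarrow> real"
  assumes [measurable]: "z \<in> borel_measurable borel" "\<psi> \<in> borel_measurable borel"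
    and \<psi>: "\<And>x. \<bar>\<psi> x\<bar> \<le> 1" "\<And>x y. \<bar>\<psi> x - \<psi> y\<bar> \<le> L * norm (x - y)" and L: "0 \<le> L"
    and q: "q < p + real DIM('a)" "real DIM('a) < q" and p: "0 \<le> p"
    and z: "energy q p z < \<infinity>" "(\<integral>\<^sup>+x. ennreal (\<bar>z x\<bar> powr p) \<partial>lborel) < \<infinity>"
  shows "energy q p (\<lambda>x. \<psi> x * z x) < \<infinity>"
proof -
  obtain C where C: "C \<ge> 0" "\<And>x::'a. (\<integral>\<^sup>+ y. ennreal (kern q x y) * ennreal (min 1 (norm (x - y)) powr p) \<partial>lborel) \<le> ennreal C"
    using kernel_near[OF q] by blast
  define G where "G = (\<lambda>w :: 'a \<times> 'a. ennreal (\<bar>z (fst w)\<bar> powr p) * ennreal (min 1 (norm (fst w - snd w)) powr p))"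
  have [measurable]: "G \<in> borel_measurable borel" unfolding G_def by measurable
  have pt: "ennreal (\<bar>\<psi> x * z x - \<psi> y * z y\<bar> powr p) \<le> ennreal (2 powr p) * (ennreal (\<bar>z x - z y\<bar> powr p) + ennreal ((L + 2) powr p) * G (x, y))" for x y
  proof -
    have 1: "\<bar>\<psi> y * (z x - z y)\<bar> \<le> \<bar>z x - z y\<bar>" using \<psi>(1)[of y] by (simp add: abs_mult mult_left_le_one_le)
    have "\<bar>\<psi> x - \<psi> y\<bar> \<le> (L + 2) * min 1 (norm (x - y))"
    proof (cases "norm (x - y) \<le> 1")
      case True
      then show ?thesis using \<psi>(2)[of x y] by (simp add: min_def distrib_right add_increasing2)
    next
      case False
      then show ?thesis using \<psi>(1)[of x] \<psi>(1)[of y] L by (simp add: min_def)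
    qed
    then have 2: "\<bar>z x * (\<psi> x - \<psi> y)\<bar> \<le> \<bar>z x\<bar> * ((L + 2) * min 1 (norm (x - y)))"
      unfolding abs_mult by (intro mult_left_mono) auto
    have "\<bar>\<psi> x * z x - \<psi> y * z y\<bar> = \<bar>\<psi> y * (z x - z y) + z x * (\<psi> x - \<psi> y)\<bar>" by (simp add: algebra_simps)
    then have "\<bar>\<psi> x * z x - \<psi> y * z y\<bar> powr p \<le> 2 powr p * (\<bar>\<psi> y * (z x - z y)\<bar> powr p + \<bar>z x * (\<psi> x - \<psi> y)\<bar> powr p)"
      using abs_add_powr_le[OF p] by simp
    also have "\<dots> \<le> 2 powr p * (\<bar>z x - z y\<bar> powr p + (\<bar>z x\<bar> * ((L + 2) * min 1 (norm (x - y)))) powr p)"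
      using 1 2 p by (intro mult_left_mono add_mono powr_mono2) auto
    also have "(\<bar>z x\<bar> * ((L + 2) * min 1 (norm (x - y)))) powr p = (L + 2) powr p * (\<bar>z x\<bar> powr p * min 1 (norm (x - y)) powr p)"
      using L by (simp add: powr_mult mult_ac)
    finally show ?thesis
      using L by (simp add: G_def ennreal_plus[symmetric] ennreal_mult[symmetric] ennreal_leI del: ennreal_plus)
  qed
  have "energy q p (\<lambda>x. \<psi> x * z x) \<le> (\<integral>\<^sup>+w. ennreal (2 powr p) * (ennreal (\<bar>z (fst w) - z (snd w)\<bar> powr p) + ennreal ((L + 2) powr p) * G w) \<partial>kernel_measure q)"
    unfolding energy_def using pt by (intro nn_integral_mono) (metis prod.collapse)
  also have "\<dots> = ennreal (2 powr p) * (energy q p z + ennreal ((L + 2) powr p) * (\<integral>\<^sup>+w. G w \<partial>kernel_measure q))"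
    unfolding energy_def by (simp add: nn_integral_cmult nn_integral_add)
  also have "\<dots> < \<infinity>"
  proof -
    have "(\<integral>\<^sup>+w. G w \<partial>kernel_measure q) = (\<integral>\<^sup>+x. ennreal (\<bar>z x\<bar> powr p) * (\<integral>\<^sup>+ y. ennreal (kern q x y) * ennreal (min 1 (norm (x - y)) powr p) \<partial>lborel) \<partial>lborel)"
      by (subst nn_integral_kernel_measure) (auto simp: G_def nn_integral_cmult[symmetric] mult_ac)
    also have "\<dots> \<le> (\<integral>\<^sup>+x. ennreal (\<bar>z x\<bar> powr p) * ennreal C \<partial>lborel)"
      by (intro nn_integral_mono mult_left_mono C) auto
    also have "\<dots> < \<infinity>" using z(2) by (simp add: nn_integral_multc ennreal_mult_less_top)
    finally show ?thesis using z(1) by (simp add: ennreal_mult_less_top)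
  qed
  finally show ?thesis .
qed

section \<open>From almost everywhere convergence to convergence in energy\<close>

lemma energy_integrable:
  assumes [measurable]: "u \<in> borel_measurable borel" and "energy q p u < \<infinity>"
  shows "integrable (kernel_measure q) (\<lambda>z. \<bar>incr u z\<bar> powr p)"
    and "energy q p u = ennreal (\<integral>z. \<bar>incr u z\<bar> powr p \<partial>kernel_measure q)"
proof -
  show *: "integrable (kernel_measure q) (\<lambda>z. \<bar>incr u z\<bar> powr p)"
    by (rule integrableI_nonneg) (use assms in \<open>auto simp: energy_def\<close>)
  show "energy q p u = ennreal (\<integral>z. \<bar>incr u z\<bar> powr p \<partial>kernel_measure q)"
    unfolding energy_def by (rule nn_integral_eq_integral[OF *]) auto
qed

text \<open>Fatou's lemma gives lower semicontinuity of the energy along the sequence; the assumed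
  upper bound by the energy of w closes the gap.\<close>

lemma integral_energy_tendsto:
  fixes w :: "'a::euclidean_space \<Rightarrow> real"
  assumes [measurable]: "\<And>k. \<phi> k \<in> borel_measurable borel" "w \<in> borel_measurable borel"
    and p: "0 < p" and lim: "AE x in lborel. (\<lambda>k. \<phi> k x) \<longlonglongrightarrow> w x"
    and le: "\<And>k. energy q p (\<phi> k) \<le> energy q p w" and fin: "energy q p w < \<infinity>"
  shows "(\<lambda>k. \<integral>z. \<bar>incr (\<phi> k) z\<bar> powr p \<partial>kernel_measure q) \<longlonglongrightarrow> (\<integral>z. \<bar>incr w z\<bar> powr p \<partial>kernel_measure q)"
proof -
  let ?\<mu> = "kernel_measure q :: ('a \<times> 'a) measure"
  have lim2: "AE z in ?\<mu>. (\<lambda>k. \<bar>incr (\<phi> k) z\<bar> powr p) \<longlonglongrightarrow> \<bar>incr w z\<bar> powr p"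
    using AE_kernel_measure_pair[OF lim]
    by eventually_elim (use p in \<open>auto intro!: tendsto_powr2 tendsto_intros always_eventually\<close>)
  have "energy q p w = (\<integral>\<^sup>+z. liminf (\<lambda>k. ennreal (\<bar>incr (\<phi> k) z\<bar> powr p)) \<partial>?\<mu>)"
    unfolding energy_def
    by (rule nn_integral_cong_AE)
      (use lim2 in \<open>auto elim!: eventually_mono intro!: lim_imp_Liminf[symmetric] tendsto_ennrealI\<close>)
  also have "\<dots> \<le> liminf (\<lambda>k. energy q p (\<phi> k))"
    unfolding energy_def by (rule nn_integral_liminf) measurable
  finally have 1: "energy q p w \<le> liminf (\<lambda>k. energy q p (\<phi> k))" .
  have 2: "limsup (\<lambda>k. energy q p (\<phi> k)) \<le> energy q p w"
    by (rule Limsup_bounded) (auto intro: always_eventually le)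
  have "(\<lambda>k. energy q p (\<phi> k)) \<longlonglongrightarrow> energy q p w"
    using 1 2 Liminf_le_Limsup[OF sequentially_bot, of "\<lambda>k. energy q p (\<phi> k)"]
    by (intro tendsto_iff_Liminf_eq_Limsup[THEN iffD2]) auto
  moreover have "energy q p (\<phi> k) = ennreal (\<integral>z. \<bar>incr (\<phi> k) z\<bar> powr p \<partial>?\<mu>)" for k
    by (rule energy_integrable) (use le[of k] fin in \<open>auto intro: le_less_trans\<close>)
  moreover have "energy q p w = ennreal (\<integral>z. \<bar>incr w z\<bar> powr p \<partial>?\<mu>)"
    by (rule energy_integrable) (use fin in auto)
  ultimately show ?thesis by (simp add: tendsto_ennreal_iff)
qed

text \<open>Almost everywhere convergence together with convergence of the norms implies strong
  convergence. The majorant 2^p (|a_k|^p + |b|^p) varies with k, but its integrals converge by the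
  preceding lemma.\<close>

lemma energy_diff_tendsto_0:
  fixes w :: "'a::euclidean_space \<Rightarrow> real"
  assumes [measurable]: "\<And>k. \<phi> k \<in> borel_measurable borel" "w \<in> borel_measurable borel"
    and p: "0 < p" and lim: "AE x in lborel. (\<lambda>k. \<phi> k x) \<longlonglongrightarrow> w x"
    and le: "\<And>k. energy q p (\<phi> k) \<le> energy q p w" and fin: "energy q p w < \<infinity>"
  shows "(\<lambda>k. energy q p (\<lambda>x. \<phi> k x - w x)) \<longlonglongrightarrow> 0"
proof -
  let ?\<mu> = "kernel_measure q :: ('a \<times> 'a) measure"
  define a where "a = (\<lambda>k z. incr (\<phi> k) z)"
  define b where "b = (\<lambda>z. incr w z)"
  have [measurable]: "a k \<in> borel_measurable borel" "b \<in> borel_measurable borel" for k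
    unfolding a_def b_def by measurable
  have fink: "energy q p (\<phi> k) < \<infinity>" for k using le[of k] fin by (rule le_less_trans)
  have inta: "integrable (?\<mu>) (\<lambda>z. \<bar>a k z\<bar> powr p)" for k
    unfolding a_def by (rule energy_integrable) (use fink in auto)
  have intb: "integrable (?\<mu>) (\<lambda>z. \<bar>b z\<bar> powr p)"
    unfolding b_def by (rule energy_integrable) (use fin in auto)
  have lim1: "AE z in ?\<mu>. (\<lambda>k. a k z) \<longlonglongrightarrow> b z"
    using AE_kernel_measure_pair[OF lim]
    by eventually_elim (auto simp: a_def b_def intro!: tendsto_intros)
  have lima: "AE z in ?\<mu>. (\<lambda>k. \<bar>a k z\<bar> powr p) \<longlonglongrightarrow> \<bar>b z\<bar> powr p"
    using lim1 by eventually_elim (use p in \<open>auto intro!: tendsto_powr2 tendsto_intros always_eventually\<close>)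
  have limd: "AE z in ?\<mu>. (\<lambda>k. \<bar>a k z - b z\<bar> powr p) \<longlonglongrightarrow> 0"
    using lim1
  proof eventually_elim
    case (elim z)
    have "(\<lambda>k. \<bar>a k z - b z\<bar> powr p) \<longlonglongrightarrow> \<bar>b z - b z\<bar> powr p"
      using p elim by (intro tendsto_powr2 tendsto_intros always_eventually) auto
    then show ?case by simp
  qed
  have "(\<lambda>k. \<integral>z. \<bar>a k z - b z\<bar> powr p \<partial>?\<mu>) \<longlonglongrightarrow> (\<integral>z. 0 \<partial>?\<mu>)"
  proof (rule dominated_convergence_varying(3)[where g = "\<lambda>k z. 2 powr p * (\<bar>a k z\<bar> powr p + \<bar>b z\<bar> powr p)"
        and g' = "\<lambda>z. 2 powr p * (\<bar>b z\<bar> powr p + \<bar>b z\<bar> powr p)"])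
    show "AE z in ?\<mu>. (\<lambda>k. 2 powr p * (\<bar>a k z\<bar> powr p + \<bar>b z\<bar> powr p)) \<longlonglongrightarrow> 2 powr p * (\<bar>b z\<bar> powr p + \<bar>b z\<bar> powr p)"
      using lima by eventually_elim (intro tendsto_mult tendsto_add tendsto_const)
    have "(\<lambda>k. 2 powr p * ((\<integral>z. \<bar>a k z\<bar> powr p \<partial>?\<mu>) + (\<integral>z. \<bar>b z\<bar> powr p \<partial>?\<mu>)))
        \<longlonglongrightarrow> 2 powr p * ((\<integral>z. \<bar>b z\<bar> powr p \<partial>?\<mu>) + (\<integral>z. \<bar>b z\<bar> powr p \<partial>?\<mu>))"
      using integral_energy_tendsto[OF assms] unfolding a_def b_def by (intro tendsto_intros)
    then show "(\<lambda>k. \<integral>z. 2 powr p * (\<bar>a k z\<bar> powr p + \<bar>b z\<bar> powr p) \<partial>?\<mu>) \<longlonglongrightarrow> (\<integral>z. 2 powr p * (\<bar>b z\<bar> powr p + \<bar>b z\<bar> powr p) \<partial>?\<mu>)"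
      using inta intb by simp
    show "AE z in ?\<mu>. \<bar>\<bar>a k z - b z\<bar> powr p\<bar> \<le> 2 powr p * (\<bar>a k z\<bar> powr p + \<bar>b z\<bar> powr p)" for k
      using abs_diff_powr_le[of p] p by simp
  qed (use limd inta intb in auto)
  then have 1: "(\<lambda>k. ennreal (\<integral>z. \<bar>a k z - b z\<bar> powr p \<partial>?\<mu>)) \<longlonglongrightarrow> 0"
    using tendsto_ennrealI[of _ 0] by simp
  have "energy q p (\<lambda>x. \<phi> k x - w x) = ennreal (\<integral>z. \<bar>a k z - b z\<bar> powr p \<partial>?\<mu>)" for k
  proof -
    have "energy q p (\<lambda>x. \<phi> k x + (-1) * w x) < \<infinity>"
    proof (rule le_less_trans[OF energy_add_le])
      have "energy q p (\<lambda>x. - 1 * w x) = energy q p w"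
        by (simp add: energy_def abs_minus_commute)
      then show "ennreal (2 powr p) * (energy q p (\<phi> k) + energy q p (\<lambda>x. - 1 * w x)) < \<infinity>"
        using fink[of k] fin by (simp add: ennreal_mult_less_top)
    qed (use p in auto)
    then have "energy q p (\<lambda>x. \<phi> k x - w x) < \<infinity>" by simp
    from energy_integrable(2)[OF _ this]
    show ?thesis by (simp add: a_def b_def algebra_simps)
  qed
  with 1 show ?thesis by simp
qed

section \<open>Approximation by functions with compact support\<close>

text \<open>Convergence is in the seminorm and almost everywhere. Approximants with small index may
  still have infinite energy; \<open>approximates_finite_energy\<close> later drops such an initial
  segment.\<close>

definition approximates :: "real \<Rightarrow> real \<Rightarrow> 'a::euclidean_space set \<Rightarrow> (nat \<Rightarrow> 'a \<Rightarrow> real) \<Rightarrow> ('a \<Rightarrow> real) \<Rightarrow> bool" where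
  "approximates q p \<Omega> \<phi> z \<longleftrightarrow>
     (\<forall>n. \<phi> n \<in> borel_measurable borel) \<and> (\<forall>n. \<exists>M. \<forall>x. \<bar>\<phi> n x\<bar> \<le> M) \<and>
     (\<forall>n. \<exists>K. compact K \<and> K \<subseteq> \<Omega> \<and> (\<forall>x. x \<notin> K \<longrightarrow> \<phi> n x = 0)) \<and>
     (AE x in lborel. (\<lambda>n. \<phi> n x) \<longlonglongrightarrow> z x) \<and>
     (\<lambda>n. energy q p (\<lambda>x. \<phi> n x - z x)) \<longlonglongrightarrow> 0"

lemma approximates_add:
  fixes u v :: "'a::euclidean_space \<Rightarrow> real"
  assumes u: "approximates q p \<Omega> \<phi> u" and v: "approximates q p \<Omega> \<psi> v" and p: "0 \<le> p"
    and [measurable]: "u \<in> borel_measurable borel" "v \<in> borel_measurable borel"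
  shows "approximates q p \<Omega> (\<lambda>n x. \<phi> n x + \<psi> n x) (\<lambda>x. u x + v x)"
  unfolding approximates_def
proof (intro conjI allI)
  have [measurable]: "\<phi> n \<in> borel_measurable borel" "\<psi> n \<in> borel_measurable borel" for n
    using u v by (auto simp: approximates_def)
  show "(\<lambda>x. \<phi> n x + \<psi> n x) \<in> borel_measurable borel" for n by measurable
  show "\<exists>M. \<forall>x. \<bar>\<phi> n x + \<psi> n x\<bar> \<le> M" for n
  proof -
    obtain M M' where "\<forall>x. \<bar>\<phi> n x\<bar> \<le> M" "\<forall>x. \<bar>\<psi> n x\<bar> \<le> M'"
      using u v unfolding approximates_def by blast
    then have "\<bar>\<phi> n x + \<psi> n x\<bar> \<le> M + M'" for x
      by (intro order.trans[OF abs_triangle_ineq] add_mono) auto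
    then show ?thesis by blast
  qed
  show "\<exists>K. compact K \<and> K \<subseteq> \<Omega> \<and> (\<forall>x. x \<notin> K \<longrightarrow> \<phi> n x + \<psi> n x = 0)" for n
  proof -
    obtain K where K: "compact K" "K \<subseteq> \<Omega>" "\<forall>x. x \<notin> K \<longrightarrow> \<phi> n x = 0"
      using u unfolding approximates_def by blast
    obtain K' where K': "compact K'" "K' \<subseteq> \<Omega>" "\<forall>x. x \<notin> K' \<longrightarrow> \<psi> n x = 0"
      using v unfolding approximates_def by blast
    show ?thesis by (rule exI[of _ "K \<union> K'"]) (use K K' in \<open>auto intro: compact_Un\<close>)
  qed
  have "AE x in lborel. (\<lambda>n. \<phi> n x) \<longlonglongrightarrow> u x" "AE x in lborel. (\<lambda>n. \<psi> n x) \<longlonglongrightarrow> v x"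
    using u v by (auto simp: approximates_def)
  then show "AE x in lborel. (\<lambda>n. \<phi> n x + \<psi> n x) \<longlonglongrightarrow> u x + v x"
    by eventually_elim (rule tendsto_add)
  have "(\<lambda>n. energy q p (\<lambda>x. \<phi> n x - u x)) \<longlonglongrightarrow> 0" "(\<lambda>n. energy q p (\<lambda>x. \<psi> n x - v x)) \<longlonglongrightarrow> 0"
    using u v by (auto simp: approximates_def)
  then have lim: "(\<lambda>n. ennreal (2 powr p) * (energy q p (\<lambda>x. \<phi> n x - u x) + energy q p (\<lambda>x. \<psi> n x - v x))) \<longlonglongrightarrow> ennreal (2 powr p) * (0 + 0)"
    by (intro ennreal_tendsto_cmult tendsto_add) auto
  have le: "energy q p (\<lambda>x. (\<phi> n x + \<psi> n x) - (u x + v x)) \<le> ennreal (2 powr p) * (energy q p (\<lambda>x. \<phi> n x - u x) + energy q p (\<lambda>x. \<psi> n x - v x))" for n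
    using energy_add_le[OF _ _ p, of "\<lambda>x. \<phi> n x - u x" "\<lambda>x. \<psi> n x - v x" q] by (simp add: algebra_simps)
  show "(\<lambda>n. energy q p (\<lambda>x. (\<phi> n x + \<psi> n x) - (u x + v x))) \<longlonglongrightarrow> 0"
    by (rule tendsto_sandwich[OF _ _ tendsto_const lim[simplified]]) (use le in auto)
qed

abbreviation approximable :: "real \<Rightarrow> real \<Rightarrow> 'a::euclidean_space set \<Rightarrow> ('a \<Rightarrow> real) \<Rightarrow> bool" where
  "approximable q p \<Omega> z \<equiv> \<exists>\<phi>. approximates q p \<Omega> \<phi> z"

text \<open>Mollifying with a density supported in a ball around t c, of radius \<kappa> t, spreads
  each point y of S over y + h with h in that ball, which the cone condition keeps inside \<Omega>.
  The support becomes compact in \<Omega> without the energy growing.\<close>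

lemma approximable_chart:
  fixes w :: "real ^ 'n \<Rightarrow> real"
  assumes w: "integrable lborel w" and fin: "energy q p w < \<infinity>" and p: "1 \<le> p" and q: "q > real CARD('n)"
    and S: "compact S" "\<And>x. w x \<noteq> 0 \<Longrightarrow> x \<in> S"
    and \<kappa>: "\<kappa> > 0" and t0: "t0 > 0"
    and cone: "\<And>t y h. 0 < t \<Longrightarrow> t \<le> t0 \<Longrightarrow> y \<in> S \<Longrightarrow> norm (h - t *\<^sub>R c) \<le> \<kappa> * t \<Longrightarrow> y + h \<in> \<Omega>"
  shows "approximable q p \<Omega> w"
proof -
  have [measurable]: "w \<in> borel_measurable borel" using w by auto
  \<comment> \<open>With \<tau> = \<kappa> t0 and b = c / \<kappa>, the k-th density lives on the
    ball around t c of radius \<kappa> t for t = t0 / 2^k, exactly the ball of the cone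
    condition.\<close>
  obtain \<rho> M B where \<rho>: "\<And>k. mollifier (\<rho> k) (M k)"
    "\<And>k h. \<rho> k h \<noteq> 0 \<Longrightarrow> norm (h - (\<kappa> * t0 / 2 ^ k) *\<^sub>R (c /\<^sub>R \<kappa>)) \<le> \<kappa> * t0 / 2 ^ k"
    "\<And>k. 0 \<le> B k" "\<And>k h. h \<noteq> 0 \<Longrightarrow> \<rho> k h \<le> B k / norm h powr q" "summable B"
    using mollifier_sequence[of "\<kappa> * t0" q "c /\<^sub>R \<kappa>"] \<kappa> t0 q by (metis mult_pos_pos)
  define t where "t = (\<lambda>k::nat. t0 / 2 ^ k)"
  have t: "0 < t k" "t k \<le> t0" for k using t0 by (auto simp: t_def field_simps)
  define K where "K = (\<lambda>k. {y + h | y h. y \<in> S \<and> h \<in> cball (t k *\<^sub>R c) (\<kappa> * t k)})"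
  have [measurable]: "conv w (\<rho> k) \<in> borel_measurable borel" for k
    using mollifier.conv_measurable[OF \<rho>(1)] by simp
  have lim: "AE x in lborel. (\<lambda>k. conv w (\<rho> k) x) \<longlonglongrightarrow> w x"
    by (rule conv_AE_tendsto[OF \<rho>(1) w p fin \<rho>(3,4,5)])
  have en: "(\<lambda>k. energy q p (\<lambda>x. conv w (\<rho> k) x - w x)) \<longlonglongrightarrow> 0"
    by (rule energy_diff_tendsto_0)
      (use p lim fin mollifier.energy_conv_le[OF \<rho>(1) w p] in auto)
  have supp: "conv w (\<rho> k) x = 0" if "x \<notin> K k" for k x
  proof -
    have "w y * \<rho> k (x - y) = 0" for y
    proof (rule ccontr)
      assume "w y * \<rho> k (x - y) \<noteq> 0"
      then have "y \<in> S" "norm ((x - y) - t k *\<^sub>R c) \<le> \<kappa> * t k"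
        using S(2)[of y] \<rho>(2)[of k "x - y"] \<kappa> by (auto simp: t_def field_simps)
      then have "x - y \<in> cball (t k *\<^sub>R c) (\<kappa> * t k)" by (simp add: dist_norm norm_minus_commute)
      then have "x \<in> K k" using \<open>y \<in> S\<close> unfolding K_def by (intro CollectI exI[of _ y] exI[of _ "x - y"]) auto
      then show False using that by simp
    qed
    then have "(\<lambda>y. w y * \<rho> k (x - y)) = (\<lambda>_. 0)" by blast
    then show ?thesis by (simp add: conv_def)
  qed
  have K: "compact (K k)" "K k \<subseteq> \<Omega>" for k
  proof -
    show "compact (K k)" unfolding K_def by (rule compact_sums) (use S in auto)
    show "K k \<subseteq> \<Omega>" using cone[OF t] by (auto simp: K_def dist_norm norm_minus_commute)
  qed
  have "\<exists>M. \<forall>x. \<bar>conv w (\<rho> k) x\<bar> \<le> M" for k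
    using mollifier.conv_bound[OF \<rho>(1) w] by blast
  then have "approximates q p \<Omega> (\<lambda>k. conv w (\<rho> k)) w"
    unfolding approximates_def
  proof (intro conjI allI)
    show "\<exists>K. compact K \<and> K \<subseteq> \<Omega> \<and> (\<forall>x. x \<notin> K \<longrightarrow> conv w (\<rho> k) x = 0)" for k
      using K[of k] supp[of _ k] by blast
  qed (use lim en in auto)
  then show ?thesis by blast
qed

lemma approximates_0: "approximates q p \<Omega> (\<lambda>_ _. 0) (\<lambda>x. 0)"
  by (auto simp: approximates_def energy_def intro!: exI[of _ "{}"])

text \<open>Membership in \<open>W\<^sup>s\<^sup>,\<^sup>p\<close>, for Borel representatives.\<close>
definition finite_W :: "real \<Rightarrow> real \<Rightarrow> ('a::euclidean_space \<Rightarrow> real) \<Rightarrow> bool" where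
  "finite_W q p z \<longleftrightarrow> z \<in> borel_measurable borel \<and> energy q p z < \<infinity> \<and> (\<integral>\<^sup>+x. ennreal (\<bar>z x\<bar> powr p) \<partial>lborel) < \<infinity>"

definition tent :: "'a::euclidean_space \<Rightarrow> real \<Rightarrow> 'a \<Rightarrow> real" where
  "tent a r x = max 0 (min 1 (2 - dist a x / r))"

lemma tent_Lipschitz:
  assumes "r > 0" shows "\<bar>tent a r x - tent a r y\<bar> \<le> (1 / r) * norm (x - y)"
proof -
  have "\<bar>dist a x - dist a y\<bar> \<le> norm (x - y)"
    using abs_dist_diff_le[of x a y] by (simp add: dist_commute dist_norm)
  then have "\<bar>dist a x / r - dist a y / r\<bar> \<le> norm (x - y) / r"
    using assms by (simp add: diff_divide_distrib[symmetric] abs_divide divide_right_mono)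
  then show ?thesis unfolding tent_def by (simp add: max_def min_def) linarith
qed

lemma tent_bounds: "0 \<le> tent a r x" "tent a r x \<le> 1"
  by (auto simp: tent_def)

lemma tent_eq_1: "dist a x \<le> r \<Longrightarrow> 0 < r \<Longrightarrow> tent a r x = 1"
  by (simp add: tent_def)

lemma tent_eq_0: "2 * r \<le> dist a x \<Longrightarrow> 0 < r \<Longrightarrow> tent a r x = 0"
  by (simp add: tent_def pos_le_divide_eq)

lemma tent_measurable [measurable]: "tent a r \<in> borel_measurable borel"
  unfolding tent_def[abs_def] by measurable

lemma finite_W_mult:
  fixes z \<psi> :: "'a::euclidean_space \<Rightarrow> real"
  assumes z: "finite_W q p z" and [measurable]: "\<psi> \<in> borel_measurable borel"
    and \<psi>: "\<And>x. \<bar>\<psi> x\<bar> \<le> 1" "\<And>x y. \<bar>\<psi> x - \<psi> y\<bar> \<le> L * norm (x - y)" "0 \<le> L"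
    and q: "q < p + real DIM('a)" "real DIM('a) < q" and p: "0 \<le> p"
  shows "finite_W q p (\<lambda>x. \<psi> x * z x)"
proof -
  have [measurable]: "z \<in> borel_measurable borel" using z by (simp add: finite_W_def)
  have "(\<integral>\<^sup>+x. ennreal (\<bar>\<psi> x * z x\<bar> powr p) \<partial>lborel) \<le> (\<integral>\<^sup>+x. ennreal (\<bar>z x\<bar> powr p) \<partial>lborel)"
    using \<psi>(1) p
    by (intro nn_integral_mono ennreal_leI powr_mono2) (auto simp: abs_mult intro!: mult_left_le_one_le)
  then have "(\<integral>\<^sup>+x. ennreal (\<bar>\<psi> x * z x\<bar> powr p) \<partial>lborel) < \<infinity>"
    using z by (auto simp: finite_W_def intro: le_less_trans)
  moreover have "energy q p (\<lambda>x. \<psi> x * z x) < \<infinity>"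
    by (rule energy_mult_finite) (use z \<psi> q p in \<open>auto simp: finite_W_def\<close>)
  ultimately show ?thesis by (simp add: finite_W_def)
qed

text \<open>Where |z| \<le> 1 it is bounded by the indicator of a ball containing S, and where |z| >
  1 by |z|^p.\<close>

lemma finite_W_integrable:
  fixes z :: "'a::euclidean_space \<Rightarrow> real"
  assumes z: "finite_W q p z" and p: "1 \<le> p" and b: "bounded S" and S: "\<And>x. x \<notin> S \<Longrightarrow> z x = 0"
  shows "integrable lborel z"
proof -
  have [measurable]: "z \<in> borel_measurable borel" using z by (simp add: finite_W_def)
  obtain a where a: "S \<subseteq> cball 0 a" using bounded_subset_ballD[OF b, of 0] ball_subset_cball by blast
  show ?thesis
  proof (rule integrableI_bounded)
    have "(\<integral>\<^sup>+x. ennreal (norm (z x)) \<partial>lborel) \<le> (\<integral>\<^sup>+x. indicator (cball 0 a) x + ennreal (\<bar>z x\<bar> powr p) \<partial>lborel)"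
    proof (rule nn_integral_mono)
      fix x
      consider "z x = 0" | "x \<in> cball 0 a" "\<bar>z x\<bar> \<le> 1" | "1 < \<bar>z x\<bar>" using S a by force
      then show "ennreal (norm (z x)) \<le> indicator (cball 0 a) x + ennreal (\<bar>z x\<bar> powr p)"
      proof cases
        case 2
        then show ?thesis by (simp add: add_increasing2 ennreal_le_1)
      next
        case 3
        then have "\<bar>z x\<bar> \<le> \<bar>z x\<bar> powr p" using powr_mono[of 1 p "\<bar>z x\<bar>"] p by simp
        then show ?thesis by (simp add: add_increasing ennreal_leI)
      qed simp
    qed
    also have "\<dots> = emeasure lborel (cball (0 :: 'a) a) + (\<integral>\<^sup>+x. ennreal (\<bar>z x\<bar> powr p) \<partial>lborel)"
    proof (subst nn_integral_add)
      show "indicator (cball (0 :: 'a) a) \<in> borel_measurable lborel" by (rule borel_measurable_indicator) simp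
    qed auto
    also have "\<dots> < \<infinity>" using z emeasure_lborel_cball_finite[of "0 :: 'a" a] by (simp add: finite_W_def)
    finally show "(\<integral>\<^sup>+x. ennreal (norm (z x)) \<partial>lborel) < \<infinity>" .
  qed measurable
qed

text \<open>The translates of the part of \<open>closure \<Omega>\<close> near \<open>a\<close> in the direction \<open>c\<close>, together with a ball
  proportional to the length of the translation, stay inside \<open>\<Omega>\<close>.\<close>
abbreviation inner_cone :: "'a::euclidean_space set \<Rightarrow> 'a \<Rightarrow> real \<Rightarrow> real \<Rightarrow> real \<Rightarrow> 'a \<Rightarrow> bool" where
  "inner_cone \<Omega> a r \<kappa> t0 c \<equiv> 0 < r \<and> 0 < \<kappa> \<and> 0 < t0 \<and>
      (\<forall>t y h. 0 < t \<longrightarrow> t \<le> t0 \<longrightarrow> y \<in> closure \<Omega> \<inter> cball a (2 * r) \<longrightarrow> norm (h - t *\<^sub>R c) \<le> \<kappa> * t \<longrightarrow> y + h \<in> \<Omega>)"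

text \<open>This replaces a partition of unity by peeling off one ball at a time. With \<psi> the
  tent at a, the part \<psi> z lives in the ball of radius 2 r where the cone is uniform, and (1 -
  \<psi>) z vanishes on the ball of radius r, hence is covered by the remaining balls.\<close>

lemma approximable_cover:
  fixes z :: "real ^ 'n \<Rightarrow> real"
  assumes q: "q < p + real CARD('n)" "real CARD('n) < q" and p: "1 \<le> p"
    and bd: "bounded \<Omega>"
    and chart: "\<And>a. a \<in> A \<Longrightarrow> inner_cone \<Omega> a (r a) (\<kappa> a) (t0 a) (c a)"
    and A: "finite A"
  shows "finite_W q p z \<Longrightarrow> (\<And>x. z x \<noteq> 0 \<Longrightarrow> x \<in> \<Omega>) \<Longrightarrow> (\<And>x. z x \<noteq> 0 \<Longrightarrow> x \<in> (\<Union>a\<in>A. cball a (r a))) \<Longrightarrow> approximable q p \<Omega> z"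
  using A chart
proof (induction A arbitrary: z rule: finite_induct)
  case empty
  then have "z = (\<lambda>x. 0)" by auto
  then show ?case by (auto intro: approximates_0)
next
  case (insert a A)
  have r: "r a > 0" using insert.prems(4)[of a] by simp
  define \<psi> where "\<psi> = tent a (r a)"
  define u where "u = (\<lambda>x. \<psi> x * z x)"
  define v where "v = (\<lambda>x. (1 - \<psi> x) * z x)"
  have bounds: "0 \<le> \<psi> x" "\<psi> x \<le> 1" for x by (simp_all add: \<psi>_def tent_bounds)
  have Lip: "\<bar>\<psi> x - \<psi> y\<bar> \<le> (1 / r a) * norm (x - y)" for x y
    using tent_Lipschitz[OF r] by (simp add: \<psi>_def)
  have [measurable]: "\<psi> \<in> borel_measurable borel" by (simp add: \<psi>_def)
  have fu: "finite_W q p u"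
    unfolding u_def by (rule finite_W_mult[where L = "1 / r a"]) (use insert.prems(1) bounds Lip q p less_imp_le[OF r] in auto)
  have fv: "finite_W q p v"
    unfolding v_def
  proof (rule finite_W_mult[where L = "1 / r a"])
    show "\<bar>1 - \<psi> x - (1 - \<psi> y)\<bar> \<le> (1 / r a) * norm (x - y)" for x y
      using Lip[of x y] by (simp add: abs_minus_commute)
  qed (use insert.prems(1) bounds q p less_imp_le[OF r] in auto)
  have "approximable q p \<Omega> v"
  proof (rule insert.IH[OF fv])
    fix x assume vx: "v x \<noteq> 0"
    then have "z x \<noteq> 0" by (auto simp: v_def)
    then show "x \<in> \<Omega>" by (rule insert.prems)
    have "x \<in> (\<Union>a\<in>insert a A. cball a (r a))" using \<open>z x \<noteq> 0\<close> by (rule insert.prems)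
    moreover have "x \<notin> cball a (r a)" using vx r by (auto simp: v_def \<psi>_def tent_eq_1)
    ultimately show "x \<in> (\<Union>a\<in>A. cball a (r a))" by auto
  qed (rule insert.prems(4), simp)
  moreover have "approximable q p \<Omega> u"
  proof (rule approximable_chart[where S = "closure \<Omega> \<inter> cball a (2 * r a)" and \<kappa> = "\<kappa> a" and ?t0.0 = "t0 a" and c = "c a"])
    have supp: "x \<in> closure \<Omega> \<inter> cball a (2 * r a)" if "u x \<noteq> 0" for x
    proof -
      have "z x \<noteq> 0" "\<psi> x \<noteq> 0" using that by (auto simp: u_def)
      then have "x \<in> \<Omega>" "\<not> 2 * r a \<le> dist a x"
        using insert.prems(2) tent_eq_0[OF _ r] by (auto simp: \<psi>_def)
      then show ?thesis using closure_subset[of \<Omega>] by auto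
    qed
    then show "\<And>x. u x \<noteq> 0 \<Longrightarrow> x \<in> closure \<Omega> \<inter> cball a (2 * r a)" .
    show "compact (closure \<Omega> \<inter> cball a (2 * r a))" using bd by (intro compact_Int_closed) auto
    show "integrable lborel u"
      by (rule finite_W_integrable[OF fu p, of "cball a (2 * r a)"]) (use supp in auto)
    show "energy q p u < \<infinity>" using fu by (simp add: finite_W_def)
    show "y + h \<in> \<Omega>" if "0 < t" "t \<le> t0 a" "y \<in> closure \<Omega> \<inter> cball a (2 * r a)" "norm (h - t *\<^sub>R c a) \<le> \<kappa> a * t" for t y h
      using insert.prems(4)[of a] that by blast
  qed (use insert.prems(4)[of a] p q in auto)
  ultimately have "approximable q p \<Omega> (\<lambda>x. u x + v x)"
    using approximates_add[where u = u and v = v and p = p and q = q and \<Omega> = \<Omega>] p fu fv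
    unfolding finite_W_def by (metis order.trans zero_le_one)
  then show ?case by (simp add: u_def v_def algebra_simps)
qed

section \<open>Inner cones at a smooth boundary and density\<close>

lemma C_infinity_locally_Lipschitz:
  fixes g :: "real ^ 'n \<Rightarrow> real"
  assumes g: "C_infinity g" and C: "compact C" "convex C"
  obtains L where "L > 0" "\<And>x y. x \<in> C \<Longrightarrow> y \<in> C \<Longrightarrow> \<bar>g x - g y\<bar> \<le> L * norm (x - y)"
proof -
  define D where "D = (\<lambda>a. frechet_derivative g (at a))"
  have D: "(g has_derivative D a) (at a)" for a
    using C_infinity_has_derivative[OF g] by (simp add: D_def)
  have lin: "linear (D a)" for a using D has_derivative_linear by blast
  have "\<exists>M. \<forall>x\<in>C. \<bar>D x i\<bar> \<le> M" for i
  proof -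
    have "compact ((\<lambda>x. D x i) ` C)"
      using C_infinity_continuous[OF C_infinity_frechet_derivative[OF g], of i] C
      by (intro compact_continuous_image) (auto simp: D_def intro: continuous_on_subset)
    then show ?thesis by (auto dest!: compact_imp_bounded simp: bounded_iff)
  qed
  then obtain M where M: "\<And>i x. x \<in> C \<Longrightarrow> \<bar>D x i\<bar> \<le> M i" by metis
  define L where "L = 1 + (\<Sum>i\<in>Basis. \<bar>M i\<bar>)"
  have L: "L > 0" by (simp add: L_def add_pos_nonneg sum_nonneg)
  have on: "onorm (D x) \<le> L" if "x \<in> C" for x
  proof (rule onorm_le)
    fix h
    have "\<bar>D x h\<bar> \<le> (\<Sum>i\<in>Basis. \<bar>M i\<bar>) * norm h"
      by (rule abs_linear_functional_le[OF lin order.trans[OF M[OF that] abs_ge_self]])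
    also have "\<dots> \<le> L * norm h" by (simp add: L_def mult_right_mono)
    finally show "norm (D x h) \<le> L * norm h" by simp
  qed
  have "\<bar>g x - g y\<bar> \<le> L * norm (x - y)" if "x \<in> C" "y \<in> C" for x y
    using differentiable_bound[of C g D L y x] C D on that
    by (simp add: has_derivative_at_withinI abs_minus_commute norm_minus_commute)
  with L show ?thesis by (rule that)
qed

text \<open>Inside \<Omega> a ball suffices, so the direction is 0. At a boundary point the
  direction is the axis e of the graph: moving by t along e gains height t, and a Lipschitz graph
  cannot catch up if the deviation from t e is small compared with t.\<close>

lemma uniform_cone:
  fixes \<Omega> :: "(real ^ 'n) set"
  assumes \<Omega>: "open \<Omega>" "smooth_boundary \<Omega>" and a: "a \<in> closure \<Omega>"
  shows "\<exists>r \<kappa> t0 c. inner_cone \<Omega> a r \<kappa> t0 c"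
proof (cases "a \<in> \<Omega>")
  case True
  then obtain r where r: "r > 0" "cball a r \<subseteq> \<Omega>" using \<Omega> open_contains_cball by blast
  show ?thesis
  proof (rule exI[of _ "r / 4"], rule exI[of _ 1], rule exI[of _ "r / 2"], rule exI[of _ 0], intro conjI allI impI)
    fix t :: real and y h :: "real ^ 'n"
    assume "0 < t" "t \<le> r / 2" "y \<in> closure \<Omega> \<inter> cball a (2 * (r / 4))" "norm (h - t *\<^sub>R 0) \<le> 1 * t"
    then have "dist a (y + h) \<le> r"
      using dist_triangle[of a "y + h" y] by (auto simp: dist_norm)
    then show "y + h \<in> \<Omega>" using r by auto
  qed (use r(1) in simp_all)
next
  case False
  then have "a \<in> frontier \<Omega>" using a \<Omega> by (simp add: frontier_def interior_open)
  then obtain r e g where r: "r > 0" and e: "norm e = 1" and g: "C_infinity g"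
    and eq: "\<Omega> \<inter> ball a r = {x \<in> ball a r. g (x - (x \<bullet> e) *\<^sub>R e) < x \<bullet> e}"
    using \<Omega> unfolding smooth_boundary_def by blast
  define P where "P = (\<lambda>x. x - (x \<bullet> e) *\<^sub>R e)"
  have P_diff: "P x - P y = P (x - y)" for x y by (simp add: P_def algebra_simps)
  have ee: "e \<bullet> e = 1" using e by (simp add: dot_square_norm)
  have P_te: "P (h - t *\<^sub>R e) = P h" for h t by (simp add: P_def ee algebra_simps)
  have P_norm: "norm (P h) \<le> 2 * norm h" for h
  proof -
    have "norm (P h) \<le> norm h + norm ((h \<bullet> e) *\<^sub>R e)" unfolding P_def by (rule norm_triangle_ineq4)
    also have "norm ((h \<bullet> e) *\<^sub>R e) \<le> norm h" using Cauchy_Schwarz_ineq2[of h e] e by simp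
    finally show ?thesis by simp
  qed
  have P_cont: "continuous_on UNIV P" unfolding P_def by (intro continuous_intros)
  \<comment> \<open>The projection at most doubles distances, so this ball contains the projections
    of all points of \<open>ball a r\<close>.\<close>
  obtain L where L: "L > 0" "\<And>x y. x \<in> cball (P a) (2 * r) \<Longrightarrow> y \<in> cball (P a) (2 * r) \<Longrightarrow> \<bar>g x - g y\<bar> \<le> L * norm (x - y)"
    using C_infinity_locally_Lipschitz[OF g, of "cball (P a) (2 * r)"] by auto
  \<comment> \<open>A deviation of size \<kappa> t from t e costs at most \<kappa> t in height and
    raises g by at most 2 L \<kappa> t. The choice makes the total loss t / 2, so half of the gain
    survives.\<close>
  define \<kappa> where "\<kappa> = 1 / (2 * (1 + 2 * L))"
  have \<kappa>: "\<kappa> > 0" "\<kappa> \<le> 1" using L by (auto simp: \<kappa>_def field_simps)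
  \<comment> \<open>On the closure of \<Omega> the strict inequality of the chart degrades to a weak
    one; the surviving gain t / 2 makes it strict again after the translation.\<close>
  have closed_side: "g (P y) \<le> y \<bullet> e" if "y \<in> closure \<Omega>" "y \<in> ball a r" for y
  proof -
    have "y \<in> closure (\<Omega> \<inter> ball a r)" using that open_Int_closure_subset[of "ball a r" \<Omega>] by (auto simp: Int_commute)
    moreover have "closure (\<Omega> \<inter> ball a r) \<subseteq> {x. g (P x) \<le> x \<bullet> e}"
    proof (rule closure_minimal)
      show "\<Omega> \<inter> ball a r \<subseteq> {x. g (P x) \<le> x \<bullet> e}" unfolding eq P_def by auto
      have "continuous_on UNIV (\<lambda>x. g (P x))"
        by (rule continuous_on_compose2[OF C_infinity_continuous[OF g] P_cont]) auto
      then show "closed {x. g (P x) \<le> x \<bullet> e}" by (intro closed_Collect_le continuous_intros)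
    qed
    ultimately show ?thesis by auto
  qed
  show ?thesis
  proof (rule exI[of _ "r / 8"], rule exI[of _ \<kappa>], rule exI[of _ "r / 4"], rule exI[of _ e], intro conjI allI impI)
    fix t :: real and y h :: "real ^ 'n"
    assume t: "0 < t" "t \<le> r / 4" and y: "y \<in> closure \<Omega> \<inter> cball a (2 * (r / 8))" and h: "norm (h - t *\<^sub>R e) \<le> \<kappa> * t"
    have "norm h \<le> norm (h - t *\<^sub>R e) + norm (t *\<^sub>R e)" using norm_triangle_ineq[of "h - t *\<^sub>R e" "t *\<^sub>R e"] by simp
    also have "\<dots> \<le> \<kappa> * t + t" using h t e by simp
    also have "\<dots> \<le> 1 * t + t" using \<kappa> t by (intro add_right_mono mult_right_mono) auto
    finally have hn: "norm h \<le> r / 2" using t by simp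
    have da: "dist a y \<le> r / 4" using y by simp
    have ball: "y \<in> ball a r" "y + h \<in> ball a r"
      using da hn r dist_triangle[of a "y + h" y] by (auto simp: dist_norm)
    have Pb: "P x \<in> cball (P a) (2 * r)" if "x \<in> ball a r" for x
    proof -
      have "dist (P a) (P x) = norm (P (a - x))" by (simp add: dist_norm P_diff)
      also have "\<dots> \<le> 2 * norm (a - x)" by (rule P_norm)
      also have "\<dots> \<le> 2 * r" using that by (simp add: dist_norm)
      finally show ?thesis by simp
    qed
    have "g (P (y + h)) - g (P y) \<le> L * norm (P (y + h) - P y)"
      using L(2)[OF Pb[OF ball(2)] Pb[OF ball(1)]] by linarith
    also have "P (y + h) - P y = P (h - t *\<^sub>R e)" by (simp add: P_diff P_te)
    also have "L * norm \<dots> \<le> L * (2 * (\<kappa> * t))"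
      using P_norm[of "h - t *\<^sub>R e"] h L by (intro mult_left_mono) auto
    finally have 1: "g (P (y + h)) \<le> y \<bullet> e + 2 * L * \<kappa> * t"
      using closed_side[of y] y ball by simp
    have "\<bar>(h - t *\<^sub>R e) \<bullet> e\<bar> \<le> \<kappa> * t"
      using Cauchy_Schwarz_ineq2[of "h - t *\<^sub>R e" e] e h by simp
    then have 2: "h \<bullet> e \<ge> t - \<kappa> * t" by (simp add: inner_diff_left ee)
    have "(1 + 2 * L) * \<kappa> = 1 / 2" using L by (simp add: \<kappa>_def)
    then have "\<kappa> * t + 2 * L * \<kappa> * t = t / 2" by (metis (no_types) distrib_right mult_1 times_divide_eq_left)
    then have "g (P (y + h)) < (y + h) \<bullet> e" using 1 2 t by (simp add: inner_add_left)
    then have "y + h \<in> \<Omega> \<inter> ball a r" unfolding eq using ball by (auto simp: P_def)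
    then show "y + h \<in> \<Omega>" by simp
  qed (use r \<kappa> in auto)
qed

text \<open>This is the density of bounded compactly supported functions, needed since the equations
  can be tested only with such functions. Compactness of the closure of \<Omega> leaves finitely
  many cones.\<close>

theorem approximable_finite_W:
  fixes z :: "real ^ 'n \<Rightarrow> real"
  assumes \<Omega>: "open \<Omega>" "bounded \<Omega>" "smooth_boundary \<Omega>"
    and q: "q < p + real CARD('n)" "real CARD('n) < q" and p: "1 \<le> p"
    and z: "finite_W q p z" "\<And>x. z x \<noteq> 0 \<Longrightarrow> x \<in> \<Omega>"
  shows "approximable q p \<Omega> z"
proof -
  have "\<forall>a\<in>closure \<Omega>. \<exists>r \<kappa> t0 c. inner_cone \<Omega> a r \<kappa> t0 c"
    using uniform_cone[OF \<Omega>(1,3)] by blast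
  then obtain r \<kappa> t0 c where chart: "\<And>a. a \<in> closure \<Omega> \<Longrightarrow> inner_cone \<Omega> a (r a) (\<kappa> a) (t0 a) (c a)"
    unfolding bchoice_iff by metis
  have cover: "closure \<Omega> \<subseteq> (\<Union>a\<in>closure \<Omega>. ball a (r a))" using chart by fastforce
  obtain A where A: "A \<subseteq> closure \<Omega>" "finite A" "closure \<Omega> \<subseteq> (\<Union>a\<in>A. ball a (r a))"
    by (rule compactE_image[OF _ _ cover]) (use \<Omega>(2) in auto)
  show ?thesis
  proof (rule approximable_cover[where r = r and \<kappa> = \<kappa> and ?t0.0 = t0 and c = c and A = A, OF q p \<Omega>(2) _ A(2) z])
    show "x \<in> (\<Union>a\<in>A. cball a (r a))" if "z x \<noteq> 0" for x
    proof -
      have "x \<in> closure \<Omega>" using z(2)[OF that] closure_subset by blast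
      then obtain a where "a \<in> A" "x \<in> ball a (r a)" using A(3) by blast
      then show ?thesis by (auto intro!: bexI[of _ a])
    qed
    show "inner_cone \<Omega> a (r a) (\<kappa> a) (t0 a) (c a)"
      if "a \<in> A" for a
      by (rule chart) (use A(1) that in blast)
  qed
qed

section \<open>Testing the equation with functions of finite energy\<close>

lemma emeasure_compact_less_top:
  "compact K \<Longrightarrow> emeasure lborel (K :: 'a::euclidean_space set) < top"
  using emeasure_bounded_finite[OF compact_imp_bounded] by simp

text \<open>Two layers of width d are needed: K1 receives the supports after mollification at scale
  d, and a point of K1 is at distance more than d from every point outside K2, so such pairs stay
  away from the diagonal.\<close>

lemma compact_neighbourhoods:
  fixes K :: "'a::euclidean_space set"
  assumes "compact K" "open \<Omega>" "K \<subseteq> \<Omega>"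
  obtains d K1 K2 where "d > 0" "compact K1" "compact K2" "K2 \<subseteq> \<Omega>" "K \<subseteq> K1" "K1 \<subseteq> K2"
    "\<And>x y. x \<in> K \<Longrightarrow> norm (x - y) \<le> d \<Longrightarrow> y \<in> K1"
    "\<And>x y. x \<in> K1 \<Longrightarrow> norm (x - y) \<le> d \<Longrightarrow> y \<in> K2"
proof -
  obtain e where e: "e > 0" "(\<Union>x\<in>K. cball x e) \<subseteq> \<Omega>"
    using compact_subset_open_imp_cball_epsilon_subset[OF assms] by blast
  define N where "N = (\<lambda>r. {x + h | x h. x \<in> K \<and> h \<in> cball (0 :: 'a) r})"
  have mem: "y \<in> N r \<longleftrightarrow> (\<exists>x\<in>K. norm (x - y) \<le> r)" for y r
  proof
    assume "\<exists>x\<in>K. norm (x - y) \<le> r"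
    then obtain x where "x \<in> K" "norm (x - y) \<le> r" by blast
    then show "y \<in> N r" unfolding N_def
      by (intro CollectI exI[of _ x] exI[of _ "y - x"]) (auto simp: norm_minus_commute)
  next
    assume "y \<in> N r"
    then obtain x h where "x \<in> K" "norm h \<le> r" "y = x + h" by (auto simp: N_def)
    then show "\<exists>x\<in>K. norm (x - y) \<le> r" by (intro bexI[of _ x]) auto
  qed
  have "compact (N r)" for r unfolding N_def using assms by (intro compact_sums) auto
  moreover have "N e \<subseteq> \<Omega>" using e(2) by (auto simp: mem dist_norm subset_iff)
  moreover have "K \<subseteq> N (e / 2)" "N (e / 2) \<subseteq> N e" using e(1) by (force simp: mem)+
  moreover have "y \<in> N (e / 2)" if "x \<in> K" "norm (x - y) \<le> e / 2" for x y using that by (auto simp: mem)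
  moreover have "y \<in> N e" if xy: "x \<in> N (e / 2)" "norm (x - y) \<le> e / 2" for x y
  proof -
    obtain a where "a \<in> K" "norm (a - x) \<le> e / 2" using xy(1) unfolding mem by blast
    then have "norm (a - y) \<le> e" using xy norm_triangle_ineq[of "a - x" "x - y"] by simp
    then show ?thesis using \<open>a \<in> K\<close> by (auto simp: mem)
  qed
  ultimately show ?thesis using that[of "e / 2" "N (e / 2)" "N e"] e(1) by simp
qed

text \<open>At distance at least d, the term in f is integrated in y with the uniform tail bound of
  the kernel; for the term in g the kernel is at most d^(-q), and the integrals over x in A and over
  y separate.\<close>

lemma kernel_tail_finite:
  fixes f g :: "'a::euclidean_space \<Rightarrow> ennreal"
  assumes [measurable]: "f \<in> borel_measurable borel" "g \<in> borel_measurable borel" "A \<in> sets borel"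
    and q: "q > real DIM('a)" and d: "d > 0"
    and f: "(\<integral>\<^sup>+x. indicator A x * f x \<partial>lborel) < \<infinity>" and g: "(\<integral>\<^sup>+x. g x \<partial>lborel) < \<infinity>"
    and A: "emeasure lborel A < \<infinity>"
  shows "(\<integral>\<^sup>+z. indicator A (fst z) * indicator {d..} (norm (fst z - snd z)) * (f (fst z) + g (snd z)) \<partial>kernel_measure q) < \<infinity>"
proof -
  obtain C where C: "C \<ge> 0" "\<And>x::'a. (\<integral>\<^sup>+ y. indicator {y. d \<le> norm (x - y)} y * ennreal (kern q x y) \<partial>lborel) \<le> ennreal C"
    using kernel_tail[OF q d] by blast
  let ?F = "\<lambda>x y. ennreal (kern q x y) * (indicator A x * indicator {d..} (norm (x - y)) * (f x + g y))"
  let ?I = "\<lambda>x y. indicator {y. d \<le> norm (x - y)} y * ennreal (kern q x y)"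
  let ?c = "ennreal (1 / d powr q)"
  have "(\<integral>\<^sup>+z. indicator A (fst z) * indicator {d..} (norm (fst z - snd z)) * (f (fst z) + g (snd z)) \<partial>kernel_measure q)
     = (\<integral>\<^sup>+x. \<integral>\<^sup>+y. ?F x y \<partial>lborel \<partial>lborel)"
    by (subst nn_integral_kernel_measure) auto
  also have "\<dots> \<le> (\<integral>\<^sup>+x. indicator A x * f x * ennreal C + indicator A x * (?c * (\<integral>\<^sup>+y. g y \<partial>lborel)) \<partial>lborel)"
  proof (rule nn_integral_mono)
    fix x :: 'a
    have "(\<integral>\<^sup>+y. ?F x y \<partial>lborel) \<le> (\<integral>\<^sup>+y. indicator A x * f x * ?I x y + indicator A x * (?c * g y) \<partial>lborel)"
    proof (rule nn_integral_mono)
      fix y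
      have "kern q x y \<le> 1 / d powr q" if "d \<le> norm (x - y)"
        using that d q by (intro divide_left_mono powr_mono2 mult_pos_pos) auto
      then have "d \<le> norm (x - y) \<Longrightarrow> ennreal (kern q x y) * g y \<le> ?c * g y"
        by (intro mult_right_mono ennreal_leI) auto
      then show "?F x y \<le> indicator A x * f x * ?I x y + indicator A x * (?c * g y)"
        by (auto simp: indicator_def distrib_left mult.commute[of "f x"] intro!: add_left_mono)
    qed
    also have "\<dots> = indicator A x * f x * (\<integral>\<^sup>+y. ?I x y \<partial>lborel) + indicator A x * (?c * (\<integral>\<^sup>+y. g y \<partial>lborel))"
      by (simp add: nn_integral_add nn_integral_cmult)
    also have "\<dots> \<le> indicator A x * f x * ennreal C + indicator A x * (?c * (\<integral>\<^sup>+y. g y \<partial>lborel))"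
      by (intro add_right_mono mult_left_mono C) auto
    finally show "(\<integral>\<^sup>+y. ?F x y \<partial>lborel) \<le> indicator A x * f x * ennreal C + indicator A x * (?c * (\<integral>\<^sup>+y. g y \<partial>lborel))" .
  qed
  also have "\<dots> = (\<integral>\<^sup>+x. indicator A x * f x \<partial>lborel) * ennreal C + emeasure lborel A * (?c * (\<integral>\<^sup>+y. g y \<partial>lborel))"
    by (simp add: nn_integral_add nn_integral_multc)
  also have "\<dots> < \<infinity>" using f g A by (simp add: ennreal_mult_less_top)
  finally show ?thesis .
qed

text \<open>Pairs with one point in K and the other outside K1 have distance more than d and are
  controlled by boundedness of w and the tail of the kernel; pairs missing K contribute nothing.
  Only K1 x K1 is left for the local hypothesis.\<close>

lemma energy_finite_of_local:
  fixes w :: "'a::euclidean_space \<Rightarrow> real"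
  assumes [measurable]: "w \<in> borel_measurable borel" and q: "q > real DIM('a)" and p: "0 \<le> p"
    and K: "compact K" "K1 \<in> sets borel" and d: "d > 0" "\<And>x y. x \<in> K \<Longrightarrow> norm (x - y) \<le> d \<Longrightarrow> y \<in> K1"
    and w: "\<And>x. \<bar>w x\<bar> \<le> M" "\<And>x. x \<notin> K \<Longrightarrow> w x = 0"
    and loc: "local_energy q p K1 w < \<infinity>"
  shows "energy q p w < \<infinity>"
proof -
  define T where "T = (\<lambda>z :: 'a \<times> 'a. indicator K (fst z) * indicator {d..} (norm (fst z - snd z)) * (ennreal (M powr p) + 0))"
  have [measurable]: "K \<in> sets borel" "K1 \<in> sets borel" using K by (auto intro: borel_compact)
  have [measurable]: "T \<in> borel_measurable borel" unfolding T_def by measurable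
  have [measurable]: "K1 \<times> K1 \<in> sets borel" by (intro borel_Times) auto
  have Kfin: "emeasure lborel K < \<infinity>" using K(1) by (simp add: emeasure_compact_less_top)
  have T: "(\<integral>\<^sup>+z. T z \<partial>kernel_measure q) < \<infinity>"
    unfolding T_def
  proof (rule kernel_tail_finite[OF _ _ _ q d(1)])
    show "(\<integral>\<^sup>+x. indicator K x * ennreal (M powr p) \<partial>lborel) < \<infinity>"
      using Kfin by (simp add: nn_integral_multc ennreal_mult_less_top)
  qed (use Kfin in auto)
  have pt: "ennreal (\<bar>incr w z\<bar> powr p) \<le> indicator (K1 \<times> K1) z * ennreal (\<bar>incr w z\<bar> powr p) + (T z + T (snd z, fst z))" for z
  proof -
    have sub: "K \<subseteq> K1" using d by force
    consider "z \<in> K1 \<times> K1" | "fst z \<notin> K" "snd z \<notin> K" | "fst z \<in> K" "snd z \<notin> K1" | "snd z \<in> K" "fst z \<notin> K1"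
      using sub by (cases z) auto
    then show ?thesis
    proof cases
      case 3
      then have "d \<le> norm (fst z - snd z)" using d(2)[of "fst z" "snd z"] by linarith
      moreover have "w (snd z) = 0" using 3 sub w(2) by blast
      moreover have "\<bar>w (fst z)\<bar> powr p \<le> M powr p" using w(1) p by (intro powr_mono2) auto
      ultimately have "ennreal (\<bar>incr w z\<bar> powr p) \<le> T z"
        using 3 by (simp add: T_def ennreal_leI)
      then show ?thesis by (simp add: add_increasing add_increasing2)
    next
      case 4
      then have "d \<le> norm (snd z - fst z)" using d(2)[of "snd z" "fst z"] by linarith
      moreover have "w (fst z) = 0" using 4 sub w(2) by blast
      moreover have "\<bar>w (snd z)\<bar> powr p \<le> M powr p" using w(1) p by (intro powr_mono2) auto
      ultimately have "ennreal (\<bar>incr w z\<bar> powr p) \<le> T (snd z, fst z)"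
        using 4 by (simp add: T_def ennreal_leI)
      then show ?thesis by (simp add: add_increasing add_increasing2)
    qed (use w(2) in auto)
  qed
  have "energy q p w \<le> (\<integral>\<^sup>+z. indicator (K1 \<times> K1) z * ennreal (\<bar>incr w z\<bar> powr p) + (T z + T (snd z, fst z)) \<partial>kernel_measure q)"
    unfolding energy_def by (intro nn_integral_mono pt)
  also have "\<dots> = local_energy q p K1 w
     + ((\<integral>\<^sup>+z. T z \<partial>kernel_measure q) + (\<integral>\<^sup>+z. T (snd z, fst z) \<partial>kernel_measure q))"
    by (simp add: nn_integral_add)
  also have "(\<integral>\<^sup>+z. T (snd z, fst z) \<partial>kernel_measure q) = (\<integral>\<^sup>+z. T z \<partial>kernel_measure q)"
    by (rule nn_integral_kernel_measure_swap) measurable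
  finally show ?thesis using loc T by (auto intro: le_less_trans)
qed

text \<open>The equation for a Borel representative, with the right-hand side as an abstract
  function h. The right-hand side stays a Lebesgue integral because f, and hence h, need not be
  Borel. Integrability of |u|^(p-1) controls the interactions far from the diagonal.\<close>

locale local_weak_solution =
  fixes q p :: real and \<Omega> :: "(real ^ 'n) set" and u h :: "real ^ 'n \<Rightarrow> real"
  assumes p: "1 < p" and q: "real CARD('n) < q" and open_domain: "open \<Omega>"
    and measurable_solution [measurable]: "u \<in> borel_measurable borel"
    and power_integrable: "(\<integral>\<^sup>+x. ennreal (\<bar>u x\<bar> powr (p - 1)) \<partial>lborel) < \<infinity>"
    and local_energy: "\<And>K. compact K \<Longrightarrow> K \<subseteq> \<Omega> \<Longrightarrow>
      local_energy q p K u < \<infinity>"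
    and rhs_integrable: "\<And>K. compact K \<Longrightarrow> K \<subseteq> \<Omega> \<Longrightarrow> set_integrable lebesgue K h"
    and weak_eq: "\<And>\<phi>. test_function \<Omega> \<phi> \<Longrightarrow>
      (\<integral>z. signed_power p (incr u z) * (incr \<phi> z) \<partial>kernel_measure q) =
      (LINT x:\<Omega>|lebesgue. h x * \<phi> x)"
begin

lemma rhs_set_integrable:
  assumes [measurable]: "w \<in> borel_measurable borel" and K: "compact K" "K \<subseteq> \<Omega>"
    and w: "\<And>x. \<bar>w x\<bar> \<le> M" "\<And>x. x \<notin> K \<Longrightarrow> w x = 0"
  shows "set_integrable lebesgue \<Omega> (\<lambda>x. h x * w x)"
proof -
  have int: "integrable lebesgue (\<lambda>x. indicator K x * h x)"
    using rhs_integrable[OF K] by (simp add: set_integrable_def)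
  have w': "w \<in> borel_measurable lebesgue" by (simp add: measurable_completion)
  have "integrable lebesgue (\<lambda>x. (indicator K x * h x) * w x)"
  proof (rule Bochner_Integration.integrable_bound)
    show "integrable lebesgue (\<lambda>x. M * (indicator K x * h x))" using int by simp
    show "(\<lambda>x. (indicator K x * h x) * w x) \<in> borel_measurable lebesgue"
      by (rule borel_measurable_times[OF borel_measurable_integrable[OF int] w'])
    have "\<bar>indicator K x * h x\<bar> * \<bar>w x\<bar> \<le> \<bar>indicator K x * h x\<bar> * \<bar>M\<bar>" for x
      by (intro mult_left_mono order.trans[OF w(1) abs_ge_self]) auto
    then show "AE x in lebesgue. norm (indicator K x * h x * w x) \<le> norm (M * (indicator K x * h x))"
      by (intro AE_I2) (simp add: abs_mult mult_ac)
  qed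
  moreover have "(\<lambda>x. (indicator K x * h x) * w x) = (\<lambda>x. indicator \<Omega> x *\<^sub>R (h x * w x))"
    by (intro ext) (use w(2) K(2) in \<open>auto simp: indicator_def\<close>)
  ultimately show ?thesis by (simp add: set_integrable_def)
qed

text \<open>The function w is mollified into test functions supported in K1. On the left the
  majorant G + |incr (\<phi> k)|^p varies with k, and convergence of the energies lets Pratt's lemma
  apply; on the right the uniform bound M and the compact set K1 give ordinary dominated
  convergence.\<close>

proposition weak_eq_extended:
  assumes [measurable]: "w \<in> borel_measurable borel" and K: "compact K" "K \<subseteq> \<Omega>"
    and w: "\<And>x. \<bar>w x\<bar> \<le> M" "\<And>x. x \<notin> K \<Longrightarrow> w x = 0" and en: "energy q p w < \<infinity>"
  shows "integrable (kernel_measure q) (\<lambda>z. signed_power p (incr u z) * (incr w z))"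
    and "(\<integral>z. signed_power p (incr u z) * (incr w z) \<partial>kernel_measure q) =
      (LINT x:\<Omega>|lebesgue. h x * w x)"
proof -
  let ?\<mu> = "kernel_measure q :: ((real ^ 'n) \<times> (real ^ 'n)) measure"
  obtain d K1 K2 where d: "d > 0" and K12: "compact K1" "compact K2" "K2 \<subseteq> \<Omega>" "K \<subseteq> K1" "K1 \<subseteq> K2"
    and nb: "\<And>x y. x \<in> K \<Longrightarrow> norm (x - y) \<le> d \<Longrightarrow> y \<in> K1"
      "\<And>x y. x \<in> K1 \<Longrightarrow> norm (x - y) \<le> d \<Longrightarrow> y \<in> K2"
    using compact_neighbourhoods[OF K(1) open_domain K(2)] by metis
  have [measurable]: "K1 \<in> sets borel" "K2 \<in> sets borel" using K12 by (auto intro: borel_compact)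
  have M: "0 \<le> M" using w(1)[of undefined] by linarith
  have w_int: "integrable lborel w"
  proof (rule Bochner_Integration.integrable_bound)
    show "integrable lborel (\<lambda>x. M * indicator K x)"
      using K(1) by (intro integrable_mult_right integrable_real_indicator)
        (auto simp: borel_compact emeasure_compact_less_top)
    show "AE x in lborel. norm (w x) \<le> norm (M * indicator K x)"
      using w M by (auto simp: indicator_def)
  qed measurable
  obtain \<rho> A B where \<rho>: "\<And>k. mollifier (\<rho> k) (A k)"
    "\<And>k x. \<rho> k x \<noteq> 0 \<Longrightarrow> norm (x - (d / 2 ^ k) *\<^sub>R (0 :: real ^ 'n)) \<le> d / 2 ^ k"
    "\<And>k. 0 \<le> B k" "\<And>k x. x \<noteq> 0 \<Longrightarrow> \<rho> k x \<le> B k / norm x powr q" "summable B"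
    "(0 :: real ^ 'n) = 0 \<Longrightarrow> \<forall>k. C_infinity (\<rho> k)"
    by (rule mollifier_sequence[OF d q, where b = 0]) (rule that, assumption+)
  define \<phi> where "\<phi> = (\<lambda>k. conv w (\<rho> k))"
  have [measurable]: "\<phi> k \<in> borel_measurable borel" for k
    unfolding \<phi>_def using mollifier.conv_measurable[OF \<rho>(1)] by simp
  have \<rho>_supp: "norm x \<le> d" if "\<rho> k x \<noteq> 0" for k x
  proof -
    have "norm x \<le> d / 2 ^ k" using \<rho>(2)[OF that] by simp
    also have "\<dots> \<le> d / 1" using d by (intro divide_left_mono) auto
    finally show ?thesis by simp
  qed
  have \<phi>_le: "\<bar>\<phi> k x\<bar> \<le> M" for k x
    unfolding \<phi>_def by (rule mollifier.conv_bound_sup[OF \<rho>(1) w_int w(1)])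
  have \<phi>_supp: "\<phi> k x = 0" if "x \<notin> K1" for k x
  proof -
    have "w y * \<rho> k (x - y) = 0" for y
    proof (rule ccontr)
      assume *: "w y * \<rho> k (x - y) \<noteq> 0"
      then have "y \<in> K" using w(2) by force
      moreover have "norm (y - x) \<le> d" using * \<rho>_supp[of k "x - y"] by (simp add: norm_minus_commute)
      ultimately show False using nb(1) that by blast
    qed
    then have "(\<lambda>y. w y * \<rho> k (x - y)) = (\<lambda>_. 0)" by blast
    then show ?thesis by (simp add: \<phi>_def conv_def)
  qed
  have \<phi>_test: "test_function \<Omega> (\<phi> k)" for k
  proof -
    have sub: "closure {x. \<phi> k x \<noteq> 0} \<subseteq> K1"
      by (rule closure_minimal) (use \<phi>_supp K12 in \<open>auto intro: compact_imp_closed\<close>)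
    have "\<rho> k x = 0" if "norm x > d" for x using \<rho>_supp[of k x] that by linarith
    then have "C_infinity (\<phi> k)"
      unfolding \<phi>_def conv_def[abs_def] by (rule C_infinity_conv[OF w_int \<rho>(6)[OF refl, rule_format]])
    moreover have "compact (closure {x. \<phi> k x \<noteq> 0})"
      using compact_Int_closed[OF K12(1) closed_closure, of "{x. \<phi> k x \<noteq> 0}"] sub by (simp add: Int_absorb1)
    ultimately show ?thesis using sub K12 by (auto simp: test_function_def)
  qed
  have \<phi>_lim: "AE x in lborel. (\<lambda>k. \<phi> k x) \<longlonglongrightarrow> w x"
    unfolding \<phi>_def by (rule conv_AE_tendsto[OF \<rho>(1) w_int less_imp_le[OF p] en \<rho>(3,4,5)])
  have \<phi>_en: "energy q p (\<phi> k) \<le> energy q p w" for k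
    unfolding \<phi>_def by (rule mollifier.energy_conv_le[OF \<rho>(1) w_int less_imp_le[OF p]])
  have en_lim: "(\<lambda>k. \<integral>z. \<bar>incr (\<phi> k) z\<bar> powr p \<partial>?\<mu>) \<longlonglongrightarrow> (\<integral>z. \<bar>incr w z\<bar> powr p \<partial>?\<mu>)"
    by (rule integral_energy_tendsto) (use p \<phi>_lim \<phi>_en en in auto)

  \<comment> \<open>T bounds the far interactions with first point in K1; its reflection handles the
    second point.\<close>
  define T where "T = (\<lambda>z :: (real ^ 'n) \<times> (real ^ 'n). indicator K1 (fst z) * indicator {d..} (norm (fst z - snd z)) *
      (\<bar>u (fst z)\<bar> powr (p - 1) + \<bar>u (snd z)\<bar> powr (p - 1)))"
  have [measurable]: "T \<in> borel_measurable borel" unfolding T_def by measurable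
  have T_nonneg: "0 \<le> T z" for z by (simp add: T_def)
  have T_fin: "(\<integral>\<^sup>+z. ennreal (T z) \<partial>?\<mu>) < \<infinity>"
  proof -
    have "(\<integral>\<^sup>+x. indicator K1 x * ennreal (\<bar>u x\<bar> powr (p - 1)) \<partial>lborel) \<le> (\<integral>\<^sup>+x. ennreal (\<bar>u x\<bar> powr (p - 1)) \<partial>lborel)"
      by (intro nn_integral_mono) (auto simp: indicator_def)
    also note power_integrable
    finally have "(\<integral>\<^sup>+z. indicator K1 (fst z) * indicator {d..} (norm (fst z - snd z)) * (ennreal (\<bar>u (fst z)\<bar> powr (p - 1)) + ennreal (\<bar>u (snd z)\<bar> powr (p - 1))) \<partial>?\<mu>) < \<infinity>"
      using K12(1) power_integrable q
      by (intro kernel_tail_finite[OF _ _ _ _ d]) (auto simp: emeasure_compact_less_top)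
    moreover have "ennreal (T z) = indicator K1 (fst z) * indicator {d..} (norm (fst z - snd z)) * (ennreal (\<bar>u (fst z)\<bar> powr (p - 1)) + ennreal (\<bar>u (snd z)\<bar> powr (p - 1)))" for z
      by (auto simp: T_def indicator_def)
    ultimately show ?thesis by simp
  qed
  have T_int: "integrable (?\<mu>) T"
    by (rule integrableI_nonneg) (use T_fin T_nonneg in auto)
  have T_swap_int: "integrable (?\<mu>) (\<lambda>z. T (snd z, fst z))"
  proof (rule integrableI_nonneg)
    show "(\<integral>\<^sup>+z. ennreal (T (snd z, fst z)) \<partial>?\<mu>) < \<infinity>"
      using T_fin nn_integral_kernel_measure_swap[of "\<lambda>z. ennreal (T z)" q] by simp
  qed (use T_nonneg in auto)
  define L where "L = (\<lambda>z. indicator (K2 \<times> K2) z * \<bar>incr u z\<bar> powr p)"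
  have K22 [measurable]: "K2 \<times> K2 \<in> sets borel" using K12 by (auto intro!: borel_compact compact_Times)
  have L_int: "integrable (?\<mu>) L"
  proof (rule integrableI_nonneg)
    show "L \<in> borel_measurable (?\<mu>)" unfolding L_def by measurable
    have "ennreal (L z) = indicator (K2 \<times> K2) z * ennreal (\<bar>incr u z\<bar> powr p)" for z
      by (auto simp: L_def indicator_def)
    then show "(\<integral>\<^sup>+z. ennreal (L z) \<partial>?\<mu>) < \<infinity>"
      using local_energy[OF K12(2,3)] by simp
  qed (auto simp: L_def)
  \<comment> \<open>One factor M bounds the increment of the test function when it vanishes at one
    of the points; 2^(p-1) comes from splitting |u x - u y|^(p-1) into the two values.\<close>
  define c where "c = M * 2 powr (p - 1)"
  have c: "0 \<le> c" using M by (simp add: c_def)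
  define G where "G = (\<lambda>z. L z + c * (T z + T (snd z, fst z)))"
  have G_int: "integrable (?\<mu>) G"
    unfolding G_def using L_int T_int T_swap_int by auto
  \<comment> \<open>For both points in K2, Young's inequality leaves the local energy density of u.
    With one point in K1 and the other outside K2 the distance is at least d and T applies. In the
    remaining case the test function vanishes at both points.\<close>
  have dom: "\<bar>signed_power p (incr u z) * (incr \<psi> z)\<bar> \<le> G z + \<bar>incr \<psi> z\<bar> powr p"
    if \<psi>: "\<And>x. \<bar>\<psi> x\<bar> \<le> M" "\<And>x. x \<notin> K1 \<Longrightarrow> \<psi> x = 0" for \<psi> :: "real ^ 'n \<Rightarrow> real" and z
  proof -
    have J: "\<bar>incr u z\<bar> powr (p - 1) * m \<le> c * (\<bar>u (fst z)\<bar> powr (p - 1) + \<bar>u (snd z)\<bar> powr (p - 1))"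
      if "0 \<le> m" "m \<le> M" for m
    proof -
      have "\<bar>incr u z\<bar> powr (p - 1) * m \<le> (2 powr (p - 1) * (\<bar>u (fst z)\<bar> powr (p - 1) + \<bar>u (snd z)\<bar> powr (p - 1))) * M"
        using p that by (intro mult_mono abs_diff_powr_le) auto
      then show ?thesis by (simp add: c_def mult_ac)
    qed
    have G_nonneg: "0 \<le> L z" "0 \<le> T z" "0 \<le> T (snd z, fst z)" using T_nonneg by (auto simp: L_def)
    consider "z \<in> K2 \<times> K2" | "fst z \<notin> K1" "snd z \<notin> K1" | "fst z \<in> K1" "snd z \<notin> K2" | "snd z \<in> K1" "fst z \<notin> K2"
      using K12(5) by (cases z) auto
    then show ?thesis
    proof cases
      case 1
      have "\<bar>signed_power p (incr u z) * (incr \<psi> z)\<bar>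
          \<le> \<bar>incr u z\<bar> powr p + \<bar>incr \<psi> z\<bar> powr p"
        unfolding abs_mult abs_signed_power using p by (intro powr_mult_le_sum) auto
      also have "\<bar>incr u z\<bar> powr p = L z" using 1 by (simp add: L_def)
      also have "L z \<le> G z" using G_nonneg c by (simp add: G_def)
      finally show ?thesis by simp
    next
      case 2
      have "0 \<le> G z" using G_nonneg c unfolding G_def by (intro add_nonneg_nonneg mult_nonneg_nonneg)
      then show ?thesis using 2 \<psi>(2) by simp
    next
      case 3
      then have "d \<le> norm (fst z - snd z)" using nb(2)[of "fst z" "snd z"] by linarith
      then have "T z = \<bar>u (fst z)\<bar> powr (p - 1) + \<bar>u (snd z)\<bar> powr (p - 1)" using 3 by (simp add: T_def)
      moreover have "\<psi> (snd z) = 0" using 3 K12(5) \<psi>(2) by blast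
      ultimately have "\<bar>signed_power p (incr u z) * (incr \<psi> z)\<bar> \<le> c * T z"
        using J[OF abs_ge_zero \<psi>(1)] by (simp add: abs_mult abs_signed_power)
      also have "\<dots> \<le> G z" using G_nonneg mult_left_mono[OF _ c] unfolding G_def
        by (simp add: add_increasing mult_nonneg_nonneg[OF c] distrib_left)
      finally show ?thesis by (simp add: add_increasing2)
    next
      case 4
      then have "d \<le> norm (snd z - fst z)" using nb(2)[of "snd z" "fst z"] by linarith
      then have "T (snd z, fst z) = \<bar>u (fst z)\<bar> powr (p - 1) + \<bar>u (snd z)\<bar> powr (p - 1)" using 4 by (simp add: T_def)
      moreover have "\<psi> (fst z) = 0" using 4 K12(5) \<psi>(2) by blast
      ultimately have "\<bar>signed_power p (incr u z) * (incr \<psi> z)\<bar> \<le> c * T (snd z, fst z)"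
        using J[OF abs_ge_zero \<psi>(1)] by (simp add: abs_mult abs_signed_power)
      also have "\<dots> \<le> G z" using G_nonneg mult_left_mono[OF _ c] unfolding G_def
        by (simp add: add_increasing mult_nonneg_nonneg[OF c] distrib_left)
      finally show ?thesis by (simp add: add_increasing2)
    qed
  qed
  have \<phi>_int: "integrable (?\<mu>) (\<lambda>z. \<bar>incr (\<phi> k) z\<bar> powr p)" for k
    by (rule energy_integrable) (use \<phi>_en[of k] en in \<open>auto intro: le_less_trans\<close>)
  have w_pint: "integrable (?\<mu>) (\<lambda>z. \<bar>incr w z\<bar> powr p)"
    by (rule energy_integrable) (use en in auto)
  have lim2: "AE z in ?\<mu>. (\<lambda>k. incr (\<phi> k) z) \<longlonglongrightarrow> incr w z"
    using AE_kernel_measure_pair[OF \<phi>_lim] by eventually_elim (intro tendsto_diff; simp)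
  let ?J = "\<lambda>\<psi> z. signed_power p (incr u z) * (incr \<psi> z)"
  note Pratt = dominated_convergence_varying[where M = "?\<mu>"
      and f = "\<lambda>k. ?J (\<phi> k)" and f' = "?J w"
      and g = "\<lambda>k z. G z + \<bar>incr (\<phi> k) z\<bar> powr p"
      and g' = "\<lambda>z. G z + \<bar>incr w z\<bar> powr p"]
  have lim_J: "AE z in ?\<mu>. (\<lambda>k. ?J (\<phi> k) z) \<longlonglongrightarrow> ?J w z"
    using lim2 by eventually_elim (intro tendsto_mult tendsto_const)
  have lim_g: "AE z in ?\<mu>. (\<lambda>k. G z + \<bar>incr (\<phi> k) z\<bar> powr p) \<longlonglongrightarrow> G z + \<bar>incr w z\<bar> powr p"
    using lim2
  proof eventually_elim
    case (elim z)
    then show ?case using p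
      by (intro tendsto_add tendsto_const tendsto_powr2 tendsto_rabs always_eventually) auto
  qed
  have int_g: "(\<lambda>k. \<integral>z. G z + \<bar>incr (\<phi> k) z\<bar> powr p \<partial>?\<mu>) \<longlonglongrightarrow> (\<integral>z. G z + \<bar>incr w z\<bar> powr p \<partial>?\<mu>)"
    unfolding Bochner_Integration.integral_add[OF G_int \<phi>_int] Bochner_Integration.integral_add[OF G_int w_pint]
    by (intro tendsto_add tendsto_const en_lim)
  have J_meas: "?J (\<phi> k) \<in> borel_measurable (?\<mu>)" "?J w \<in> borel_measurable (?\<mu>)" for k
    by measurable
  have g_int: "integrable (?\<mu>) (\<lambda>z. G z + \<bar>incr (\<phi> k) z\<bar> powr p)"
    "integrable (?\<mu>) (\<lambda>z. G z + \<bar>incr w z\<bar> powr p)" for k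
    by (intro Bochner_Integration.integrable_add G_int \<phi>_int w_pint)+
  have dom_AE: "AE z in ?\<mu>. \<bar>?J (\<phi> k) z\<bar> \<le> G z + \<bar>incr (\<phi> k) z\<bar> powr p" for k
    using dom[OF \<phi>_le \<phi>_supp] by (intro AE_I2)
  show "integrable (?\<mu>) (?J w)"
    by (rule Pratt(1)[OF J_meas g_int lim_J lim_g dom_AE int_g])
  have "(\<lambda>k. \<integral>z. ?J (\<phi> k) z \<partial>?\<mu>) \<longlonglongrightarrow> (\<integral>z. ?J w z \<partial>?\<mu>)"
    by (rule Pratt(3)[OF J_meas g_int lim_J lim_g dom_AE int_g])
  moreover have "(\<integral>z. ?J (\<phi> k) z \<partial>?\<mu>) = (LINT x:\<Omega>|lebesgue. h x * \<phi> k x)" for k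
    by (rule weak_eq[OF \<phi>_test])
  moreover have "(\<lambda>k. LINT x:\<Omega>|lebesgue. h x * \<phi> k x) \<longlonglongrightarrow> (LINT x:\<Omega>|lebesgue. h x * w x)"
    unfolding set_lebesgue_integral_def
  proof (rule integral_dominated_convergence[where w = "\<lambda>x. M * \<bar>indicator K1 x * h x\<bar>"])
    have K1\<Omega>: "K1 \<subseteq> \<Omega>" using K12 by blast
    show "(\<lambda>x. indicator \<Omega> x *\<^sub>R (h x * w x)) \<in> borel_measurable lebesgue"
      using rhs_set_integrable[OF _ K w] by (auto simp: set_integrable_def)
    show "(\<lambda>x. indicator \<Omega> x *\<^sub>R (h x * \<phi> k x)) \<in> borel_measurable lebesgue" for k
      using rhs_set_integrable[OF _ K12(1) K1\<Omega> \<phi>_le \<phi>_supp] by (auto simp: set_integrable_def)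
    show "integrable lebesgue (\<lambda>x. M * \<bar>indicator K1 x * h x\<bar>)"
      using rhs_integrable[OF K12(1) K1\<Omega>] by (auto simp: set_integrable_def)
    show "AE x in lebesgue. (\<lambda>k. indicator \<Omega> x *\<^sub>R (h x * \<phi> k x)) \<longlonglongrightarrow> indicator \<Omega> x *\<^sub>R (h x * w x)"
      using AE_completion[OF \<phi>_lim] by eventually_elim (intro tendsto_intros)
    have "\<bar>h x\<bar> * \<bar>\<phi> k x\<bar> \<le> M * \<bar>h x\<bar>" for k x
      using mult_left_mono[OF \<phi>_le abs_ge_zero] by (simp add: mult.commute)
    then show "AE x in lebesgue. norm (indicator \<Omega> x *\<^sub>R (h x * \<phi> k x)) \<le> M * \<bar>indicator K1 x * h x\<bar>" for k
      using \<phi>_supp M by (intro AE_I2) (auto simp: indicator_def abs_mult)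
  qed
  ultimately show "(\<integral>z. ?J w z \<partial>?\<mu>) = (LINT x:\<Omega>|lebesgue. h x * w x)"
    by (simp add: LIMSEQ_unique)
qed

end

section \<open>Comparison\<close>

lemma signed_power_minus: "signed_power p (- t) = - signed_power p t"
  by (simp add: signed_power_def)

lemma signed_power_diff_nonneg:
  assumes "1 < p" shows "0 \<le> (signed_power p a - signed_power p b) * (a - b)"
proof (cases "a \<le> b")
  case True
  then show ?thesis using signed_power_mono[OF assms True] by (intro mult_nonpos_nonpos) auto
next
  case False
  then show ?thesis using signed_power_mono[OF assms, of b a] by (intro mult_nonneg_nonneg) auto
qed

text \<open>Here \<open>s\<close> stands for a truncation of \<open>(u - \<epsilon>)\<^sup>+\<close>, and the two points are \<open>x\<close> and \<open>y\<close>. The negative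
  part of the integrand is controlled by the truncation error alone, independently of \<open>v\<close>.\<close>
lemma truncated_monotonicity_ordered:
  fixes ux uy vx vy sx sy \<epsilon> :: real
  assumes p: "1 < p" and nonneg: "0 \<le> vx" "0 \<le> vy"
    and z: "zx = max (ux - \<epsilon>) 0" "zy = max (uy - \<epsilon>) 0"
    and s: "0 \<le> sx" "sx \<le> zx" "0 \<le> sy" "sy \<le> zy"
    and w: "wx = max (sx - vx) 0" "wy = max (sy - vy) 0" and le: "wy \<le> wx"
  shows "- ((signed_power p (zx - zy) - signed_power p (sx - sy)) * ((zx - zy) - (sx - sy)))
    \<le> (signed_power p (ux - uy) - signed_power p (vx - vy)) * (wx - wy)"
proof -
  let ?err = "(signed_power p (zx - zy) - signed_power p (sx - sy)) * ((zx - zy) - (sx - sy))"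
  have err: "0 \<le> ?err" by (rule signed_power_diff_nonneg[OF p])
  show ?thesis
  proof (cases "wx = wy")
    case True
    then show ?thesis using err by simp
  next
    case False
    then have less: "wy < wx" using le by simp
    then have wx: "wx = sx - vx" "sx > vx" using w by (auto simp: max_def split: if_splits)
    have zx: "zx = ux - \<epsilon>" "ux > \<epsilon>" using wx nonneg s z by (auto simp: max_def split: if_splits)
    have wd: "0 < wx - wy" "wx - wy \<le> (sx - sy) - (vx - vy)" using less wx w by auto
    show ?thesis
    proof (cases "vx - vy \<le> ux - uy")
      case True
      then have "0 \<le> (signed_power p (ux - uy) - signed_power p (vx - vy)) * (wx - wy)"
        using signed_power_mono[OF p True] wd by (intro mult_nonneg_nonneg) auto
      then show ?thesis using err by linarith
    next
      case F: False
      \<comment> \<open>Otherwise zy = sy = 0, and wx > wy forces vx - vy < sx \<le> ux - \<epsilon>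
        < ux - uy, contrary to the case assumption.\<close>
      have "uy \<ge> \<epsilon>"
      proof (rule ccontr)
        assume "\<not> uy \<ge> \<epsilon>"
        then show False using F z zx s wd by (auto simp: max_def split: if_splits)
      qed
      then have eq: "zx - zy = ux - uy" using z zx by auto
      \<comment> \<open>Here the increment of v lies strictly between those of u and s. So J of it
        may be raised to J of the increment of s, and wx - wy enlarged to the difference of the
        increments of s and u; v disappears from the bound.\<close>
      have "(signed_power p (vx - vy) - signed_power p (ux - uy)) * (wx - wy)
          \<le> (signed_power p (sx - sy) - signed_power p (ux - uy)) * ((sx - sy) - (ux - uy))"
      proof (rule mult_mono)
        show "signed_power p (vx - vy) - signed_power p (ux - uy) \<le> signed_power p (sx - sy) - signed_power p (ux - uy)"
          using wd by (intro diff_right_mono signed_power_mono[OF p]) auto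
        then show "0 \<le> signed_power p (sx - sy) - signed_power p (ux - uy)"
          using signed_power_mono[OF p, of "ux - uy" "vx - vy"] F by linarith
      qed (use wd F in auto)
      then show ?thesis unfolding eq by (simp add: algebra_simps)
    qed
  qed
qed

text \<open>Exchanging the two points changes the sign of both factors in each product, so the
  ordering of wx and wy may be assumed.\<close>

lemma truncated_monotonicity:
  fixes ux uy vx vy sx sy \<epsilon> :: real
  assumes p: "1 < p" and nonneg: "0 \<le> vx" "0 \<le> vy"
    and z: "zx = max (ux - \<epsilon>) 0" "zy = max (uy - \<epsilon>) 0"
    and s: "0 \<le> sx" "sx \<le> zx" "0 \<le> sy" "sy \<le> zy"
    and w: "wx = max (sx - vx) 0" "wy = max (sy - vy) 0"
  shows "- ((signed_power p (zx - zy) - signed_power p (sx - sy)) * ((zx - zy) - (sx - sy)))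
    \<le> (signed_power p (ux - uy) - signed_power p (vx - vy)) * (wx - wy)"
proof (cases "wy \<le> wx")
  case True
  then show ?thesis using truncated_monotonicity_ordered[OF p nonneg z s w] by simp
next
  case False
  have J: "signed_power p (a - b) = - signed_power p (b - a)" for a b
    using signed_power_minus[of p "b - a"] by simp
  have "- ((signed_power p (zy - zx) - signed_power p (sy - sx)) * ((zy - zx) - (sy - sx)))
    \<le> (signed_power p (uy - ux) - signed_power p (vy - vx)) * (wy - wx)"
    by (rule truncated_monotonicity_ordered[OF p nonneg(2,1) z(2,1) s(3,4,1,2) w(2,1)]) (use False in simp)
  then show ?thesis by (simp add: J[of zy] J[of sy] J[of uy] J[of vy] algebra_simps)
qed

text \<open>All quantities involved are at most m = 3 |a| + b, so the product is at most 2 m^p. In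
  the application a is the increment of z, and b the approximation error, whose p-th power has
  vanishing integral.\<close>

lemma truncation_error_le:
  assumes p: "1 < p" and r: "\<bar>r\<bar> \<le> 2 * \<bar>a\<bar> + b" and b: "0 \<le> b"
  shows "(signed_power p a - signed_power p r) * (a - r) \<le> 2 * 2 powr p * (3 powr p * \<bar>a\<bar> powr p + b powr p)"
proof -
  define m where "m = 3 * \<bar>a\<bar> + b"
  have m: "0 \<le> m" "\<bar>a\<bar> \<le> m" "\<bar>r\<bar> \<le> m" "\<bar>a - r\<bar> \<le> m" using r b by (auto simp: m_def)
  have "(signed_power p a - signed_power p r) * (a - r) \<le> \<bar>signed_power p a - signed_power p r\<bar> * \<bar>a - r\<bar>"
    by (simp add: abs_mult[symmetric])
  also have "\<dots> \<le> (\<bar>a\<bar> powr (p - 1) + \<bar>r\<bar> powr (p - 1)) * m"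
    using m abs_triangle_ineq4[of "signed_power p a" "signed_power p r"]
    by (intro mult_mono) (auto simp: abs_signed_power)
  also have "\<dots> \<le> (m powr (p - 1) + m powr (p - 1)) * m"
    using m p by (intro mult_right_mono add_mono powr_mono2) auto
  also have "\<dots> = 2 * (m powr (p - 1) * m)" by simp
  also have "m powr (p - 1) * m = m powr p" using powr_add[of m "p - 1" 1] m p by (cases "m = 0") auto
  also have "m powr p \<le> 2 powr p * ((3 * \<bar>a\<bar>) powr p + b powr p)"
    unfolding m_def using p b by (intro add_powr_le) auto
  also have "(3 * \<bar>a\<bar>) powr p = 3 powr p * \<bar>a\<bar> powr p" by (simp add: powr_mult)
  finally show ?thesis by simp
qed

section \<open>Passage to the limit in the comparison\<close>

lemma emeasure_complement_bounded:
  assumes "bounded (\<Omega> :: 'a::euclidean_space set)" "open \<Omega>"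
  shows "emeasure lborel (- \<Omega>) \<noteq> 0"
proof
  assume "emeasure lborel (- \<Omega>) = 0"
  then have "emeasure lborel (UNIV :: 'a set) = emeasure lborel \<Omega>"
    using plus_emeasure[of \<Omega> lborel "- \<Omega>"] assms by (simp add: Compl_partition)
  then show False using emeasure_bounded_finite[OF assms(1)] by simp
qed

lemma approximates_finite_energy:
  assumes "approximable q p \<Omega> z" and p: "0 \<le> p" and z: "finite_W q p z"
  obtains \<phi> where "approximates q p \<Omega> \<phi> z" "\<And>n. energy q p (\<lambda>x. \<phi> n x - z x) < \<infinity>" "\<And>n. energy q p (\<phi> n) < \<infinity>"
proof -
  obtain \<phi> where \<phi>: "approximates q p \<Omega> \<phi> z" using assms by blast
  then have "(\<lambda>n. energy q p (\<lambda>x. \<phi> n x - z x)) \<longlonglongrightarrow> 0" by (simp add: approximates_def)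
  then have "\<forall>\<^sub>F n in sequentially. energy q p (\<lambda>x. \<phi> n x - z x) < 1"
    by (rule order_tendstoD) simp
  then obtain N where N: "\<And>n. n \<ge> N \<Longrightarrow> energy q p (\<lambda>x. \<phi> n x - z x) < 1"
    by (auto simp: eventually_sequentially)
  have [measurable]: "z \<in> borel_measurable borel" "\<phi> n \<in> borel_measurable borel" for n
    using z \<phi> by (auto simp: finite_W_def approximates_def)
  have shift: "approximates q p \<Omega> (\<lambda>n. \<phi> (n + N)) z"
    using \<phi> unfolding approximates_def
    by (auto intro: LIMSEQ_ignore_initial_segment[of "\<lambda>n. energy q p (\<lambda>x. \<phi> n x - z x)"]
        elim!: eventually_mono LIMSEQ_ignore_initial_segment)
  have fin: "energy q p (\<lambda>x. \<phi> (n + N) x - z x) < \<infinity>" for n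
    using N[of "n + N"] by (auto intro: less_trans)
  have "energy q p (\<lambda>x. (\<phi> (n + N) x - z x) + z x) < \<infinity>" for n
    by (rule le_less_trans[OF energy_add_le])
      (use fin[of n] z p in \<open>auto simp: finite_W_def ennreal_mult_less_top\<close>)
  then show ?thesis using that[OF shift fin] by simp
qed

text \<open>The hypothesis \<open>h\<close> keeps the comparison independent of the form of the
  nonlinearity. The solutions enter asymmetrically: the truncation of u has finite global energy,
  whereas v contributes its local energy and its sign.\<close>

theorem truncated_comparison:
  fixes u v :: "real ^ 'n \<Rightarrow> real"
  assumes \<Omega>: "bounded \<Omega>" "smooth_boundary \<Omega>"
    and q: "q < p + real CARD('n)"
    and u: "local_weak_solution q p \<Omega> u hu" and v: "local_weak_solution q p \<Omega> v hv"
    and nonneg: "\<And>x. 0 \<le> u x" "\<And>x. 0 \<le> v x" and out: "\<And>x. x \<notin> \<Omega> \<Longrightarrow> u x = 0" "\<And>x. x \<notin> \<Omega> \<Longrightarrow> v x = 0"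
    and h: "AE x in lebesgue. x \<in> \<Omega> \<longrightarrow> v x \<le> u x \<longrightarrow> hu x \<le> hv x"
    and \<epsilon>: "0 < \<epsilon>" and trunc: "finite_W q p (\<lambda>x. max (u x - \<epsilon>) 0)"
  shows "AE x in lborel. u x - \<epsilon> \<le> v x"
proof -
  interpret u: local_weak_solution q p \<Omega> u hu by (rule u)
  interpret v: local_weak_solution q p \<Omega> v hv by (rule v)
  note p = u.p and qN = u.q
  define z where "z = (\<lambda>x. max (u x - \<epsilon>) 0)"
  have z_fin: "finite_W q p z" using trunc by (simp add: z_def)
  have z_nonneg: "0 \<le> z x" for x by (simp add: z_def)
  have [measurable]: "z \<in> borel_measurable borel" using z_fin by (simp add: finite_W_def)
  have "x \<in> \<Omega>" if "z x \<noteq> 0" for x using that out(1)[of x] \<epsilon> by (cases "x \<in> \<Omega>") (auto simp: z_def)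
  from approximable_finite_W[OF u.open_domain \<Omega> q qN less_imp_le[OF p] z_fin this]
  obtain \<phi> where \<phi>: "approximates q p \<Omega> \<phi> z" and \<phi>_err: "\<And>n. energy q p (\<lambda>x. \<phi> n x - z x) < \<infinity>"
    and \<phi>_fin: "\<And>n. energy q p (\<phi> n) < \<infinity>"
    using approximates_finite_energy[OF _ _ z_fin] p by (metis less_imp_le order.strict_trans zero_less_one)
  have [measurable]: "\<phi> n \<in> borel_measurable borel" for n using \<phi> by (simp add: approximates_def)
  have \<phi>_lim: "AE x in lborel. (\<lambda>n. \<phi> n x) \<longlonglongrightarrow> z x"
    and err_lim: "(\<lambda>n. energy q p (\<lambda>x. \<phi> n x - z x)) \<longlonglongrightarrow> 0" using \<phi> by (auto simp: approximates_def)
  \<comment> \<open>The bounds 0 and z give the range required by the pointwise inequality, while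
    |s_n| \<le> |\<phi>_n| retains boundedness and compact support.\<close>
  define s where "s = (\<lambda>n x. max 0 (min (z x) (\<phi> n x)))"
  define w where "w = (\<lambda>n x. max (s n x - v x) 0)"
  have [measurable]: "s n \<in> borel_measurable borel" "w n \<in> borel_measurable borel" for n
    unfolding s_def w_def by measurable
  have s_bounds: "0 \<le> s n x" "s n x \<le> z x" "\<bar>s n x\<bar> \<le> \<bar>\<phi> n x\<bar>" for n x
    using z_nonneg[of x] by (auto simp: s_def)
  have w_bounds: "0 \<le> w n x" "w n x \<le> s n x" for n x
    using s_bounds(1)[of n x] nonneg(2)[of x] by (auto simp: w_def)
  have s_diff: "\<bar>s n x - s n y\<bar> \<le> \<bar>z x - z y\<bar> + \<bar>\<phi> n x - \<phi> n y\<bar>" for n x y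
    by (auto simp: s_def max_def min_def)
  define D where "D = (\<lambda>(f :: real ^ 'n \<Rightarrow> real) a. incr f a)"
  have [measurable]: "D f \<in> borel_measurable borel" if "f \<in> borel_measurable borel" for f
    using that unfolding D_def by measurable
  let ?\<mu> = "kernel_measure q :: ((real ^ 'n) \<times> (real ^ 'n)) measure"
  define F where "F = (\<lambda>n a. (signed_power p (D u a) - signed_power p (D v a)) * D (w n) a)"
  define R where "R = (\<lambda>n a. (signed_power p (D z a) - signed_power p (D (s n) a)) * (D z a - D (s n) a))"
  have [measurable]: "F n \<in> borel_measurable borel" "R n \<in> borel_measurable borel" for n
    unfolding F_def R_def by measurable
  \<comment> \<open>F_n alone has no fixed sign; adding the truncation error R_n makes it
    nonnegative, as Fatou's lemma requires.\<close>
  have FR: "0 \<le> F n a + R n a" for n a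
  proof -
    have "- R n a \<le> F n a"
      unfolding F_def R_def D_def
      by (rule truncated_monotonicity[OF p, where \<epsilon> = \<epsilon> and sx = "s n (fst a)" and sy = "s n (snd a)"])
        (use nonneg(2) s_bounds(1,2) in \<open>auto simp: z_def w_def\<close>)
    then show ?thesis by simp
  qed
  have F: "integrable ?\<mu> (F n)" "(\<integral>a. F n a \<partial>?\<mu>) \<le> 0" for n
  proof -
    obtain K where K: "compact K" "K \<subseteq> \<Omega>" "\<And>x. x \<notin> K \<Longrightarrow> \<phi> n x = 0"
      using \<phi> unfolding approximates_def by blast
    obtain M where M: "\<And>x. \<bar>\<phi> n x\<bar> \<le> M" using \<phi> unfolding approximates_def by blast
    have w_le: "\<bar>w n x\<bar> \<le> M" for x using w_bounds[of n x] s_bounds[of n x] M[of x] by linarith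
    have w_out: "w n x = 0" if "x \<notin> K" for x using w_bounds[of n x] s_bounds[of n x] K(3)[OF that] by simp
    obtain d K1 K2 where d: "d > 0" and K12: "compact K1" "compact K2" "K2 \<subseteq> \<Omega>" "K1 \<subseteq> K2"
      and nb: "\<And>x y. x \<in> K \<Longrightarrow> norm (x - y) \<le> d \<Longrightarrow> y \<in> K1"
      using compact_neighbourhoods[OF K(1) u.open_domain K(2)] by metis
    have [measurable]: "K1 \<in> sets borel" using K12 by (auto intro: borel_compact)
    have [measurable]: "K1 \<times> K1 \<in> sets borel" by (intro borel_Times) auto
    \<comment> \<open>The energy of v is known to be finite only on compact subsets of \<Omega>; the
      support of w_n in K turns that local bound into a global one.\<close>
    have en: "energy q p (w n) < \<infinity>"
    proof (rule energy_finite_of_local[OF _ _ _ K(1) _ d nb w_le w_out])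
      have "local_energy q p K1 (s n) \<le> ennreal (2 powr p) * (local_energy q p K1 z + local_energy q p K1 (\<phi> n))"
        by (rule local_energy_le_add[OF _ _ _ _ s_diff]) (use p in auto)
      also have "\<dots> < \<infinity>"
        using le_less_trans[OF local_energy_le_energy[where K = K1 and u = z and p = p and q = q], of top] le_less_trans[OF local_energy_le_energy[where K = K1 and u = "\<phi> n" and p = p and q = q], of top]
          z_fin \<phi>_fin[of n] by (simp add: finite_W_def ennreal_mult_less_top)
      finally have s_fin: "local_energy q p K1 (s n) < \<infinity>" .
      have v_fin: "local_energy q p K1 v < \<infinity>" using v.local_energy[OF K12(1)] K12 by blast
      have "local_energy q p K1 (w n) \<le> ennreal (2 powr p) * (local_energy q p K1 (s n) + local_energy q p K1 v)"
        by (rule local_energy_le_add) (use p in \<open>auto simp: w_def max_def\<close>)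
      also have "\<dots> < \<infinity>" using s_fin v_fin by (simp add: ennreal_mult_less_top)
      finally show "local_energy q p K1 (w n) < \<infinity>" .
    qed (use qN p in auto)
    note U = u.weak_eq_extended[OF _ K(1,2) w_le w_out en] and V = v.weak_eq_extended[OF _ K(1,2) w_le w_out en]
    have F_eq: "F n = (\<lambda>a. signed_power p (incr u a) * (incr (w n) a)
        - signed_power p (incr v a) * (incr (w n) a))"
      by (simp add: F_def D_def left_diff_distrib)
    show "integrable ?\<mu> (F n)" unfolding F_eq by (intro Bochner_Integration.integrable_diff U V) measurable
    have "(\<integral>a. F n a \<partial>?\<mu>) = (LINT x:\<Omega>|lebesgue. hu x * w n x) - (LINT x:\<Omega>|lebesgue. hv x * w n x)"
      unfolding F_eq by (subst Bochner_Integration.integral_diff) (auto simp: U V)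
    \<comment> \<open>Where w_n > 0 one has 0 \<le> v < s_n \<le> z, so z > 0 and v < u: this is the
      set on which hu \<le> hv is assumed.\<close>
    also have "(LINT x:\<Omega>|lebesgue. hu x * w n x) \<le> (LINT x:\<Omega>|lebesgue. hv x * w n x)"
      unfolding set_lebesgue_integral_def
    proof (rule integral_mono_AE)
      show "integrable lebesgue (\<lambda>x. indicator \<Omega> x *\<^sub>R (hu x * w n x))"
        using u.rhs_set_integrable[OF _ K(1,2) w_le w_out] by (simp add: set_integrable_def)
      show "integrable lebesgue (\<lambda>x. indicator \<Omega> x *\<^sub>R (hv x * w n x))"
        using v.rhs_set_integrable[OF _ K(1,2) w_le w_out] by (simp add: set_integrable_def)
      show "AE x in lebesgue. indicator \<Omega> x *\<^sub>R (hu x * w n x) \<le> indicator \<Omega> x *\<^sub>R (hv x * w n x)"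
        using h
      proof eventually_elim
        case (elim x)
        have "v x \<le> u x" if "w n x \<noteq> 0"
        proof -
          have "v x < s n x" using that by (auto simp: w_def)
          then have "v x < z x" using s_bounds(2)[of n x] by simp
          then show ?thesis using nonneg(2)[of x] \<epsilon> by (auto simp: z_def max_def split: if_splits)
        qed
        then show ?case using elim w_bounds(1)[of n x]
          by (cases "w n x = 0") (auto simp: indicator_def intro!: mult_right_mono)
      qed
    qed
    finally show "(\<integral>a. F n a \<partial>?\<mu>) \<le> 0" by simp
  qed
  have s_lim: "AE x in lborel. (\<lambda>n. s n x) \<longlonglongrightarrow> z x"
    using \<phi>_lim
  proof eventually_elim
    case (elim x)
    have "(\<lambda>n. max 0 (min (z x) (\<phi> n x))) \<longlonglongrightarrow> max 0 (min (z x) (z x))"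
      by (intro tendsto_max tendsto_min tendsto_const elim)
    then show ?case using z_nonneg[of x] by (simp add: s_def)
  qed
  have Ds_lim: "AE a in ?\<mu>. (\<lambda>n. D (s n) a) \<longlonglongrightarrow> D z a"
    using AE_kernel_measure_pair[OF s_lim] unfolding D_def by eventually_elim (intro tendsto_diff; simp)
  have R_lim: "AE a in ?\<mu>. (\<lambda>n. R n a) \<longlonglongrightarrow> 0"
    using Ds_lim
  proof eventually_elim
    case (elim a)
    have "(\<lambda>n. R n a) \<longlonglongrightarrow> (signed_power p (D z a) - signed_power p (D z a)) * (D z a - D z a)"
      unfolding R_def by (intro tendsto_mult tendsto_diff tendsto_const tendsto_signed_power[OF p] elim)
    then show ?case by simp
  qed
  define b where "b = (\<lambda>n a. \<bar>D (\<phi> n) a - D z a\<bar>)"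
  have [measurable]: "b n \<in> borel_measurable borel" for n unfolding b_def by measurable
  have b_int: "integrable ?\<mu> (\<lambda>a. b n a powr p)"
    and b_energy: "energy q p (\<lambda>x. \<phi> n x - z x) = ennreal (\<integral>a. b n a powr p \<partial>?\<mu>)" for n
    using energy_integrable[OF _ \<phi>_err[of n]] by (simp_all add: b_def D_def algebra_simps)
  have b_lim: "(\<lambda>n. \<integral>a. b n a powr p \<partial>?\<mu>) \<longlonglongrightarrow> 0"
    using err_lim unfolding b_energy by (simp add: tendsto_ennreal_iff[where x = 0, simplified])
  have z_int: "integrable ?\<mu> (\<lambda>a. \<bar>D z a\<bar> powr p)"
    unfolding D_def by (rule energy_integrable) (use z_fin in \<open>auto simp: finite_W_def\<close>)
  define c where "c = 2 * 2 powr p"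
  \<comment> \<open>From |D s_n| \<le> 2 |D z| + b_n the error R_n is at most G_n. This majorant
    depends on n through b_n, but its integrals converge to that of G', so varying domination gives
    convergence of the integrals of R_n to 0.\<close>
  define G where "G = (\<lambda>n a. c * (3 powr p * \<bar>D z a\<bar> powr p + b n a powr p))"
  define G' where "G' = (\<lambda>a. c * (3 powr p * \<bar>D z a\<bar> powr p + 0))"
  have G_int: "integrable ?\<mu> (G n)" "integrable ?\<mu> G'" for n
    unfolding G_def G'_def using z_int b_int by auto
  have R_le: "AE a in ?\<mu>. \<bar>R n a\<bar> \<le> G n a" for n
  proof (rule AE_I2)
    fix a
    have "\<bar>D (\<phi> n) a\<bar> \<le> \<bar>D z a\<bar> + b n a" by (simp add: b_def)
    moreover have "\<bar>D (s n) a\<bar> \<le> \<bar>D z a\<bar> + \<bar>D (\<phi> n) a\<bar>" using s_diff by (simp add: D_def)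
    ultimately have "\<bar>D (s n) a\<bar> \<le> 2 * \<bar>D z a\<bar> + b n a" by simp
    then have "R n a \<le> G n a"
      unfolding R_def G_def c_def by (intro truncation_error_le[OF p]) (auto simp: b_def)
    moreover have "0 \<le> R n a" unfolding R_def by (rule signed_power_diff_nonneg[OF p])
    ultimately show "\<bar>R n a\<bar> \<le> G n a" by simp
  qed
  have G_lim: "AE a in ?\<mu>. (\<lambda>n. G n a) \<longlonglongrightarrow> G' a"
    using AE_kernel_measure_pair[OF \<phi>_lim]
  proof eventually_elim
    case (elim a)
    have "(\<lambda>n. b n a) \<longlonglongrightarrow> \<bar>D z a - D z a\<bar>"
      unfolding b_def D_def using elim by (intro tendsto_intros) auto
    then have "(\<lambda>n. b n a powr p) \<longlonglongrightarrow> 0 powr p"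
      using p by (intro tendsto_powr2 tendsto_const always_eventually) (auto simp: b_def)
    then show ?case unfolding G_def G'_def using p
      by (intro tendsto_mult tendsto_add tendsto_const) simp
  qed
  have "(\<lambda>n. \<integral>a. G n a \<partial>?\<mu>) \<longlonglongrightarrow> c * (3 powr p * (\<integral>a. \<bar>D z a\<bar> powr p \<partial>?\<mu>) + 0)"
  proof -
    have "(\<integral>a. G n a \<partial>?\<mu>) = c * (3 powr p * (\<integral>a. \<bar>D z a\<bar> powr p \<partial>?\<mu>) + (\<integral>a. b n a powr p \<partial>?\<mu>))" for n
      unfolding G_def using z_int b_int by simp
    then show ?thesis by (simp only:) (intro tendsto_mult tendsto_add tendsto_const b_lim)
  qed
  then have G_int_lim: "(\<lambda>n. \<integral>a. G n a \<partial>?\<mu>) \<longlonglongrightarrow> (\<integral>a. G' a \<partial>?\<mu>)"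
    by (simp add: G'_def)
  have meas: "R n \<in> borel_measurable ?\<mu>" "(\<lambda>_. 0) \<in> borel_measurable ?\<mu>" for n by measurable
  note R_int = dominated_convergence_varying(2)[OF meas G_int R_lim G_lim R_le G_int_lim]
  have R_int_lim: "(\<lambda>n. \<integral>a. R n a \<partial>?\<mu>) \<longlonglongrightarrow> 0"
    using dominated_convergence_varying(3)[OF meas G_int R_lim G_lim R_le G_int_lim] by simp
  \<comment> \<open>The integral of F_n is at most 0 and that of R_n tends to 0, so the nonnegative
    lower limit has integral 0 and vanishes almost everywhere.\<close>
  have "(\<integral>\<^sup>+a. liminf (\<lambda>n. ennreal (F n a + R n a)) \<partial>?\<mu>) \<le> liminf (\<lambda>n. \<integral>\<^sup>+a. ennreal (F n a + R n a) \<partial>?\<mu>)"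
    by (rule nn_integral_liminf) measurable
  also have "\<dots> \<le> liminf (\<lambda>n. ennreal (\<integral>a. R n a \<partial>?\<mu>))"
  proof (intro Liminf_mono always_eventually allI)
    fix n
    have "(\<integral>\<^sup>+a. ennreal (F n a + R n a) \<partial>?\<mu>) = ennreal (\<integral>a. F n a + R n a \<partial>?\<mu>)"
      using F(1) R_int FR by (intro nn_integral_eq_integral) auto
    also have "\<dots> \<le> ennreal (\<integral>a. R n a \<partial>?\<mu>)"
      using F[of n] R_int[of n] by (intro ennreal_leI) simp
    finally show "(\<integral>\<^sup>+a. ennreal (F n a + R n a) \<partial>?\<mu>) \<le> ennreal (\<integral>a. R n a \<partial>?\<mu>)" .
  qed
  also have "\<dots> = 0"
    using tendsto_ennrealI[OF R_int_lim] by (intro lim_imp_Liminf) auto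
  finally have "AE a in ?\<mu>. liminf (\<lambda>n. ennreal (F n a + R n a)) = 0"
    by (subst (asm) le_zero_eq, subst (asm) nn_integral_0_iff_AE) auto
  then have "AE a in ?\<mu>. \<not> (fst a \<in> \<Omega> \<and> snd a \<notin> \<Omega> \<and> v (fst a) < z (fst a))"
    using R_lim AE_kernel_measure_pair[OF s_lim]
  proof eventually_elim
    case (elim a)
    show ?case
    proof
      assume *: "fst a \<in> \<Omega> \<and> snd a \<notin> \<Omega> \<and> v (fst a) < z (fst a)"
      let ?l = "(signed_power p (D u a) - signed_power p (D v a)) * (z (fst a) - v (fst a))"
      have zy: "u (snd a) = 0" "v (snd a) = 0" "z (snd a) = 0" using * out \<epsilon> by (auto simp: z_def)
      \<comment> \<open>Since u, v and z vanish at the second point, the increments are the values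
        at the first one, and the limit of F_n + R_n is (J u - J v)(z - v) there, positive if v <
        z.\<close>
      have "(\<lambda>n. D (w n) a) \<longlonglongrightarrow> max (z (fst a) - v (fst a)) 0 - max (z (snd a) - v (snd a)) 0"
        unfolding D_def w_def using elim(3) by (intro tendsto_intros tendsto_max) auto
      then have "(\<lambda>n. D (w n) a) \<longlonglongrightarrow> z (fst a) - v (fst a)" using * zy by simp
      then have "(\<lambda>n. F n a + R n a) \<longlonglongrightarrow> ?l + 0"
        unfolding F_def by (intro tendsto_add tendsto_mult tendsto_const elim(2))
      then have "liminf (\<lambda>n. ennreal (F n a + R n a)) = ennreal ?l"
        by (intro lim_imp_Liminf tendsto_ennrealI) auto
      then have "?l \<le> 0" using elim(1) by (simp add: ennreal_eq_0_iff)
      moreover have "v (fst a) < u (fst a)" using * nonneg(2)[of "fst a"] \<epsilon> by (auto simp: z_def max_def split: if_splits)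
      then have "signed_power p (D v a) < signed_power p (D u a)"
        unfolding D_def zy by (intro signed_power_strict_mono[OF p]) simp
      then have "0 < ?l" using * by (intro mult_pos_pos) auto
      ultimately show False by simp
    qed
  qed
  then have "AE a in (lborel :: ((real ^ 'n) \<times> (real ^ 'n)) measure). 0 < ennreal (kern q (fst a) (snd a)) \<longrightarrow>
      \<not> (fst a \<in> \<Omega> \<and> snd a \<notin> \<Omega> \<and> v (fst a) < z (fst a))"
    unfolding kernel_measure_def by (subst (asm) AE_density) auto
  \<comment> \<open>The density of the kernel measure vanishes on the diagonal only, and this
    product of disjoint sets avoids the diagonal.\<close>
  then have AE: "AE a in (lborel :: ((real ^ 'n) \<times> (real ^ 'n)) measure). a \<notin> {x \<in> \<Omega>. v x < z x} \<times> - \<Omega>"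
  proof eventually_elim
    case (elim a)
    show ?case
    proof
      assume *: "a \<in> {x \<in> \<Omega>. v x < z x} \<times> - \<Omega>"
      then have "fst a \<noteq> snd a" by auto
      then show False using elim * by auto
    qed
  qed
  have [measurable]: "\<Omega> \<in> sets borel" using u.open_domain by simp
  have A: "{x \<in> \<Omega>. v x < z x} \<in> sets borel" by measurable
  have "{x \<in> \<Omega>. v x < z x} \<times> - \<Omega> \<in> sets borel" by (intro borel_Times A) auto
  then have "emeasure lborel ({x \<in> \<Omega>. v x < z x} \<times> - \<Omega>) = 0"
    using AE by (subst (asm) AE_iff_measurable[OF _ refl]) auto
  then have "emeasure lborel {x \<in> \<Omega>. v x < z x} * emeasure lborel (- \<Omega>) = 0"
    unfolding lborel_prod[symmetric] using A by (subst (asm) lborel.emeasure_pair_measure_Times) auto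
  then have "emeasure lborel {x \<in> \<Omega>. v x < z x} = 0"
    using emeasure_complement_bounded[OF \<Omega>(1) u.open_domain] by simp
  then have "AE x in lborel. x \<notin> {x \<in> \<Omega>. v x < z x}"
    using A by (intro AE_not_in) (auto simp: null_sets_def)
  then show ?thesis
  proof eventually_elim
    case (elim x)
    then show ?case using out[of x] \<epsilon> by (cases "x \<in> \<Omega>") (auto simp: z_def)
  qed
qed

section \<open>Borel representatives and uniqueness\<close>

lemma sigma_finite_lebesgue: "sigma_finite_measure (lebesgue :: 'a::euclidean_space measure)"
proof
  show "\<exists>A. countable A \<and> A \<subseteq> sets (lebesgue :: 'a measure) \<and> \<Union>A = space lebesgue \<and> (\<forall>a\<in>A. emeasure lebesgue a \<noteq> \<infinity>)"
  proof (intro exI[of _ "range (\<lambda>n::nat. cball (0::'a) n)"] conjI)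
    show "\<Union> (range (\<lambda>n::nat. cball (0::'a) n)) = space lebesgue"
      using real_arch_simple by (auto simp: dist_norm)
    show "\<forall>a\<in>range (\<lambda>n::nat. cball (0::'a) n). emeasure lebesgue a \<noteq> \<infinity>"
      using emeasure_lborel_cball_finite[of "0 :: 'a"] by (auto simp: less_top)
  qed auto
qed

interpretation lebesgue: sigma_finite_measure "lebesgue :: 'a::euclidean_space measure"
  by (rule sigma_finite_lebesgue)

text \<open>The product of two Lebesgue measures is a product of completions and is not
  \<open>lborel\<close> on pairs. It extends the latter, so integrals of Borel functions can be
  moved between the two.\<close>

lemma id_measurable_lebesgue_pair:
  "(\<lambda>z. z) \<in> (lebesgue \<Otimes>\<^sub>M lebesgue) \<rightarrow>\<^sub>M (borel :: ('a::euclidean_space \<times> 'a) measure)"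
proof -
  have "(\<lambda>z. (fst z, snd z)) \<in> (lebesgue \<Otimes>\<^sub>M lebesgue) \<rightarrow>\<^sub>M (borel \<Otimes>\<^sub>M (borel :: 'a measure))"
    by (intro measurable_Pair measurable_compose[OF measurable_fst] measurable_compose[OF measurable_snd])
      (auto simp: measurable_completion)
  then show ?thesis by (simp add: borel_prod)
qed

lemma sets_borel_lebesgue_pair: "A \<in> sets (borel :: ('a::euclidean_space \<times> 'a) measure) \<Longrightarrow> A \<in> sets (lebesgue \<Otimes>\<^sub>M lebesgue)"
  using measurable_sets[OF id_measurable_lebesgue_pair] by (simp add: space_pair_measure)

lemma emeasure_lebesgue_pair:
  assumes "A \<in> sets (borel :: ('a::euclidean_space \<times> 'a) measure)"
  shows "emeasure (lebesgue \<Otimes>\<^sub>M lebesgue) A = emeasure lborel A"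
proof -
  have A: "A \<in> sets (lborel \<Otimes>\<^sub>M (lborel :: 'a measure))" using assms unfolding lborel_prod by simp
  have "emeasure (lebesgue \<Otimes>\<^sub>M lebesgue) A = (\<integral>\<^sup>+x. emeasure lebesgue (Pair x -` A) \<partial>lebesgue)"
    by (rule lebesgue.emeasure_pair_measure_alt[OF sets_borel_lebesgue_pair[OF assms]])
  also have "\<dots> = (\<integral>\<^sup>+x. emeasure lborel (Pair x -` A) \<partial>lborel)"
    using sets_Pair1[OF A] by (simp add: nn_integral_completion)
  also have "\<dots> = emeasure (lborel \<Otimes>\<^sub>M lborel) A"
    by (rule lborel.emeasure_pair_measure_alt[OF A, symmetric])
  finally show ?thesis by (simp add: lborel_prod)
qed

lemma nn_integral_lebesgue_pair:
  fixes F :: "'a::euclidean_space \<times> 'a \<Rightarrow> ennreal"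
  assumes "F \<in> borel_measurable borel"
  shows "(\<integral>\<^sup>+z. F z \<partial>(lebesgue \<Otimes>\<^sub>M lebesgue)) = (\<integral>\<^sup>+z. F z \<partial>lborel)"
  by (rule nn_integral_subalgebra[symmetric])
    (use assms sets_borel_lebesgue_pair in \<open>auto simp: emeasure_lebesgue_pair space_pair_measure\<close>)

lemma integral_lebesgue_pair:
  fixes F :: "'a::euclidean_space \<times> 'a \<Rightarrow> real"
  assumes "F \<in> borel_measurable borel"
  shows "(\<integral>z. F z \<partial>(lebesgue \<Otimes>\<^sub>M lebesgue)) = (\<integral>z. F z \<partial>lborel)"
  by (rule integral_subalgebra[symmetric])
    (use assms sets_borel_lebesgue_pair in \<open>auto simp: emeasure_lebesgue_pair space_pair_measure\<close>)

lemma AE_lebesgue_pair: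
  fixes P :: "'a::euclidean_space \<Rightarrow> bool"
  assumes "AE x in lborel. P x"
  shows "AE z in (lebesgue \<Otimes>\<^sub>M lebesgue). P (fst z) \<and> P (snd z)"
proof -
  obtain N where N: "{z \<in> space lborel. \<not> (P (fst z) \<and> P (snd z))} \<subseteq> N" "emeasure lborel N = 0" "N \<in> sets lborel"
    by (rule AE_E[OF AE_lborel_pair[OF assms]])
  then have "N \<in> null_sets (lebesgue \<Otimes>\<^sub>M lebesgue)"
    by (simp add: null_sets_def emeasure_lebesgue_pair sets_borel_lebesgue_pair)
  then show ?thesis by (rule AE_I') (use N in auto)
qed

lemma gagliardo_energy_eq:
  fixes w w' :: "real ^ 'n \<Rightarrow> real"
  assumes w': "AE x in lborel. w x = w' x" and [measurable]: "w' \<in> borel_measurable borel" "A \<in> sets borel"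
  shows "gagliardo_energy s p A w =
    local_energy (real CARD('n) + s * p) p A w'"
proof -
  define q where "q = real CARD('n) + s * p"
  have [measurable]: "A \<times> A \<in> sets borel" by (intro borel_Times) auto
  have "gagliardo_energy s p A w = (\<integral>\<^sup>+z. ennreal (\<bar>incr w z\<bar> powr p / norm (fst z - snd z) powr q) * indicator (A \<times> A) z \<partial>(lebesgue \<Otimes>\<^sub>M lebesgue))"
    by (simp add: gagliardo_energy_def q_def case_prod_beta')
  also have "\<dots> = (\<integral>\<^sup>+z. ennreal (kern q (fst z) (snd z)) * (indicator (A \<times> A) z * ennreal (\<bar>incr w' z\<bar> powr p)) \<partial>(lebesgue \<Otimes>\<^sub>M lebesgue))"
  proof (rule nn_integral_cong_AE)
    show "AE z in lebesgue \<Otimes>\<^sub>M lebesgue. ennreal (\<bar>incr w z\<bar> powr p / norm (fst z - snd z) powr q) * indicator (A \<times> A) z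
       = ennreal (kern q (fst z) (snd z)) * (indicator (A \<times> A) z * ennreal (\<bar>incr w' z\<bar> powr p))"
      using AE_lebesgue_pair[OF w']
      by eventually_elim (auto simp: indicator_def ennreal_mult[symmetric])
  qed
  also have "\<dots> = (\<integral>\<^sup>+z. ennreal (kern q (fst z) (snd z)) * (indicator (A \<times> A) z * ennreal (\<bar>incr w' z\<bar> powr p)) \<partial>lborel)"
    by (rule nn_integral_lebesgue_pair) measurable
  also have "\<dots> = local_energy q p A w'"
    unfolding kernel_measure_def by (subst nn_integral_density) auto
  finally show ?thesis by (simp add: q_def)
qed

text \<open>Replacing u by u' under a Bochner integral requires measurability of both integrands.
  The one built from u is measurable for the product of Lebesgue measures because u agrees almost
  everywhere with a Borel function and \<open>lebesgue\<close> is complete.\<close>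

lemma frac_p_Laplacian_form_eq:
  fixes u u' \<phi> :: "real ^ 'n \<Rightarrow> real"
  assumes u': "AE x in lborel. u x = u' x" and [measurable]: "u' \<in> borel_measurable borel" "\<phi> \<in> borel_measurable borel"
  shows "frac_p_Laplacian_form s p u \<phi> =
    (\<integral>z. signed_power p (incr u' z) * (incr \<phi> z) \<partial>kernel_measure (real CARD('n) + s * p))"
proof -
  define q where "q = real CARD('n) + s * p"
  let ?J = "\<lambda>u z. signed_power p (incr u z) * (incr \<phi> z)"
  have u_leb: "u \<in> borel_measurable lebesgue"
  proof (rule borel_measurable_AE)
    show "u' \<in> borel_measurable lebesgue" by (simp add: measurable_completion)
    show "AE x in lebesgue. u' x = u x" using AE_completion[OF u'] by eventually_elim simp
  qed
  have id: "g \<in> borel_measurable borel \<Longrightarrow> g \<in> borel_measurable (lebesgue \<Otimes>\<^sub>M lebesgue)" for g :: "(real ^ 'n) \<times> (real ^ 'n) \<Rightarrow> real"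
    using measurable_compose[OF id_measurable_lebesgue_pair] by blast
  have "(\<lambda>z. incr \<phi> z) \<in> borel_measurable borel" by measurable
  note \<phi>_pair = id[OF this]
  have "(\<lambda>z :: (real ^ 'n) \<times> (real ^ 'n). kern q (fst z) (snd z)) \<in> borel_measurable borel" by measurable
  note kernel_pair = id[OF this]
  have "(\<lambda>z. signed_power p (incr u z)) \<in> borel_measurable (lebesgue \<Otimes>\<^sub>M lebesgue)"
    by (intro measurable_compose[OF _ signed_power_measurable] borel_measurable_diff
        measurable_compose[OF measurable_fst u_leb] measurable_compose[OF measurable_snd u_leb])
  then have J_pair: "(\<lambda>z. kern q (fst z) (snd z) * ?J u z) \<in> borel_measurable (lebesgue \<Otimes>\<^sub>M lebesgue)"
    by (intro borel_measurable_times kernel_pair \<phi>_pair)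
  have "frac_p_Laplacian_form s p u \<phi> = (\<integral>z. kern q (fst z) (snd z) * ?J u z \<partial>(lebesgue \<Otimes>\<^sub>M lebesgue))"
    by (simp add: frac_p_Laplacian_form_def q_def case_prod_beta' signed_power_def)
  also have "\<dots> = (\<integral>z. kern q (fst z) (snd z) * ?J u' z \<partial>(lebesgue \<Otimes>\<^sub>M lebesgue))"
  proof (rule integral_cong_AE)
    show "(\<lambda>z. kern q (fst z) (snd z) * ?J u' z) \<in> borel_measurable (lebesgue \<Otimes>\<^sub>M lebesgue)"
      by (rule id) measurable
    show "AE z in lebesgue \<Otimes>\<^sub>M lebesgue. kern q (fst z) (snd z) * ?J u z = kern q (fst z) (snd z) * ?J u' z"
      using AE_lebesgue_pair[OF u'] by eventually_elim simp
  qed (rule J_pair)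
  also have "\<dots> = (\<integral>z. kern q (fst z) (snd z) * ?J u' z \<partial>lborel)"
    by (rule integral_lebesgue_pair) measurable
  also have "\<dots> = (\<integral>z. ?J u' z \<partial>kernel_measure q)"
    unfolding kernel_measure_def by (subst integral_density) auto
  finally show ?thesis by (simp add: q_def)
qed

section \<open>Borel representatives of solutions and their truncations\<close>

lemma Borel_representative:
  fixes u :: "'a::euclidean_space \<Rightarrow> real"
  assumes \<Omega>: "open \<Omega>" and u: "set_borel_measurable lebesgue \<Omega> u"
    and pos: "AE x in lebesgue. x \<in> \<Omega> \<longrightarrow> 0 < u x" and zero: "AE x in lebesgue. x \<notin> \<Omega> \<longrightarrow> u x = 0"
  obtains u' where "u' \<in> borel_measurable borel" "AE x in lborel. u x = u' x"
    "\<And>x. x \<in> \<Omega> \<Longrightarrow> 0 < u' x" "\<And>x. x \<notin> \<Omega> \<Longrightarrow> u' x = 0"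
proof -
  have "(\<lambda>x. indicator \<Omega> x * u x) \<in> borel_measurable (completion lborel)"
    using u by (simp add: set_borel_measurable_def)
  then obtain g where [measurable]: "g \<in> borel_measurable lborel" and g: "AE x in lborel. indicator \<Omega> x * u x = g x"
    using completion_ex_borel_measurable_real by blast
  have [measurable]: "\<Omega> \<in> sets borel" using \<Omega> by simp
  \<comment> \<open>The value 1 is a default on the null set of points of \<Omega> where g fails to
    be positive; it makes the sign conditions hold everywhere, so that pointwise arguments need no
    exceptional set.\<close>
  define u' where "u' = (\<lambda>x. if x \<in> \<Omega> then if 0 < g x then g x else 1 else 0)"
  have "AE x in lborel. x \<in> \<Omega> \<longrightarrow> 0 < u x" "AE x in lborel. x \<notin> \<Omega> \<longrightarrow> u x = 0"
    using pos zero by (simp_all add: AE_completion_iff)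
  then have "AE x in lborel. u x = u' x"
    using g by eventually_elim (auto simp: u'_def indicator_def)
  moreover have "u' \<in> borel_measurable borel" unfolding u'_def by measurable
  ultimately show ?thesis using that[of u'] by (auto simp: u'_def)
qed

text \<open>The truncation is constant below \<epsilon>, and above \<epsilon> the difference
  quotients of t^\<alpha> are at least \<epsilon>^(\<alpha>-1). Writing t^\<alpha> = t^(\<alpha>-1)
  t gives this from monotonicity alone.\<close>

lemma truncation_Lipschitz_power:
  assumes "1 \<le> \<alpha>" "0 < \<epsilon>" "0 \<le> (a::real)" "0 \<le> b"
  shows "\<bar>max (a - \<epsilon>) 0 - max (b - \<epsilon>) 0\<bar> \<le> \<epsilon> powr (1 - \<alpha>) * \<bar>a powr \<alpha> - b powr \<alpha>\<bar>"
proof -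
  have less: "max (a - \<epsilon>) 0 - max (b - \<epsilon>) 0 \<le> \<epsilon> powr (1 - \<alpha>) * (a powr \<alpha> - b powr \<alpha>)"
    if "b \<le> a" "0 \<le> b" for a b :: real
  proof (cases "\<epsilon> < a")
    case True
    \<comment> \<open>The truncation grows only on the part of [b, a] above \<epsilon>, which is
      [m, a].\<close>
    define m where "m = max b \<epsilon>"
    have m: "0 < m" "m \<le> a" "\<epsilon> \<le> m" "b \<le> m" using that True assms by (auto simp: m_def)
    have pw: "t powr \<alpha> = t powr (\<alpha> - 1) * t" if "0 < t" for t :: real
      using that powr_add[of t "\<alpha> - 1" 1] by simp
    have "\<epsilon> powr (\<alpha> - 1) * (a - m) \<le> m powr (\<alpha> - 1) * (a - m)"
      using m assms by (intro mult_right_mono powr_mono2) auto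
    also have "\<dots> \<le> a powr \<alpha> - m powr \<alpha>"
    proof -
      have "m powr (\<alpha> - 1) * a \<le> a powr (\<alpha> - 1) * a"
        using m assms by (intro mult_right_mono powr_mono2) auto
      then show ?thesis using pw[of a] pw[of m] m by (simp add: right_diff_distrib)
    qed
    also have "\<dots> \<le> a powr \<alpha> - b powr \<alpha>"
      using m that assms by (intro diff_left_mono powr_mono2) auto
    finally have "\<epsilon> powr (1 - \<alpha>) * (\<epsilon> powr (\<alpha> - 1) * (a - m)) \<le> \<epsilon> powr (1 - \<alpha>) * (a powr \<alpha> - b powr \<alpha>)"
      by (intro mult_left_mono) auto
    moreover have "\<epsilon> powr (1 - \<alpha>) * \<epsilon> powr (\<alpha> - 1) = 1"
      using assms by (simp add: powr_add[symmetric])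
    ultimately have "a - m \<le> \<epsilon> powr (1 - \<alpha>) * (a powr \<alpha> - b powr \<alpha>)" by (simp add: mult.assoc[symmetric])
    moreover have "max (a - \<epsilon>) 0 - max (b - \<epsilon>) 0 = a - m" using True by (auto simp: m_def)
    ultimately show ?thesis by simp
  next
    case False
    moreover have "b powr \<alpha> \<le> a powr \<alpha>" using that assms by (intro powr_mono2) auto
    ultimately show ?thesis using that by simp
  qed
  show ?thesis
  proof (cases "b \<le> a")
    case True
    then show ?thesis using less[OF True] assms powr_mono2[of \<alpha> b a] by simp
  next
    case False
    then show ?thesis using less[of a b] assms powr_mono2[of \<alpha> a b] by (simp add: abs_minus_commute)
  qed
qed

text \<open>All conditions on u are moved to a single Borel representative, while the right-hand
  side keeps the original u. Energy and L^p norm of the truncations are bounded through the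
  Lipschitz dependence on u^\<alpha>.\<close>

lemma weak_solution_representative:
  fixes u f :: "real ^ 'n \<Rightarrow> real"
  assumes p: "1 < p" and s: "0 < s" and \<gamma>: "0 < \<gamma>" and \<Omega>: "open \<Omega>" and u: "weak_solution s p \<gamma> \<Omega> f u"
  obtains u' where "local_weak_solution (real CARD('n) + s * p) p \<Omega> u' (\<lambda>x. f x / u x powr \<gamma>)"
    "AE x in lborel. u x = u' x" "\<And>x. x \<in> \<Omega> \<Longrightarrow> 0 < u' x" "\<And>x. x \<notin> \<Omega> \<Longrightarrow> u' x = 0"
    "\<And>\<epsilon>. 0 < \<epsilon> \<Longrightarrow> finite_W (real CARD('n) + s * p) p (\<lambda>x. max (u' x - \<epsilon>) 0)"
proof -
  define q where "q = real CARD('n) + s * p"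
  note ws = u[unfolded weak_solution_def]
  obtain u' where u': "u' \<in> borel_measurable borel" "AE x in lborel. u x = u' x"
    "\<And>x. x \<in> \<Omega> \<Longrightarrow> 0 < u' x" "\<And>x. x \<notin> \<Omega> \<Longrightarrow> u' x = 0"
    using Borel_representative[OF \<Omega>, of u] ws by (auto simp: in_Lp_def)
  note [measurable] = u'(1)
  have [measurable]: "\<Omega> \<in> sets borel" using \<Omega> by simp
  have nonneg: "0 \<le> u' x" for x using u'(3,4)[of x] by (cases "x \<in> \<Omega>") (auto intro: less_imp_le)
  have contained: "compactly_contained K \<Omega>" if "compact K" "K \<subseteq> \<Omega>" for K
    using that by (simp add: compactly_contained_def compact_imp_closed borel_compact)
  have sol: "local_weak_solution q p \<Omega> u' (\<lambda>x. f x / u x powr \<gamma>)"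
  proof
    show "1 < p" "real CARD('n) < q" "open \<Omega>" using p s \<Omega> by (auto simp: q_def)
    show "u' \<in> borel_measurable borel" by (rule u')
    have "integrable lebesgue (\<lambda>x. indicator \<Omega> x *\<^sub>R \<bar>u x\<bar> powr (p - 1))"
      using ws by (simp add: in_Lp_def set_integrable_def)
    then have "(\<integral>\<^sup>+x. ennreal (norm (indicator \<Omega> x *\<^sub>R \<bar>u x\<bar> powr (p - 1))) \<partial>lborel) < \<infinity>"
      by (simp add: integrable_iff_bounded nn_integral_completion)
    also have "(\<integral>\<^sup>+x. ennreal (norm (indicator \<Omega> x *\<^sub>R \<bar>u x\<bar> powr (p - 1))) \<partial>lborel) = (\<integral>\<^sup>+x. ennreal (\<bar>u' x\<bar> powr (p - 1)) \<partial>lborel)"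
      by (rule nn_integral_cong_AE) (use u'(2,4) p in \<open>auto simp: indicator_def elim!: eventually_mono\<close>)
    finally show "(\<integral>\<^sup>+x. ennreal (\<bar>u' x\<bar> powr (p - 1)) \<partial>lborel) < \<infinity>" .
    show "local_energy q p K u' < \<infinity>"
      if K: "compact K" "K \<subseteq> \<Omega>" for K
      using ws contained[OF K] gagliardo_energy_eq[OF u'(2,1) borel_compact[OF K(1)], of s p]
      by (auto simp: in_W_loc_def q_def)
    show "set_integrable lebesgue K (\<lambda>x. f x / u x powr \<gamma>)" if K: "compact K" "K \<subseteq> \<Omega>" for K
      using ws contained[OF K] by (auto simp: in_L1_loc_def)
    show "(\<integral>z. signed_power p (incr u' z) * (incr \<phi> z) \<partial>kernel_measure q)
        = (LINT x:\<Omega>|lebesgue. f x / u x powr \<gamma> * \<phi> x)" if "test_function \<Omega> \<phi>" for \<phi>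
    proof -
      have "\<phi> \<in> borel_measurable borel"
        using that C_infinity_continuous by (auto simp: test_function_def intro: borel_measurable_continuous_onI)
      from frac_p_Laplacian_form_eq[OF u'(2,1) this, of s p] show ?thesis
        using ws that by (auto simp: q_def)
    qed
  qed
  have trunc: "finite_W q p (\<lambda>x. max (u' x - \<epsilon>) 0)" if \<epsilon>: "0 < \<epsilon>" for \<epsilon>
  proof -
    define \<alpha> where "\<alpha> = max ((\<gamma> + p - 1) / p) 1"
    have \<alpha>: "1 \<le> \<alpha>" by (simp add: \<alpha>_def)
    have W: "in_W s p (\<lambda>x. u x powr \<alpha>)" using ws by (simp add: power_in_W0_def in_W0_def \<alpha>_def)
    have ae: "AE x in lborel. u x powr \<alpha> = u' x powr \<alpha>" using u'(2) by eventually_elim simp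
    have [measurable]: "(\<lambda>x. u' x powr \<alpha>) \<in> borel_measurable borel" by measurable
    have en: "energy q p (\<lambda>x. u' x powr \<alpha>) < \<infinity>"
      using W gagliardo_energy_eq[OF ae, of UNIV s p] by (simp add: in_W_def energy_def q_def)
    define C where "C = \<epsilon> powr (1 - \<alpha>)"
    have C: "0 \<le> C" by (simp add: C_def)
    have Lip: "\<bar>max (u' x - \<epsilon>) 0 - max (u' y - \<epsilon>) 0\<bar> \<le> C * \<bar>u' x powr \<alpha> - u' y powr \<alpha>\<bar>" for x y
      unfolding C_def by (rule truncation_Lipschitz_power[OF \<alpha> \<epsilon> nonneg nonneg])
    have "energy q p (\<lambda>x. max (u' x - \<epsilon>) 0) \<le> ennreal (C powr p) * energy q p (\<lambda>x. u' x powr \<alpha>)"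
      by (rule energy_le[OF Lip]) (use p C in auto)
    also have "\<dots> < \<infinity>" using en by (simp add: ennreal_mult_less_top)
    finally have 1: "energy q p (\<lambda>x. max (u' x - \<epsilon>) 0) < \<infinity>" .
    have "integrable lebesgue (\<lambda>x. \<bar>u x powr \<alpha>\<bar> powr p)"
      using W by (simp add: in_W_def in_Lp_def set_integrable_def)
    then have "(\<integral>\<^sup>+x. ennreal (\<bar>u x powr \<alpha>\<bar> powr p) \<partial>lborel) < \<infinity>"
      by (simp add: integrable_iff_bounded nn_integral_completion)
    also have "(\<integral>\<^sup>+x. ennreal (\<bar>u x powr \<alpha>\<bar> powr p) \<partial>lborel) = (\<integral>\<^sup>+x. ennreal (\<bar>u' x powr \<alpha>\<bar> powr p) \<partial>lborel)"
      by (rule nn_integral_cong_AE) (use ae in \<open>auto elim!: eventually_mono\<close>)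
    finally have Lp: "(\<integral>\<^sup>+x. ennreal (\<bar>u' x powr \<alpha>\<bar> powr p) \<partial>lborel) < \<infinity>" .
    have "(\<integral>\<^sup>+x. ennreal (\<bar>max (u' x - \<epsilon>) 0\<bar> powr p) \<partial>lborel) \<le> (\<integral>\<^sup>+x. ennreal (C powr p) * ennreal (\<bar>u' x powr \<alpha>\<bar> powr p) \<partial>lborel)"
    proof (rule nn_integral_mono)
      fix x
      \<comment> \<open>The Lipschitz estimate is applied against the value 0, at which the
        truncation and the power both vanish.\<close>
      have "\<bar>max (u' x - \<epsilon>) 0\<bar> \<le> C * \<bar>u' x powr \<alpha>\<bar>"
        using truncation_Lipschitz_power[OF \<alpha> \<epsilon> nonneg[of x], of 0] \<epsilon> by (simp add: C_def)
      then have "\<bar>max (u' x - \<epsilon>) 0\<bar> powr p \<le> (C * \<bar>u' x powr \<alpha>\<bar>) powr p" using p by (intro powr_mono2) auto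
      also have "\<dots> = C powr p * \<bar>u' x powr \<alpha>\<bar> powr p" by (rule powr_mult)
      finally show "ennreal (\<bar>max (u' x - \<epsilon>) 0\<bar> powr p) \<le> ennreal (C powr p) * ennreal (\<bar>u' x powr \<alpha>\<bar> powr p)"
        by (simp add: ennreal_mult[symmetric] ennreal_leI)
    qed
    also have "\<dots> = ennreal (C powr p) * (\<integral>\<^sup>+x. ennreal (\<bar>u' x powr \<alpha>\<bar> powr p) \<partial>lborel)"
      by (rule nn_integral_cmult) measurable
    also have "\<dots> < \<infinity>" using Lp by (simp add: ennreal_mult_less_top)
    finally have 2: "(\<integral>\<^sup>+x. ennreal (\<bar>max (u' x - \<epsilon>) 0\<bar> powr p) \<partial>lborel) < \<infinity>" .
    show ?thesis using 1 2 by (simp add: finite_W_def)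
  qed
  show ?thesis by (rule that[OF sol[unfolded q_def] u'(2,3,4) trunc[unfolded q_def]])
qed

section \<open>Ordering of two solutions and uniqueness\<close>

lemma weak_solution_le:
  fixes u v f :: "real ^ 'n \<Rightarrow> real"
  assumes p: "1 < p" and s: "0 < s" "s < 1" and \<Omega>: "smooth_bounded_domain \<Omega>" and \<gamma>: "0 < \<gamma>"
    and f: "AE x in lebesgue. x \<in> \<Omega> \<longrightarrow> 0 \<le> f x"
    and u: "weak_solution s p \<gamma> \<Omega> f u" and v: "weak_solution s p \<gamma> \<Omega> f v"
  shows "AE x in lborel. u x \<le> v x"
proof -
  define q where "q = real CARD('n) + s * p"
  have dom: "open \<Omega>" "bounded \<Omega>" "smooth_boundary \<Omega>" using \<Omega> by (auto simp: smooth_bounded_domain_def)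
  obtain u' where u': "local_weak_solution q p \<Omega> u' (\<lambda>x. f x / u x powr \<gamma>)"
    "AE x in lborel. u x = u' x" "\<And>x. x \<in> \<Omega> \<Longrightarrow> 0 < u' x" "\<And>x. x \<notin> \<Omega> \<Longrightarrow> u' x = 0"
    "\<And>\<epsilon>. 0 < \<epsilon> \<Longrightarrow> finite_W q p (\<lambda>x. max (u' x - \<epsilon>) 0)"
    by (rule weak_solution_representative[OF p s(1) \<gamma> dom(1) u, folded q_def]) (rule that, assumption+)
  obtain v' where v': "local_weak_solution q p \<Omega> v' (\<lambda>x. f x / v x powr \<gamma>)"
    "AE x in lborel. v x = v' x" "\<And>x. x \<in> \<Omega> \<Longrightarrow> 0 < v' x" "\<And>x. x \<notin> \<Omega> \<Longrightarrow> v' x = 0"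
    by (rule weak_solution_representative[OF p s(1) \<gamma> dom(1) v, folded q_def]) (rule that, assumption+)
  have nonneg: "0 \<le> u' x" "0 \<le> v' x" for x
    using u'(3,4)[of x] v'(3,4)[of x] by (cases "x \<in> \<Omega>"; force)+
  have q: "q < p + real CARD('n)" using p s by (simp add: q_def)
  \<comment> \<open>The map t -> t^(-\<gamma>) is decreasing on t > 0 and f is nonnegative, so the
    larger solution has the smaller right-hand side.\<close>
  have h: "AE x in lebesgue. x \<in> \<Omega> \<longrightarrow> v' x \<le> u' x \<longrightarrow> f x / u x powr \<gamma> \<le> f x / v x powr \<gamma>"
    using AE_completion[OF u'(2)] AE_completion[OF v'(2)] f
  proof eventually_elim
    case (elim x)
    show ?case
    proof (intro impI)
      assume x: "x \<in> \<Omega>" "v' x \<le> u' x"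
      then have "0 < v x" "v x \<le> u x" using elim v'(3)[of x] by auto
      then show "f x / u x powr \<gamma> \<le> f x / v x powr \<gamma>"
        using elim(3) x \<gamma> by (intro divide_left_mono powr_mono2 mult_pos_pos) auto
    qed
  qed
  \<comment> \<open>The levels \<epsilon> = 1 / (n + 1) are countably many, so one null set serves
    all of them before \<epsilon> tends to 0.\<close>
  have "AE x in lborel. u' x - inverse (real (Suc n)) \<le> v' x" for n
    by (rule truncated_comparison[OF dom(2,3) q u'(1) v'(1) nonneg u'(4) v'(4) h _ u'(5)]) auto
  then have "AE x in lborel. \<forall>n. u' x - inverse (real (Suc n)) \<le> v' x" by (simp add: AE_all_countable)
  then show ?thesis
    using u'(2) v'(2)
  proof eventually_elim
    case (elim x)
    have "(\<lambda>n. u' x - inverse (real (Suc n))) \<longlonglongrightarrow> u' x - 0"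
      by (intro tendsto_intros LIMSEQ_inverse_real_of_nat)
    then have "u' x \<le> v' x" using elim(1) by (intro LIMSEQ_le_const2) auto
    then show ?case using elim by simp
  qed
qed

theorem theorem1p6:
  fixes p s \<gamma> :: real
    and \<Omega> :: "(real ^ 'n) set"
    and f u v :: "real ^ 'n \<Rightarrow> real"
  assumes "1 < p"
    and "0 < s" "s < 1"
    and "smooth_bounded_domain \<Omega>"
    and "s * p < real CARD('n)"
    and "0 < \<gamma>"
    and "set_integrable lebesgue \<Omega> f"
    and "AE x in lebesgue. x \<in> \<Omega> \<longrightarrow> 0 \<le> f x"
    and "weak_solution s p \<gamma> \<Omega> f u"
    and "weak_solution s p \<gamma> \<Omega> f v"
    and "truncations_in_W0 s p \<Omega> u \<or> power_in_W0 s p \<gamma> \<Omega> u"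
    and "truncations_in_W0 s p \<Omega> v \<or> power_in_W0 s p \<gamma> \<Omega> v"
  shows "AE x in lebesgue. u x = v x"
proof -
  have "AE x in lborel. u x \<le> v x" "AE x in lborel. v x \<le> u x"
    using assms by (auto intro: weak_solution_le)
  then have "AE x in lborel. u x = v x" by eventually_elim simp
  then show ?thesis by (rule AE_completion)
qed

end
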